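(* Let $w\colon\mathbb{R}\to\mathbb{R}$ be a fixed smooth function supported on $[0,1]$ with $\int_0^1 w(t)^2\,dt>0$. Let $\theta$ be an irrational real number for which there is a constant $C=C(\theta)>0$ such that for all positive integers $q$, $$\|q\theta\| := \min_{n\in\mathbb{Z}}|q\theta-n| \ \ge\ C\exp(-q^{1/4}).$$ Then there exist a constant $x_0>0$ depending only on $w$, and constants $c_1,c_2>0$ depending only on $\theta$ and $w$, such that for every prime $r$ and every real $x$ with $x_0\le x\le r$, $$c_1\sqrt{x}\ \le\ \frac{1}{r-1}\sum_{\chi \bmod r}\Big|\sum_{1\le n\le x}\chi(n)\,e(n\theta)\,w(n/x)\Big|\ \le\ c_2\sqrt{x}.$$
   Context: $e(t):=e^{2\pi i t}$. The outer sum runs over all $r-1$ Dirichlet characters $\chi$ modulo $r$ (including the principal one); the inner sum is over positive integers $n\le x$. *)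

theory Defs
  imports "HOL-Analysis.Analysis" "HOL-Number_Theory.Number_Theory"
begin

definition smooth :: "(real \<Rightarrow> real) \<Rightarrow> bool" where
  "smooth w \<longleftrightarrow> (\<forall>k x. ((deriv ^^ k) w) field_differentiable at x)"

definition e :: "real \<Rightarrow> complex" where
  "e t = exp (2 * complex_of_real pi * \<i> * complex_of_real t)"

text \<open>Distance to the nearest integer. The infimum is a minimum, by \<open>nint_dist_attained\<close>.\<close>

definition nint_dist :: "real \<Rightarrow> real" where
  "nint_dist t = (INF n::int. \<bar>t - of_int n\<bar>)"

lemma nint_dist_le: "nint_dist t \<le> \<bar>t - of_int n\<bar>"
  unfolding nint_dist_def by (intro cINF_lower) (auto intro!: bdd_belowI[of _ 0])

lemma nint_dist_attained: "\<exists>n::int. nint_dist t = \<bar>t - of_int n\<bar>"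
proof -
  have "\<bar>t - of_int (round t)\<bar> \<le> nint_dist t"
    unfolding nint_dist_def by (rule cINF_greatest) (auto simp: round_diff_minimal)
  then show ?thesis
    using nint_dist_le[of t "round t"] by (intro exI[of _ "round t"]) simp
qed

text \<open>Dirichlet characters modulo \<open>r\<close> are viewed as functions on the natural numbers; by
  periodicity such a function is the restriction of a unique character on the integers.\<close>

definition dirichlet_character :: "nat \<Rightarrow> (nat \<Rightarrow> complex) \<Rightarrow> bool" where
  "dirichlet_character r chi \<longleftrightarrow>
     (\<forall>m n. chi (m * n) = chi m * chi n) \<and>
     (\<forall>n. chi (n + r) = chi n) \<and>
     (\<forall>n. chi n \<noteq> 0 \<longleftrightarrow> coprime n r)"

definition dirichlet_characters :: "nat \<Rightarrow> (nat \<Rightarrow> complex) set" where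
  "dirichlet_characters r = {chi. dirichlet_character r chi}"

lemma dirichlet_character_mod:
  assumes "dirichlet_character r chi"
  shows "chi (n mod r) = chi n"
proof -
  have "chi (m + k * r) = chi m" for m k
  proof (induction k)
    case (Suc k)
    have "chi (m + Suc k * r) = chi ((m + k * r) + r)" by (simp add: algebra_simps)
    also have "\<dots> = chi (m + k * r)" using assms unfolding dirichlet_character_def by blast
    finally show ?case using Suc by simp
  qed simp
  from this[of "n mod r" "n div r"] show ?thesis by simp
qed

lemma dirichlet_character_1:
  assumes "dirichlet_character r chi"
  shows "chi 1 = 1"
proof -
  have "chi 1 * chi 1 = chi 1" "chi 1 \<noteq> 0"
    using assms unfolding dirichlet_character_def by (metis mult_1, simp)
  then show ?thesis by simp
qed

lemma dirichlet_character_root_of_unity: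
  assumes "dirichlet_character r chi" "coprime n r"
  shows "chi n ^ totient r = 1"
proof -
  have pow: "chi (n ^ k) = chi n ^ k" for k
    using assms(1) dirichlet_character_1[OF assms(1)]
    by (induction k) (auto simp: dirichlet_character_def)
  have "chi (n ^ totient r) = chi 1"
    using euler_theorem[OF assms(2)] dirichlet_character_mod[OF assms(1)]
    unfolding cong_def by metis
  then show ?thesis using pow dirichlet_character_1[OF assms(1)] by simp
qed

lemma finite_dirichlet_characters:
  assumes "r > 0"
  shows "finite (dirichlet_characters r)"
proof (rule inj_on_finite)
  let ?Z = "insert 0 {z::complex. z ^ totient r = 1}"
  let ?f = "\<lambda>chi :: nat \<Rightarrow> complex. restrict chi {..<r}"
  show "inj_on ?f (dirichlet_characters r)"
  proof (rule inj_onI, rule ext)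
    fix chi psi n
    assume *: "chi \<in> dirichlet_characters r" "psi \<in> dirichlet_characters r" "?f chi = ?f psi"
    have "chi (n mod r) = psi (n mod r)"
      using fun_cong[OF *(3), of "n mod r"] assms by simp
    then show "chi n = psi n"
      using *(1,2) dirichlet_character_mod unfolding dirichlet_characters_def mem_Collect_eq
      by metis
  qed
  show "?f ` dirichlet_characters r \<subseteq> {..<r} \<rightarrow>\<^sub>E ?Z"
  proof (rule image_subsetI, rule restrict_PiE_iff[THEN iffD2], rule ballI)
    fix chi n
    assume "chi \<in> dirichlet_characters r"
    then have chi: "dirichlet_character r chi" by (simp add: dirichlet_characters_def)
    show "chi n \<in> ?Z"
    proof (cases "coprime n r")
      case True
      then show ?thesis using dirichlet_character_root_of_unity[OF chi] by blast
    next
      case False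
      then have "chi n = 0" using chi unfolding dirichlet_character_def by blast
      then show ?thesis by blast
    qed
  qed
  have "finite {z::complex. z ^ totient r = 1}"
    by (rule finite_roots_unity) (use assms in \<open>simp add: Suc_le_eq\<close>)
  then show "finite ({..<r} \<rightarrow>\<^sub>E ?Z)"
    by (intro finite_PiE) auto
qed

end

theory Submission
  imports Defs
begin

text \<open>
  Write \<open>S(\<chi>)\<close> for the inner sum and \<open>\<langle>\<cdot>\<rangle>\<close> for the average over the characters modulo \<open>r\<close>.
  Orthogonality gives \<open>\<langle>|S|\<^sup>2\<rangle> = \<Sum> w(n/x)\<^sup>2\<close>, which has order \<open>x\<close>; the upper bound for
  \<open>\<langle>|S|\<rangle>\<close> is then the Cauchy-Schwarz inequality. For the lower bound, two applications of
  Cauchy-Schwarz give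
  \<open>\<langle>|S T|\<rangle>\<^sup>4 \<le> \<langle>|S|\<rangle>\<^sup>2 \<langle>|S|\<^sup>2\<rangle> \<langle>|T|\<^sup>4\<rangle>\<close> for every function \<open>T\<close> of the character
  (\<open>sum_mult_fourth_power_le\<close>). So it suffices to find a \<open>T\<close> that correlates with \<open>S\<close>, in the
  sense that \<open>\<langle>|S T|\<rangle>\<close> has order \<open>x\<close>, and whose fourth moment is \<open>O(x\<^sup>2)\<close>. For \<open>\<theta> = 0\<close>
  the fourth moment of \<open>S\<close> itself is larger by a logarithm, and removing this logarithm is where
  the Diophantine condition enters.

  If \<open>x\<^sup>2 \<le> r\<close>, take \<open>T = S\<close>. The congruence \<open>m n' = m' n\<close> modulo \<open>r\<close> between numbers up to \<open>x\<close>
  is then an equation, so the fourth moment is the sum, over the reduced fractions \<open>a/b\<close>, of the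
  squared absolute values of \<open>\<Sum>\<^sub>g w(ga/x) w(gb/x) e(g(a-b)\<theta>)\<close>. Such a sum has at most \<open>x/M\<close>
  terms, where \<open>M = max(a,b)\<close>, and partial summation bounds it by a multiple of the inverse of the
  distance \<open>\<parallel>(a-b)\<theta>\<parallel>\<close> to the nearest integer. The fraction \<open>1/1\<close> contributes \<open>O(x\<^sup>2)\<close>, and
  the others contribute \<open>O(x\<^sup>2)\<close> as soon as the sum of
  \<open>(min (1/M) (1/(y \<parallel>(a-b)\<theta>\<parallel>)))\<^sup>2\<close>, over the pairs of integers \<open>a \<noteq> b\<close> for which
  \<open>M = max(|a|,|b|)\<close> is at most \<open>y\<close>, is bounded uniformly in \<open>y\<close>. This is
  \<open>diophantine_pair_sum_bounded\<close>: the Diophantine condition makes differences \<open>a - b\<close> with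
  \<open>\<parallel>(a-b)\<theta>\<parallel>\<close> small so rare that the sum over the size \<open>M\<close> of the pair converges like
  \<open>\<Sum> 1 / (M (1 + ln (y/M))\<^sup>2)\<close>.

  If \<open>x\<^sup>2 > r\<close>, pass to the dual sum. For a nonprincipal character, \<open>\<surd>r |S(\<chi>)|\<close> is the absolute
  value of \<open>\<Sum>\<^sub>h \<chi>(h) cnj(F(h))\<close>, where \<open>F\<close> is the discrete Fourier transform of
  \<open>w(n/x) e(n\<theta>)\<close> modulo \<open>r\<close> (\<open>nonprincipal_fourier_transform\<close>). By Plancherel, applied both to
  \<open>F\<close> and to its multiple by \<open>1 - e(\<theta> + h/r)\<close>, most of the mass of \<open>F\<close> sits on the
  frequencies with \<open>\<parallel>\<theta> + h/r\<parallel> \<le> L/x\<close>, for a constant \<open>L\<close>. Let \<open>T\<close> be the part of the dual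
  sum over these frequencies, divided by \<open>\<surd>r\<close>. It correlates with the whole by orthogonality, and its frequencies
  lie, modulo \<open>r\<close>, in an interval around \<open>-r\<theta>\<close> of length \<open>O(r/x)\<close>. Its fourth moment is controlled
  by the number of solutions of \<open>h k' = h' k\<close> modulo \<open>r\<close> in that interval. With
  \<open>h' = h + g a\<close> and \<open>k' = k + g b\<close>, where \<open>a\<close> and \<open>b\<close> are coprime, this becomes \<open>h b = k a\<close>
  modulo \<open>r\<close>; since \<open>h\<close> and \<open>k\<close> are both close to \<open>-r\<theta>\<close>, it forces \<open>(a-b)\<theta>\<close> to be
  close to an integer. The count is therefore again governed by the same sum over pairs
  (\<open>card_ratio_quadruples_le\<close>).

  Small \<open>x\<close>, up to a bound depending on \<open>\<theta>\<close>, only need \<open>\<langle>|S|\<rangle> \<ge> \<langle>|S|\<^sup>2\<rangle> / max |S|\<close>.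
\<close>

section \<open>The exponential and the distance to the nearest integer\<close>

lemma e_add: "e (s + t) = e s * e t"
  by (simp add: e_def exp_add[symmetric] algebra_simps)

lemma e_0 [simp]: "e 0 = 1" by (simp add: e_def)

lemma e_of_int [simp]: "e (of_int n) = 1"
  unfolding e_def exp_eq_1 by (auto intro!: exI[of _ n])

lemma e_of_nat [simp]: "e (real n) = 1"
  using e_of_int[of "int n"] by simp

lemma e_of_nat_mult: "e (real n * t) = e t ^ n"
  by (simp add: e_def exp_of_nat_mult[symmetric] algebra_simps)

lemma cmod_e [simp]: "cmod (e t) = 1"
  by (simp add: e_def)

lemma e_ne_0 [simp]: "e t \<noteq> 0"
  by (simp add: e_def)

lemma cnj_e: "cnj (e t) = e (- t)"
  by (simp add: e_def exp_cnj)

lemma e_diff_of_int: "e (t - of_int n) = e t"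
  using e_add[of "t - of_int n" "of_int n"] by simp

lemma e_eq_1_iff: "e t = 1 \<longleftrightarrow> t \<in> \<int>"
proof
  assume "e t = 1"
  then obtain n :: int where "2 * pi * t = of_int (2 * n) * pi"
    unfolding e_def exp_eq_1 by auto
  then have "t = of_int n" by simp
  then show "t \<in> \<int>" by simp
qed (auto elim!: Ints_cases)

text \<open>
  Concavity of the sine on \<open>[0, \<pi>]\<close> places the graph above its chord from \<open>0\<close> to \<open>\<pi>/2\<close>.
\<close>

lemma sin_ge_chord:
  assumes "0 \<le> y" "y \<le> pi / 2"
  shows "sin y \<ge> 2 / pi * y"
proof -
  have "concave_on {0..pi} sin"
  proof (rule f''_le0_imp_concave)
    show "(sin has_real_derivative cos x) (at x)" for x :: real by (rule DERIV_sin)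
    show "(cos has_real_derivative - sin x) (at x)" for x :: real by (rule DERIV_cos)
  qed (auto intro: sin_ge_zero)
  from concave_onD[OF this, of "2 / pi * y" 0 "pi / 2"] assms show ?thesis
    by (simp add: field_simps)
qed

lemma nint_dist_eq_round: "nint_dist t = \<bar>t - of_int (round t)\<bar>"
  using nint_dist_attained[of t] nint_dist_le[of t "round t"] round_diff_minimal[of t]
  by (metis order_antisym)

lemma nint_dist_nonneg [simp]: "0 \<le> nint_dist t"
  by (simp add: nint_dist_eq_round)

lemma nint_dist_le_half: "nint_dist t \<le> 1 / 2"
  using of_int_round_abs_le[of t] by (simp add: nint_dist_eq_round abs_minus_commute)

lemma nint_dist_minus [simp]: "nint_dist (- t) = nint_dist t"
proof -
  have "nint_dist (- t) \<le> nint_dist t" for t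
    using nint_dist_le[of "- t" "- round t"] by (simp add: nint_dist_eq_round)
  from this[of t] this[of "- t"] show ?thesis by simp
qed

lemma nint_dist_pos: "t \<notin> \<int> \<Longrightarrow> 0 < nint_dist t"
  using nint_dist_attained[of t] by auto

lemma nint_dist_diff_le: "nint_dist (s - t) \<le> nint_dist s + nint_dist t"
  using nint_dist_le[of "s - t" "round s - round t"] by (simp add: nint_dist_eq_round)

text \<open>
  The chord \<open>|1 - e t|\<close> equals \<open>2 |sin (\<pi> s)|\<close>, where \<open>s\<close> is the distance from \<open>t\<close> to the nearest
  integer.
\<close>

lemma nint_dist_le_cmod: "4 * nint_dist t \<le> cmod (1 - e t)"
proof -
  define s where "s = t - of_int (round t)"
  have s: "nint_dist t = \<bar>s\<bar>" by (simp add: s_def nint_dist_eq_round)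
  have "e t = e s" unfolding s_def e_diff_of_int ..
  also have "\<dots> = exp (\<i> * of_real (2 * pi * s))" by (simp add: e_def mult_ac)
  finally have *: "cmod (1 - e t) = 2 * \<bar>sin (pi * s)\<bar>"
    using dist_exp_i_1[of "2 * pi * s"] by (simp add: norm_minus_commute)
  have "2 / pi * (pi * \<bar>s\<bar>) \<le> sin (pi * \<bar>s\<bar>)"
    using nint_dist_le_half[of t] s by (intro sin_ge_chord) auto
  moreover have "\<bar>sin (pi * s)\<bar> = \<bar>sin (pi * \<bar>s\<bar>)\<bar>" by (simp add: abs_if)
  ultimately show ?thesis using s * by simp
qed

text \<open>
  Partial summation against a geometric progression. It gains a factor \<open>|1 - e t|\<close> over the trivial
  bound whenever the coefficients vary slowly.
\<close>

lemma abel_summation_e: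
  fixes f :: "nat \<Rightarrow> real"
  shows "(1 - e t) * (\<Sum>n\<le>K. f n * e (real n * t)) =
    f 0 + (\<Sum>n<K. (f (Suc n) - f n) * e (real (Suc n) * t)) - f K * e (real (Suc K) * t)"
proof (induction K)
  case 0
  then show ?case by (simp add: algebra_simps)
next
  case (Suc K)
  have "e (real (Suc (Suc K)) * t) = e t * e (real (Suc K) * t)"
    by (simp add: e_add[symmetric] algebra_simps)
  then show ?case using Suc by (simp add: algebra_simps)
qed

section \<open>Dirichlet characters to a prime modulus\<close>

lemma mult_mod_bij:
  fixes a r :: nat
  assumes "coprime a r" "0 < r"
  shows "bij_betw (\<lambda>h. a * h mod r) {..<r} {..<r}"
proof -
  have "inj_on (\<lambda>h. a * h mod r) {..<r}"
  proof (rule inj_onI)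
    fix h k assume "h \<in> {..<r}" "k \<in> {..<r}" "a * h mod r = a * k mod r"
    then show "h = k"
      using cong_mult_lcancel_nat[OF assms(1), of h k] by (simp add: cong_def)
  qed
  moreover have "(\<lambda>h. a * h mod r) ` {..<r} \<subseteq> {..<r}" using assms by auto
  ultimately show ?thesis
    by (simp add: bij_betw_def endo_inj_surj)
qed

lemma sum_mult_mod:
  fixes a r :: nat
  assumes "coprime a r" "0 < r"
  shows "(\<Sum>h<r. F (a * h mod r)) = (\<Sum>h<r. F h)"
  using sum.reindex_bij_betw[OF mult_mod_bij[OF assms], of F] .

lemma coprime_prime_less_iff:
  fixes h r :: nat
  assumes "prime r" "h < r"
  shows "coprime h r \<longleftrightarrow> h \<noteq> 0"
  using prime_imp_coprime[OF assms(1), of h] assms prime_gt_1_nat[OF assms(1)] nat_dvd_not_less[of h r]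
  by (cases "h = 0") (auto simp: coprime_commute)

lemma coprime_residue: "prime (r::nat) \<Longrightarrow> n \<in> {1..<r} \<Longrightarrow> coprime n r"
  by (simp add: coprime_prime_less_iff)

lemma dirichlet_charactersD:
  assumes "chi \<in> dirichlet_characters r"
  shows "dirichlet_character r chi" "chi (m * n) = chi m * chi n"
    "chi (n mod r) = chi n" "chi n \<noteq> 0 \<longleftrightarrow> coprime n r" "chi 1 = 1"
  using assms dirichlet_character_mod[of r chi] dirichlet_character_1[of r chi]
  unfolding dirichlet_characters_def dirichlet_character_def by blast+

lemma dirichlet_character_cong:
  assumes "chi \<in> dirichlet_characters r" "[m = n] (mod r)"
  shows "chi m = chi n"
  using assms dirichlet_charactersD(3)[OF assms(1)] unfolding cong_def by metis

lemma cmod_dirichlet_character: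
  assumes "chi \<in> dirichlet_characters r" "0 < r"
  shows "cmod (chi n) = (if coprime n r then 1 else 0)"
proof (cases "coprime n r")
  case True
  have "chi n ^ totient r = 1"
    using dirichlet_character_root_of_unity dirichlet_charactersD(1)[OF assms(1)] True by blast
  then show ?thesis
    using True assms(2) power_eq_1_iff[of "chi n" "totient r"] by simp
next
  case False
  then show ?thesis using dirichlet_charactersD(4)[OF assms(1)] by auto
qed

definition principal_character :: "nat \<Rightarrow> nat \<Rightarrow> complex" where
  "principal_character r n = (if coprime n r then 1 else 0)"

lemma coprime_add_self_nat [simp]: "coprime (n + r) r \<longleftrightarrow> coprime n (r::nat)"
  by (simp only: coprime_iff_gcd_eq_1 gcd_add1)

lemma principal_character_in: "principal_character r \<in> dirichlet_characters r"
  by (auto simp: dirichlet_characters_def dirichlet_character_def principal_character_def)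

lemma dirichlet_character_mult_in:
  assumes "chi \<in> dirichlet_characters r" "psi \<in> dirichlet_characters r"
  shows "(\<lambda>n. chi n * psi n) \<in> dirichlet_characters r"
  using assms by (auto simp: dirichlet_characters_def dirichlet_character_def)

lemma nonprincipal_witness:
  assumes "chi \<in> dirichlet_characters r" "chi \<noteq> principal_character r"
  obtains a where "coprime a r" "chi a \<noteq> 1"
  using assms dirichlet_charactersD(4)[OF assms(1)]
  by (auto simp: principal_character_def fun_eq_iff split: if_splits)

lemma sum_nonprincipal_character:
  assumes "chi \<in> dirichlet_characters r" "chi \<noteq> principal_character r" "0 < r"
  shows "(\<Sum>h<r. chi h) = 0"
proof -
  obtain a where a: "coprime a r" "chi a \<noteq> 1"
    using nonprincipal_witness[OF assms(1,2)] by blast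
  have "(\<Sum>h<r. chi h) = (\<Sum>h<r. chi (a * h mod r))"
    using sum_mult_mod[OF a(1) assms(3), of chi] by simp
  also have "\<dots> = chi a * (\<Sum>h<r. chi h)"
    by (simp only: dirichlet_charactersD[OF assms(1)] sum_distrib_left)
  finally show ?thesis using a(2) by simp
qed

text \<open>
  The unit group is cyclic: with a primitive root \<open>g\<close>, the character that sends \<open>g ^ i\<close> to
  \<open>e (i / \<phi>(r))\<close> is injective on the residue classes prime to \<open>r\<close>.
\<close>

lemma separating_character:
  assumes "prime r" "coprime a r" "\<not> [a = 1] (mod r)"
  obtains psi where "psi \<in> dirichlet_characters r" "psi a \<noteq> 1"
proof -
  have r: "r > 1" using assms(1) by (rule prime_gt_1_nat)
  obtain g where g: "residue_primroot r g"
    using prime_primitive_root_exists[OF _ assms(1)] r by blast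
  define T where "T = totient r"
  have T: "T > 0" using r by (simp add: T_def)
  have og: "ord r g = T" and cg: "coprime r g" using g by (auto simp: residue_primroot_def T_def)
  have ex: "\<exists>i<T. [g ^ i = n] (mod r)" if "coprime n r" for n
  proof -
    have "n mod r \<in> totatives r"
      using that r by (auto simp: totatives_def coprime_commute intro!: Nat.gr0I)
    then obtain i where "i < T" "n mod r = g ^ i mod r"
      using residue_primroot_is_generator[OF r g] unfolding bij_betw_def T_def by auto
    then show ?thesis by (auto simp: cong_def)
  qed
  define ind where "ind n = (SOME i. i < T \<and> [g ^ i = n] (mod r))" for n
  have ind: "ind n < T" "[g ^ ind n = n] (mod r)" if "coprime n r" for n
    using someI_ex[OF ex[OF that, unfolded Bex_def]] unfolding ind_def by blast+
  define psi where "psi n = (if coprime n r then e (real (ind n) / real T) else 0)" for n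
  have e_cong: "e (real i / real T) = e (real j / real T)" if "[i = j] (mod T)" for i j
  proof -
    have *: "e (real i / real T) = e (real (i mod T) / real T)" for i
    proof -
      have "real i = real (i div T * T + i mod T)" by simp
      also have "\<dots> / real T = real (i div T) + real (i mod T) / real T"
        using T by (simp only: of_nat_add of_nat_mult) (simp add: field_simps)
      finally show ?thesis by (simp add: e_add)
    qed
    show ?thesis using that *[of i] *[of j] by (simp add: cong_def)
  qed
  have ind_cong: "[i = j] (mod T)" if "[g ^ i = g ^ j] (mod r)" for i j
    using order_divides_expdiff[OF cg, of i j] that og by simp
  have "dirichlet_character r psi"
    unfolding dirichlet_character_def
  proof (intro conjI allI)
    fix m n
    show "psi (m * n) = psi m * psi n"
    proof (cases "coprime m r \<and> coprime n r")
      case True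
      then have c: "coprime m r" "coprime n r" "coprime (m * n) r" by auto
      have "[g ^ ind (m * n) = g ^ (ind m + ind n)] (mod r)"
        using cong_trans[OF ind(2)[OF c(3)] cong_sym[OF cong_mult[OF ind(2)[OF c(1)] ind(2)[OF c(2)]]]]
        by (simp add: power_add)
      from e_cong[OF ind_cong[OF this]] c show ?thesis
        by (simp add: psi_def e_add add_divide_distrib)
    qed (auto simp: psi_def)
  next
    fix n
    have "coprime (n + r) r \<longleftrightarrow> coprime n r" by (simp only: coprime_iff_gcd_eq_1 gcd_add1)
    moreover have "[g ^ ind (n + r) = g ^ ind n] (mod r)" if "coprime n r" "coprime (n + r) r"
      using ind(2)[OF that(1)] ind(2)[OF that(2)] by (simp add: cong_def)
    ultimately show "psi (n + r) = psi n"
      using e_cong[OF ind_cong] by (auto simp: psi_def)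
    show "psi n \<noteq> 0 \<longleftrightarrow> coprime n r" by (simp add: psi_def)
  qed
  moreover have "psi a \<noteq> 1"
  proof
    assume "psi a = 1"
    then have "real (ind a) / real T \<in> \<int>" using assms(2) by (simp add: psi_def e_eq_1_iff)
    then obtain k :: int where "real (ind a) / real T = of_int k" by (elim Ints_cases)
    then have "real (ind a) = of_int k * real T" using T by (simp add: field_simps)
    then have "int (ind a) = k * int T"
      by (metis of_int_eq_iff of_int_mult of_int_of_nat_eq)
    then have "T dvd ind a" by (metis dvd_triv_right int_dvd_int_iff)
    then have "ind a = 0" using ind(1)[OF assms(2)] by (auto dest: dvd_imp_le)
    then have "[a = 1] (mod r)" using ind(2)[OF assms(2)] by (simp add: cong_sym_eq)
    then show False using assms(3) by simp
  qed
  ultimately show ?thesis using that unfolding dirichlet_characters_def by blast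
qed

text \<open>
  Multiplication by a character that separates \<open>a\<close> from \<open>1\<close> permutes the characters and multiplies
  the sum by a number other than \<open>1\<close>.
\<close>

lemma sum_over_characters:
  assumes "prime r" "coprime a r" "\<not> [a = 1] (mod r)"
  shows "(\<Sum>chi\<in>dirichlet_characters r. chi a) = 0"
proof -
  have r: "r > 0" using assms(1) by (rule prime_gt_0_nat)
  obtain psi where psi: "psi \<in> dirichlet_characters r" "psi a \<noteq> 1"
    using separating_character[OF assms] by blast
  let ?D = "dirichlet_characters r"
  let ?f = "\<lambda>chi n. psi n * chi n"
  have inj: "inj_on ?f ?D"
  proof (rule inj_onI, rule ext)
    fix chi chi' n assume *: "chi \<in> ?D" "chi' \<in> ?D" "?f chi = ?f chi'"
    have "psi n * chi n = psi n * chi' n" using fun_cong[OF *(3), of n] .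
    then show "chi n = chi' n"
      using dirichlet_charactersD(4)[OF *(1)] dirichlet_charactersD(4)[OF *(2)]
        dirichlet_charactersD(4)[OF psi(1)] by (metis mult_cancel_left)
  qed
  have "?f ` ?D \<subseteq> ?D" using dirichlet_character_mult_in[OF psi(1)] by blast
  with inj have "bij_betw ?f ?D ?D"
    by (simp add: bij_betw_def endo_inj_surj finite_dirichlet_characters[OF r])
  from sum.reindex_bij_betw[OF this, of "\<lambda>chi. chi a"]
  have "psi a * (\<Sum>chi\<in>?D. chi a) = (\<Sum>chi\<in>?D. chi a)" by (simp add: sum_distrib_left)
  then show ?thesis using psi(2) by simp
qed

text \<open>
  Double counting: the sum of \<open>chi h\<close> over all characters and residues is the number of
  characters when summed over characters first, since only \<open>h = 1\<close> contributes, and \<open>r - 1\<close> when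
  summed over residues first, since only the principal character contributes.
\<close>

lemma card_dirichlet_characters:
  assumes "prime r"
  shows "card (dirichlet_characters r) = r - 1"
proof -
  let ?D = "dirichlet_characters r"
  have r: "r > 1" using assms by (rule prime_gt_1_nat)
  have fin: "finite ?D" using r by (intro finite_dirichlet_characters) auto
  note cop = coprime_prime_less_iff[OF assms]
  have "(\<Sum>h<r. \<Sum>chi\<in>?D. chi h) = (\<Sum>h<r. if h = 1 then of_nat (card ?D) else 0)"
  proof (rule sum.cong)
    fix h assume h: "h \<in> {..<r}"
    show "(\<Sum>chi\<in>?D. chi h) = (if h = 1 then of_nat (card ?D) else 0)"
    proof (cases "h = 1")
      case True
      then have "(\<Sum>chi\<in>?D. chi h) = (\<Sum>chi\<in>?D. 1)"
        using dirichlet_charactersD(5) by (intro sum.cong) auto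
      then show ?thesis using True by simp
    next
      case False
      show ?thesis
      proof (cases "coprime h r")
        case True
        moreover have "\<not> [h = 1] (mod r)" using False h r by (simp add: cong_def)
        ultimately show ?thesis using sum_over_characters[OF assms] False by simp
      next
        case False
        then have "\<forall>chi\<in>?D. chi h = 0" using dirichlet_charactersD(4) by blast
        then have "(\<Sum>chi\<in>?D. chi h) = 0" by (rule sum.neutral)
        then show ?thesis using \<open>h \<noteq> 1\<close> by simp
      qed
    qed
  qed simp
  also have "\<dots> = of_nat (card ?D)" using r by simp
  finally have 1: "(\<Sum>h<r. \<Sum>chi\<in>?D. chi h) = of_nat (card ?D)" .
  have "(\<Sum>chi\<in>?D. \<Sum>h<r. chi h) = (\<Sum>chi\<in>?D. if chi = principal_character r then of_nat (r - 1) else 0)"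
  proof (rule sum.cong)
    fix chi assume chi: "chi \<in> ?D"
    have "(\<Sum>h<r. principal_character r h) = (\<Sum>h\<in>{..<r}-{0}. 1)"
      by (rule sum.mono_neutral_cong_right) (auto simp: principal_character_def cop)
    also have "\<dots> = of_nat (r - 1)" using r by (simp add: of_nat_diff)
    finally show "(\<Sum>h<r. chi h) = (if chi = principal_character r then of_nat (r - 1) else 0)"
      using sum_nonprincipal_character[OF chi] r by simp
  qed simp
  also have "\<dots> = of_nat (r - 1)" using fin principal_character_in by simp
  finally show ?thesis using 1 sum.swap[of "\<lambda>h chi. chi h" ?D "{..<r}"]
    by (metis of_nat_eq_iff)
qed

theorem character_orthogonality:
  assumes "prime r"
  shows "(\<Sum>chi\<in>dirichlet_characters r. chi m * cnj (chi n)) =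
    (if [m = n] (mod r) \<and> coprime n r then of_nat (r - 1) else 0)"
proof (cases "coprime m r \<and> coprime n r")
  case False
  have "\<forall>chi\<in>dirichlet_characters r. chi m * cnj (chi n) = 0"
    using False dirichlet_charactersD(4) by (metis complex_cnj_zero mult_zero_left mult_zero_right)
  then have "(\<Sum>chi\<in>dirichlet_characters r. chi m * cnj (chi n)) = 0" by (rule sum.neutral)
  moreover have "\<not> ([m = n] (mod r) \<and> coprime n r)"
    using False by (metis cong_imp_coprime cong_sym)
  ultimately show ?thesis by auto
next
  case True
  have r: "r > 0" using assms by (rule prime_gt_0_nat)
  obtain n' where n': "[n * n' = 1] (mod r)"
    using cong_solve_coprime_nat[of n r] True by auto
  have cn': "coprime n' r"
  proof -
    have "coprime (n * n') r" by (rule cong_imp_coprime[OF cong_sym[OF n']]) simp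
    then show ?thesis by simp
  qed
  have "chi m * cnj (chi n) = chi (m * n')" if chi: "chi \<in> dirichlet_characters r" for chi
  proof -
    have "chi n * chi n' = 1"
      using dirichlet_character_cong[OF chi n'] dirichlet_charactersD(2,5)[OF chi] by simp
    moreover have "chi n * cnj (chi n) = 1"
      using cmod_dirichlet_character[OF chi r, of n] True complex_norm_square[of "chi n"] by simp
    ultimately have "cnj (chi n) = chi n'"
      by (metis mult_cancel_left mult_zero_left zero_neq_one)
    then show ?thesis by (simp add: dirichlet_charactersD(2)[OF chi])
  qed
  then have "(\<Sum>chi\<in>dirichlet_characters r. chi m * cnj (chi n)) =
      (\<Sum>chi\<in>dirichlet_characters r. chi (m * n'))" by (rule sum.cong[OF refl])
  also have "\<dots> = (if [m = n] (mod r) then of_nat (r - 1) else 0)"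
  proof (cases "[m = n] (mod r)")
    case True
    then have "[m * n' = 1] (mod r)" using n' by (metis cong_scalar_right cong_trans)
    then have "chi (m * n') = 1" if "chi \<in> dirichlet_characters r" for chi
      using dirichlet_character_cong[OF that] dirichlet_charactersD(5)[OF that] by metis
    then have "(\<Sum>chi\<in>dirichlet_characters r. chi (m * n')) = (\<Sum>chi\<in>dirichlet_characters r. 1)"
      by (rule sum.cong[OF refl])
    then show ?thesis using True card_dirichlet_characters[OF assms] by simp
  next
    case False
    have "\<not> [m * n' = 1] (mod r)"
    proof
      assume "[m * n' = 1] (mod r)"
      then have "[m * n' = n * n'] (mod r)" using n' by (metis cong_sym cong_trans)
      then show False using False cn' cong_mult_rcancel_nat by blast
    qed
    then show ?thesis using False sum_over_characters[OF assms, of "m * n'"] True cn' by simp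
  qed
  finally show ?thesis using True by simp
qed

text \<open>
  The index type and the maps \<open>u\<close>, \<open>v\<close> are kept general so that the lemma also applies to
  \<open>|\<Sum>\<^sub>n c n chi n|\<^sup>2\<close>, expanded over pairs of indices, and then computes a fourth moment.
\<close>

lemma character_second_moment:
  fixes u v :: "'i \<Rightarrow> nat"
  assumes "prime r" "finite X" "\<And>i. i \<in> X \<Longrightarrow> coprime (u i) r \<and> coprime (v i) r"
  shows "(\<Sum>chi\<in>dirichlet_characters r. (cmod (\<Sum>i\<in>X. c i * (chi (u i) * cnj (chi (v i)))))\<^sup>2) =
    (r - 1) * (\<Sum>i\<in>X. \<Sum>j\<in>X. if [u i * v j = u j * v i] (mod r) then c i * cnj (c j) else 0)"
proof -
  let ?D = "dirichlet_characters r"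
  have "complex_of_real (\<Sum>chi\<in>?D. (cmod (\<Sum>i\<in>X. c i * (chi (u i) * cnj (chi (v i)))))\<^sup>2) =
    (\<Sum>chi\<in>?D. (\<Sum>i\<in>X. c i * (chi (u i) * cnj (chi (v i)))) * cnj (\<Sum>i\<in>X. c i * (chi (u i) * cnj (chi (v i)))))"
    by (simp only: of_real_sum complex_norm_square)
  also have "\<dots> = (\<Sum>chi\<in>?D. \<Sum>i\<in>X. \<Sum>j\<in>X. c i * cnj (c j) * (chi (u i * v j) * cnj (chi (u j * v i))))"
    unfolding sum_product cnj_sum
    by (intro sum.cong refl) (simp add: dirichlet_charactersD(2) mult_ac)
  also have "\<dots> = (\<Sum>i\<in>X. \<Sum>j\<in>X. c i * cnj (c j) * (\<Sum>chi\<in>?D. chi (u i * v j) * cnj (chi (u j * v i))))"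
  proof -
    have "(\<Sum>chi\<in>?D. \<Sum>i\<in>X. \<Sum>j\<in>X. c i * cnj (c j) * (chi (u i * v j) * cnj (chi (u j * v i)))) =
      (\<Sum>i\<in>X. \<Sum>j\<in>X. \<Sum>chi\<in>?D. c i * cnj (c j) * (chi (u i * v j) * cnj (chi (u j * v i))))"
      by (rule trans[OF sum.swap]) (rule sum.cong[OF refl], rule sum.swap)
    then show ?thesis by (simp only: sum_distrib_left)
  qed
  also have "\<dots> = (r - 1) * (\<Sum>i\<in>X. \<Sum>j\<in>X. if [u i * v j = u j * v i] (mod r) then c i * cnj (c j) else 0)"
    unfolding character_orthogonality[OF assms(1)] sum_distrib_left
    by (intro sum.cong refl) (use assms(3) in auto)
  finally show ?thesis using prime_gt_0_nat[OF assms(1)] by (simp add: of_nat_diff)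
qed

lemma character_linear_moment:
  assumes "prime r" "finite X" "\<And>n. n \<in> X \<Longrightarrow> coprime n r" "\<And>m n. m \<in> X \<Longrightarrow> n \<in> X \<Longrightarrow> [m = n] (mod r) \<Longrightarrow> m = n"
    "Y \<subseteq> X"
  shows "(\<Sum>chi\<in>dirichlet_characters r. (\<Sum>n\<in>X. c n * chi n) * cnj (\<Sum>n\<in>Y. c n * chi n)) =
    complex_of_real ((r - 1) * (\<Sum>n\<in>Y. (cmod (c n))\<^sup>2))"
proof -
  let ?D = "dirichlet_characters r"
  have finY: "finite Y" using assms(2,5) finite_subset by blast
  have "(\<Sum>chi\<in>?D. (\<Sum>n\<in>X. c n * chi n) * cnj (\<Sum>n\<in>Y. c n * chi n)) =
    (\<Sum>n\<in>Y. \<Sum>m\<in>X. c m * cnj (c n) * (\<Sum>chi\<in>?D. chi m * cnj (chi n)))"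
  proof -
    have "(\<Sum>chi\<in>?D. (\<Sum>n\<in>X. c n * chi n) * cnj (\<Sum>n\<in>Y. c n * chi n)) =
      (\<Sum>chi\<in>?D. \<Sum>m\<in>X. \<Sum>n\<in>Y. c m * cnj (c n) * (chi m * cnj (chi n)))"
      unfolding sum_product cnj_sum by (intro sum.cong refl) (simp add: mult_ac)
    also have "\<dots> = (\<Sum>m\<in>X. \<Sum>n\<in>Y. \<Sum>chi\<in>?D. c m * cnj (c n) * (chi m * cnj (chi n)))"
      by (rule trans[OF sum.swap]) (rule sum.cong[OF refl], rule sum.swap)
    also have "\<dots> = (\<Sum>n\<in>Y. \<Sum>m\<in>X. \<Sum>chi\<in>?D. c m * cnj (c n) * (chi m * cnj (chi n)))"
      by (rule sum.swap)
    finally show ?thesis by (simp only: sum_distrib_left)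
  qed
  also have "\<dots> = (\<Sum>n\<in>Y. \<Sum>m\<in>X. if m = n then of_nat (r - 1) * (c n * cnj (c n)) else 0)"
    unfolding character_orthogonality[OF assms(1)]
    by (intro sum.cong refl) (use assms(3-5) in auto)
  also have "\<dots> = (\<Sum>n\<in>Y. of_nat (r - 1) * (c n * cnj (c n)))"
    using assms(2,5) by (intro sum.cong refl) auto
  also have "\<dots> = complex_of_real ((r - 1) * (\<Sum>n\<in>Y. (cmod (c n))\<^sup>2))"
    by (simp only: of_real_mult of_real_sum sum_distrib_left of_real_of_nat_eq complex_norm_square)
  finally show ?thesis using prime_gt_0_nat[OF assms(1)] by (simp add: of_nat_diff)
qed
text \<open>
  Hoelder's inequality with weights \<open>1/2\<close>, \<open>1/4\<close>, \<open>1/4\<close> for the factors \<open>\<surd>a\<close>, \<open>\<surd>a\<close>, \<open>b\<close>, obtained from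
  Cauchy-Schwarz used twice. Read from right to left it bounds a first moment from below.
\<close>

lemma sum_mult_fourth_power_le:
  fixes a b :: "'i \<Rightarrow> real"
  assumes "finite X" "\<And>i. i \<in> X \<Longrightarrow> 0 \<le> a i" "\<And>i. i \<in> X \<Longrightarrow> 0 \<le> b i"
  shows "(\<Sum>i\<in>X. a i * b i) ^ 4 \<le> (\<Sum>i\<in>X. a i)\<^sup>2 * (\<Sum>i\<in>X. (a i)\<^sup>2) * (\<Sum>i\<in>X. b i ^ 4)"
proof -
  have "(\<Sum>i\<in>X. a i * b i)\<^sup>2 = (\<Sum>i\<in>X. sqrt (a i) * (sqrt (a i) * b i))\<^sup>2"
    using assms by (intro arg_cong[where f = "\<lambda>z. z\<^sup>2"] sum.cong) (auto simp flip: mult.assoc)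
  also have "\<dots> \<le> (\<Sum>i\<in>X. (sqrt (a i))\<^sup>2) * (\<Sum>i\<in>X. (sqrt (a i) * b i)\<^sup>2)"
    by (rule Cauchy_Schwarz_ineq_sum)
  also have "\<dots> = (\<Sum>i\<in>X. a i) * (\<Sum>i\<in>X. a i * (b i)\<^sup>2)"
    using assms by (intro arg_cong2[where f = "(*)"] sum.cong) (auto simp: power_mult_distrib)
  finally have 1: "(\<Sum>i\<in>X. a i * b i)\<^sup>2 \<le> (\<Sum>i\<in>X. a i) * (\<Sum>i\<in>X. a i * (b i)\<^sup>2)" .
  have 2: "(\<Sum>i\<in>X. a i * (b i)\<^sup>2)\<^sup>2 \<le> (\<Sum>i\<in>X. (a i)\<^sup>2) * (\<Sum>i\<in>X. ((b i)\<^sup>2)\<^sup>2)"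
    by (rule Cauchy_Schwarz_ineq_sum)
  have "(\<Sum>i\<in>X. a i * b i) ^ 4 = ((\<Sum>i\<in>X. a i * b i)\<^sup>2)\<^sup>2" by (simp flip: power_mult)
  also have "\<dots> \<le> ((\<Sum>i\<in>X. a i) * (\<Sum>i\<in>X. a i * (b i)\<^sup>2))\<^sup>2"
    using 1 by (intro power_mono) auto
  also have "\<dots> = (\<Sum>i\<in>X. a i)\<^sup>2 * (\<Sum>i\<in>X. a i * (b i)\<^sup>2)\<^sup>2" by (rule power_mult_distrib)
  also have "\<dots> \<le> (\<Sum>i\<in>X. a i)\<^sup>2 * ((\<Sum>i\<in>X. (a i)\<^sup>2) * (\<Sum>i\<in>X. ((b i)\<^sup>2)\<^sup>2))"
    by (intro mult_left_mono 2) auto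
  finally show ?thesis by (simp add: mult.assoc flip: power_mult)
qed

text \<open>
  The square \<open>|\<Sum>\<^sub>n c n chi n|\<^sup>2\<close> is a combination of the values \<open>chi m * cnj (chi n)\<close>, and its second
  moment only sees coincidences of ratios \<open>m/n\<close> modulo \<open>r\<close>.
\<close>

lemma character_fourth_moment_le:
  assumes r: "prime r" and I: "finite I" "\<And>n. n \<in> I \<Longrightarrow> coprime n r" and c: "\<And>n. n \<in> I \<Longrightarrow> cmod (c n) \<le> D"
  shows "(\<Sum>chi\<in>dirichlet_characters r. cmod (\<Sum>n\<in>I. c n * chi n) ^ 4) \<le>
    (real r - 1) * D ^ 4 * card {(p, q). p \<in> I \<times> I \<and> q \<in> I \<times> I \<and> [fst p * snd q = fst q * snd p] (mod r)}"
proof -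
  let ?D = "dirichlet_characters r"
  define X where "X = I \<times> I"
  define d where "d p = c (fst p) * cnj (c (snd p))" for p
  have finX: "finite X" using I(1) by (simp add: X_def)
  have cop: "coprime (fst p) r \<and> coprime (snd p) r" if "p \<in> X" for p
    using that I(2) by (auto simp: X_def)
  have "(\<Sum>chi\<in>?D. cmod (\<Sum>n\<in>I. c n * chi n) ^ 4) =
      (\<Sum>chi\<in>?D. (cmod (\<Sum>p\<in>X. d p * (chi (fst p) * cnj (chi (snd p)))))\<^sup>2)"
  proof (intro sum.cong refl)
    fix chi :: "nat \<Rightarrow> complex"
    have "(\<Sum>p\<in>X. d p * (chi (fst p) * cnj (chi (snd p)))) = (\<Sum>n\<in>I. c n * chi n) * cnj (\<Sum>n\<in>I. c n * chi n)"
      by (simp add: X_def d_def sum_product sum.cartesian_product case_prod_unfold mult_ac)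
    then show "cmod (\<Sum>n\<in>I. c n * chi n) ^ 4 = (cmod (\<Sum>p\<in>X. d p * (chi (fst p) * cnj (chi (snd p)))))\<^sup>2"
      by (simp add: norm_mult power4_eq_xxxx power2_eq_square del: cnj_sum)
  qed
  moreover note character_second_moment[OF r finX cop, of "\<lambda>p. p" d]
  ultimately have "complex_of_real (\<Sum>chi\<in>?D. cmod (\<Sum>n\<in>I. c n * chi n) ^ 4) =
      (of_nat r - 1) * (\<Sum>p\<in>X. \<Sum>q\<in>X. if [fst p * snd q = fst q * snd p] (mod r) then d p * cnj (d q) else 0)"
    by (simp only:)
  note * = this
  have "cmod (complex_of_real (\<Sum>chi\<in>?D. cmod (\<Sum>n\<in>I. c n * chi n) ^ 4)) =
      (real r - 1) * cmod (\<Sum>p\<in>X. \<Sum>q\<in>X. if [fst p * snd q = fst q * snd p] (mod r) then d p * cnj (d q) else 0)"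
  proof -
    have "(of_nat r - 1 :: complex) = of_real (real r - 1)" by simp
    moreover have "\<bar>real r - 1\<bar> = real r - 1" using prime_ge_1_nat[OF r] by simp
    ultimately have "cmod (of_nat r - 1) = real r - 1" by (simp only: norm_of_real)
    then show ?thesis using * by (simp only: norm_mult)
  qed
  also have "cmod (complex_of_real (\<Sum>chi\<in>?D. cmod (\<Sum>n\<in>I. c n * chi n) ^ 4)) = (\<Sum>chi\<in>?D. cmod (\<Sum>n\<in>I. c n * chi n) ^ 4)"
    unfolding norm_of_real by (intro abs_of_nonneg sum_nonneg) simp
  also have "cmod (\<Sum>p\<in>X. \<Sum>q\<in>X. if [fst p * snd q = fst q * snd p] (mod r) then d p * cnj (d q) else 0) \<le>
      (\<Sum>p\<in>X. \<Sum>q\<in>X. if [fst p * snd q = fst q * snd p] (mod r) then D ^ 4 else 0)"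
  proof (intro sum_norm_le)
    fix p q assume pq: "p \<in> X" "q \<in> X"
    have d_le: "cmod (d p) \<le> D * D" if "p \<in> X" for p
    proof -
      have "cmod (c (fst p)) \<le> D" "cmod (c (snd p)) \<le> D" using c that by (auto simp: X_def)
      then show ?thesis unfolding d_def norm_mult complex_mod_cnj
        by (intro mult_mono) (auto intro: order_trans[OF norm_ge_zero])
    qed
    have "cmod (d p) * cmod (d q) \<le> (D * D) * (D * D)"
      by (intro mult_mono d_le pq) (auto intro: order_trans[OF norm_ge_zero])
    then show "cmod (if [fst p * snd q = fst q * snd p] (mod r) then d p * cnj (d q) else 0)
        \<le> (if [fst p * snd q = fst q * snd p] (mod r) then D ^ 4 else 0)"
      by (simp add: norm_mult power4_eq_xxxx mult.assoc)
  qed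
  also have "\<dots> = (\<Sum>z\<in>X \<times> X. if [fst (fst z) * snd (snd z) = fst (snd z) * snd (fst z)] (mod r) then D ^ 4 else 0)"
    by (simp add: sum.cartesian_product case_prod_unfold)
  also have "\<dots> = D ^ 4 * card {z\<in>X \<times> X. [fst (fst z) * snd (snd z) = fst (snd z) * snd (fst z)] (mod r)}"
    using finX by (subst sum.inter_filter[symmetric]) auto
  also have "{z\<in>X \<times> X. [fst (fst z) * snd (snd z) = fst (snd z) * snd (fst z)] (mod r)} =
      {(p, q). p \<in> I \<times> I \<and> q \<in> I \<times> I \<and> [fst p * snd q = fst q * snd p] (mod r)}"
    by (auto simp: X_def)
  finally show ?thesis using prime_ge_1_nat[OF r] by (simp add: mult_left_mono mult.assoc)
qed

section \<open>The discrete Fourier transform modulo a prime\<close>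

lemma sum_additive_characters:
  assumes "m < r" "n < r"
  shows "(\<Sum>h<r. e (real (h * m) / real r) * cnj (e (real (h * n) / real r))) = (if m = n then of_nat r else 0)"
proof (cases "m = n")
  case True
  have "e (real (h * n) / real r) * cnj (e (real (h * n) / real r)) = 1" for h
    by (simp add: cnj_e e_add[symmetric])
  then show ?thesis using True by simp
next
  case False
  define z where "z = e ((real m - real n) / real r)"
  have r: "r > 0" using assms by simp
  have "e (real (h * m) / real r) * cnj (e (real (h * n) / real r)) = z ^ h" for h
    unfolding z_def e_of_nat_mult[symmetric] cnj_e e_add[symmetric]
    by (simp add: algebra_simps diff_divide_distrib)
  moreover have "z ^ r = 1"
    using e_of_int[of "int m - int n"] r unfolding z_def e_of_nat_mult[symmetric] by simp
  moreover have "z \<noteq> 1"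
  proof
    assume "z = 1"
    then obtain k :: int where "(real m - real n) / real r = of_int k"
      unfolding z_def e_eq_1_iff by (elim Ints_cases)
    then have "real_of_int (int m - int n) = real_of_int (k * int r)" using r by (simp add: field_simps)
    then have *: "int m - int n = k * int r" by (simp only: of_int_eq_iff)
    have "\<bar>k\<bar> * int r = \<bar>int m - int n\<bar>" using * by (simp add: abs_mult)
    also have "\<dots> < 1 * int r" using assms by simp
    finally have "k = 0" using r by (simp only: mult_less_cancel_right) auto
    then show False using * False by simp
  qed
  ultimately show ?thesis using False by (simp add: sum_gp_strict)
qed

lemma plancherel_mod:
  assumes "0 < r"
  shows "(\<Sum>h<r. (cmod (\<Sum>n<r. c n * e (real (h * n) / real r)))\<^sup>2) = r * (\<Sum>n<r. (cmod (c n))\<^sup>2)"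
proof -
  have "complex_of_real (\<Sum>h<r. (cmod (\<Sum>n<r. c n * e (real (h * n) / real r)))\<^sup>2) =
    (\<Sum>h<r. \<Sum>m<r. \<Sum>n<r. c m * cnj (c n) * (e (real (h * m) / real r) * cnj (e (real (h * n) / real r))))"
    unfolding of_real_sum complex_norm_square sum_product cnj_sum
    by (intro sum.cong refl) (simp add: mult_ac)
  also have "\<dots> = (\<Sum>m<r. \<Sum>n<r. \<Sum>h<r. c m * cnj (c n) * (e (real (h * m) / real r) * cnj (e (real (h * n) / real r))))"
    by (rule trans[OF sum.swap]) (rule sum.cong[OF refl], rule sum.swap)
  also have "\<dots> = (\<Sum>m<r. \<Sum>n<r. if m = n then of_nat r * (c n * cnj (c n)) else 0)"
    by (intro sum.cong refl) (auto simp: sum_distrib_left[symmetric] sum_additive_characters simp del: of_nat_mult)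
  also have "\<dots> = complex_of_real (r * (\<Sum>n<r. (cmod (c n))\<^sup>2))"
    by (simp add: sum_distrib_left complex_norm_square del: of_real_power)
  finally show ?thesis by (simp only: of_real_eq_iff)
qed

text \<open>
  Substituting \<open>n h\<close> for \<open>h\<close> shows that the discrete Fourier transform of \<open>chi\<close> is \<open>cnj chi\<close> times
  the Gauss sum. That the Gauss sum has absolute value \<open>\<surd>r\<close> then follows from Plancherel.
\<close>

lemma nonprincipal_fourier_transform:
  assumes "prime r" "chi \<in> dirichlet_characters r" "chi \<noteq> principal_character r"
  shows "cmod (\<Sum>h<r. chi h * cnj (\<Sum>n<r. f n * e (real (h * n) / real r))) =
    sqrt r * cmod (\<Sum>n<r. chi n * f n)"
proof -
  have r: "r > 1" using assms(1) by (rule prime_gt_1_nat)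
  note cop = coprime_prime_less_iff[OF assms(1)]
  define G where "G n = (\<Sum>h<r. chi h * cnj (e (real (h * n) / real r)))" for n
  have e_mod: "e (real (m mod r) / real r) = e (real m / real r)" for m
  proof -
    have "real m = real (m div r * r + m mod r)" by simp
    also have "\<dots> / real r = real (m div r) + real (m mod r) / real r"
      using r by (simp only: of_nat_add of_nat_mult) (simp add: field_simps)
    finally show ?thesis by (simp add: e_add)
  qed
  have G: "G n = cnj (chi n) * G 1" if n: "n < r" for n
  proof (cases "n = 0")
    case True
    have "G n = (\<Sum>h<r. chi h)" using True by (simp add: G_def)
    then show ?thesis using sum_nonprincipal_character[OF assms(2,3)] r True cop[of 0]
        dirichlet_charactersD(4)[OF assms(2), of 0] by simp
  next
    case False
    then have cn: "coprime n r" using cop n by simp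
    have "G 1 = (\<Sum>h<r. (\<lambda>h. chi h * cnj (e (real h / real r))) (n * h mod r))"
      unfolding G_def using r by (subst sum_mult_mod[OF cn]) auto
    also have "\<dots> = chi n * G n"
      by (simp add: G_def e_mod dirichlet_charactersD(2,3)[OF assms(2)] sum_distrib_left mult_ac
               del: of_nat_mult)
    finally have "cnj (chi n) * G 1 = (chi n * cnj (chi n)) * G n" by simp
    also have "chi n * cnj (chi n) = 1"
      using cmod_dirichlet_character[OF assms(2), of n] r cn complex_norm_square[of "chi n"] by simp
    finally show ?thesis by simp
  qed
  have "(\<Sum>h<r. (cmod (\<Sum>n<r. cnj (chi n) * e (real (h * n) / real r)))\<^sup>2) = (\<Sum>h<r. (cmod (G h))\<^sup>2)"
  proof (intro sum.cong refl)
    fix h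
    have "(\<Sum>n<r. cnj (chi n) * e (real (h * n) / real r)) = cnj (G h)"
      by (simp add: G_def mult.commute)
    then show "(cmod (\<Sum>n<r. cnj (chi n) * e (real (h * n) / real r)))\<^sup>2 = (cmod (G h))\<^sup>2" by simp
  qed
  also have "\<dots> = (\<Sum>h<r. (cmod (chi h))\<^sup>2 * (cmod (G 1))\<^sup>2)"
    by (intro sum.cong refl, subst G) (auto simp: norm_mult power_mult_distrib)
  also have "\<dots> = (cmod (G 1))\<^sup>2 * (\<Sum>h<r. (cmod (chi h))\<^sup>2)"
    by (simp add: sum_distrib_left mult.commute)
  finally have "r * (\<Sum>h<r. (cmod (chi h))\<^sup>2) = (cmod (G 1))\<^sup>2 * (\<Sum>h<r. (cmod (chi h))\<^sup>2)"
    using plancherel_mod[of r "\<lambda>n. cnj (chi n)"] r by (simp only: complex_mod_cnj)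
  moreover have "(\<Sum>h<r. (cmod (chi h))\<^sup>2) \<noteq> 0"
  proof -
    have "(cmod (chi 1))\<^sup>2 \<le> (\<Sum>h<r. (cmod (chi h))\<^sup>2)"
      using r by (intro member_le_sum) auto
    then show ?thesis using dirichlet_charactersD(5)[OF assms(2)] by simp
  qed
  ultimately have "(cmod (G 1))\<^sup>2 = r" by simp
  then have G1: "cmod (G 1) = sqrt r" by (metis norm_ge_zero real_sqrt_unique)
  have "(\<Sum>h<r. chi h * cnj (\<Sum>n<r. f n * e (real (h * n) / real r))) =
    (\<Sum>h<r. \<Sum>n<r. cnj (f n) * (chi h * cnj (e (real (h * n) / real r))))"
    unfolding cnj_sum sum_distrib_left by (intro sum.cong refl) (simp add: mult_ac)
  also have "\<dots> = (\<Sum>n<r. cnj (f n) * G n)"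
    unfolding G_def sum_distrib_left by (rule sum.swap)
  also have "\<dots> = (\<Sum>n<r. cnj (chi n * f n) * G 1)"
    by (intro sum.cong refl, subst G) auto
  also have "\<dots> = cnj (\<Sum>n<r. chi n * f n) * G 1" by (simp add: sum_distrib_right)
  finally show ?thesis using G1 by (simp add: norm_mult del: cnj_sum)
qed

section \<open>Consequences of the Diophantine condition\<close>

text \<open>
  Two numbers \<open>c < d\<close> with \<open>c\<theta>\<close> and \<open>d\<theta>\<close> both within \<open>\<delta>\<close> of an integer differ by a \<open>q\<close> with \<open>q\<theta>\<close>
  within \<open>2\<delta>\<close> of an integer. So they are \<open>Q\<close>-separated, and their integral parts in units of \<open>Q\<close>
  are distinct.
\<close>

lemma card_near_integers_le:
  fixes \<theta> :: real
  assumes "0 < Q" "0 < \<delta>" and Q: "\<And>q::nat. 0 < q \<Longrightarrow> nint_dist (real q * \<theta>) < 2 * \<delta> \<Longrightarrow> Q \<le> real q"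
  shows "real (card {d\<in>{1..K}. nint_dist (real d * \<theta>) < \<delta>}) \<le> real K / Q"
proof -
  let ?S = "{d\<in>{1..K}. nint_dist (real d * \<theta>) < \<delta>}"
  let ?f = "\<lambda>d::nat. nat \<lfloor>real d / Q\<rfloor>"
  have "inj_on ?f ?S"
  proof (rule linorder_inj_onI)
    fix c d assume cd: "c < d" "c \<in> ?S" "d \<in> ?S"
    have "real (d - c) * \<theta> = real d * \<theta> - real c * \<theta>"
      using cd(1) by (simp add: of_nat_diff algebra_simps)
    then have "nint_dist (real (d - c) * \<theta>) < 2 * \<delta>"
      using nint_dist_diff_le[of "real d * \<theta>" "real c * \<theta>"] cd(2,3) by simp
    then have "Q \<le> real (d - c)" using cd(1) by (intro Q) auto
    then have "(real c + Q) / Q \<le> real d / Q"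
      using assms(1) cd(1) by (intro divide_right_mono) (auto simp: of_nat_diff)
    then have "real c / Q + 1 \<le> real d / Q" using assms(1) by (simp add: add_divide_distrib)
    then have "\<lfloor>real c / Q\<rfloor> < \<lfloor>real d / Q\<rfloor>" by linarith
    moreover have "0 \<le> \<lfloor>real c / Q\<rfloor>" using assms(1) by simp
    ultimately show "?f c \<noteq> ?f d" by linarith
  qed auto
  moreover have "?f ` ?S \<subseteq> {1..nat \<lfloor>real K / Q\<rfloor>}"
  proof (rule image_subsetI)
    fix d assume d: "d \<in> ?S"
    have "Q \<le> real d" using d assms(2) by (intro Q) auto
    then have "1 \<le> \<lfloor>real d / Q\<rfloor>" using assms(1) by (simp add: field_simps)
    moreover have "\<lfloor>real d / Q\<rfloor> \<le> \<lfloor>real K / Q\<rfloor>"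
      using d assms(1) by (intro floor_mono divide_right_mono) auto
    ultimately show "?f d \<in> {1..nat \<lfloor>real K / Q\<rfloor>}" using assms(1) by (auto simp: nat_le_iff le_nat_iff)
  qed
  ultimately have "card ?S \<le> nat \<lfloor>real K / Q\<rfloor>"
    using card_inj_on_le[of ?f ?S "{1..nat \<lfloor>real K / Q\<rfloor>}"] by simp
  moreover have "0 \<le> real K / Q" using assms(1) by simp
  ultimately show ?thesis by linarith
qed

text \<open>
  The Diophantine condition turns \<open>\<parallel>q\<theta>\<parallel> < 2\<delta>\<close> into a lower bound for \<open>q\<close> of the order of the fourth
  power of \<open>ln (1/\<delta>)\<close>, hence also of its square. The square in the denominator makes the sum over
  sizes converge.
\<close>

lemma card_near_integers_log:
  fixes \<theta> :: real
  assumes "C > 0"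
    and dio: "\<And>q::nat. q > 0 \<Longrightarrow> nint_dist (real q * \<theta>) \<ge> C * exp (- (real q powr (1/4)))"
  obtains \<kappa> where "\<kappa> > 0" and
    "\<And>\<delta> K. 0 < \<delta> \<Longrightarrow> \<delta> \<le> 1 \<Longrightarrow>
      real (card {d\<in>{1..K}. nint_dist (real d * \<theta>) < \<delta>}) \<le> \<kappa> * real K / (1 + ln (1 / \<delta>))\<^sup>2"
proof -
  define k where "k = 2 + \<bar>ln (2 / C)\<bar>"
  have k: "k > 0" by (simp add: k_def)
  have *: "real (card {d\<in>{1..K}. nint_dist (real d * \<theta>) < \<delta>}) \<le> k\<^sup>2 * real K / (1 + ln (1 / \<delta>))\<^sup>2"
    if d: "0 < \<delta>" "\<delta> \<le> 1" for \<delta> K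
  proof -
    define u where "u = 1 + ln (1 / \<delta>)"
    have u: "u \<ge> 1" using d by (simp add: u_def ln_div)
    have "(u / k)\<^sup>2 \<le> real q" if q: "0 < q" "nint_dist (real q * \<theta>) < 2 * \<delta>" for q
    proof -
      define p where "p = real q powr (1/4)"
      have p1: "1 \<le> p" using q(1) by (simp add: p_def ge_one_powr_ge_zero)
      have "C * exp (- p) < 2 * \<delta>" using dio[OF q(1)] q(2) by (simp add: p_def)
      then have "1 / \<delta> < 2 / C * exp p" using assms(1) d(1)
        by (simp add: exp_minus field_simps)
      then have "ln (1 / \<delta>) < ln (2 / C * exp p)"
        using d(1) by (subst ln_less_cancel_iff) (auto intro: less_trans[rotated])
      also have "\<dots> = ln (2 / C) + p" using assms(1) by (subst ln_mult_pos) auto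
      finally have "u \<le> 1 + p + \<bar>ln (2 / C)\<bar> * 1" by (simp add: u_def)
      also have "\<dots> \<le> 1 * p + p + \<bar>ln (2 / C)\<bar> * p"
        using p1 by (intro add_mono mult_left_mono) auto
      also have "\<dots> = k * p" by (simp add: k_def algebra_simps)
      finally have "u / k \<le> p" using k by (simp add: field_simps)
      then have "(u / k)\<^sup>2 \<le> p\<^sup>2" using u k by (intro power_mono) auto
      also have "\<dots> = real q powr (1/2)"
        by (simp add: p_def power2_eq_square flip: powr_add)
      also have "\<dots> \<le> real q powr 1" using q(1) by (intro powr_mono) auto
      finally show ?thesis using q(1) by simp
    qed
    from card_near_integers_le[of "(u / k)\<^sup>2" \<delta> \<theta> K, OF _ d(1) this]
    have "real (card {d\<in>{1..K}. nint_dist (real d * \<theta>) < \<delta>}) \<le> real K / (u / k)\<^sup>2"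
      using u k by simp
    then show ?thesis by (simp add: u_def power_divide mult.commute)
  qed
  show ?thesis by (rule that[of "k\<^sup>2"]) (use k * in auto)
qed

text \<open>
  A discrete form of \<open>\<integral> dM / (M (1 + ln (y/M))\<^sup>2) = 1 / (1 + ln (y/M))\<close>: each term is at most twice
  the increment of the antiderivative.
\<close>

lemma sum_inverse_log_squared_le:
  fixes y :: real
  assumes "1 \<le> Y" "real Y \<le> y"
  shows "(\<Sum>M=1..Y. 1 / (real M * (1 + ln (y / real M))\<^sup>2)) \<le> 3"
proof -
  define g where "g M = 1 / (1 + ln (y / real M))" for M :: nat
  have y: "1 \<le> y" using assms by linarith
  have "1 \<le> Y \<Longrightarrow> real Y \<le> y \<Longrightarrow> (\<Sum>M=1..Y. 1 / (real M * (1 + ln (y / real M))\<^sup>2)) \<le> 1 + 2 * (g Y - g 1)"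
  proof (induction Y rule: nat_induct_at_least)
    case base
    have "1 \<le> (1 + ln y)\<^sup>2" using y by simp
    then show ?case by (simp add: divide_le_eq_1)
  next
    case (Suc M)
    define L where "L = ln (y / real (Suc M))"
    have M: "1 \<le> M" and My: "real (Suc M) \<le> y" using Suc by auto
    have L0: "0 \<le> L" using My y M unfolding L_def by (intro ln_ge_zero) (simp add: field_simps)
    define s where "s = ln (real (Suc M) / real M)"
    \<comment> \<open>The step s = ln ((M+1)/M) of the logarithm lies between 1/(M+1) and 1.\<close>
    have lnM: "ln (y / real M) = L + s"
      using M y unfolding L_def s_def by (simp add: ln_div)
    have "s = - ln (1 - 1 / real (Suc M))"
    proof -
      have "1 - 1 / real (Suc M) = inverse (real (Suc M) / real M)" using M by (simp add: field_simps)
      then show ?thesis unfolding s_def by (simp only: ln_inverse)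
    qed
    moreover have "ln (1 - 1 / real (Suc M)) \<le> (1 - 1 / real (Suc M)) - 1"
      using M by (intro ln_le_minus_one) auto
    ultimately have s_lower: "1 / real (Suc M) \<le> s" by simp
    have "s \<le> real (Suc M) / real M - 1" unfolding s_def using M by (intro ln_le_minus_one) auto
    also have "\<dots> \<le> 1" using M by (simp add: field_simps)
    finally have s_upper: "s \<le> 1" .
    have "1 / (real (Suc M) * (1 + L)\<^sup>2) \<le> s / (1 + L)\<^sup>2"
      using s_lower L0 by (simp add: divide_right_mono flip: divide_divide_eq_left)
    also have "\<dots> = 2 * (s / (2 * ((1 + L) * (1 + L))))" by (simp add: power2_eq_square)
    also have "\<dots> \<le> 2 * (s / ((1 + L) * (1 + L + s)))"
    proof -
      have "0 < 1 / real (Suc M)" by simp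
      then have s0: "0 < s" using s_lower by linarith
      have "(1 + L) * (1 + L + s) \<le> (1 + L) * (2 * (1 + L))"
        using L0 s_upper by (intro mult_left_mono) auto
      then have "(1 + L) * (1 + L + s) \<le> 2 * ((1 + L) * (1 + L))" by (simp only: mult_ac)
      moreover have "0 < (1 + L) * (1 + L + s)" using L0 s0 by simp
      ultimately show ?thesis
        using s0 by (intro mult_left_mono divide_left_mono) auto
    qed
    also have "s / ((1 + L) * (1 + L + s)) = g (Suc M) - g M"
    proof -
      have "0 < 1 / real (Suc M)" by simp
      then have "0 < 1 + L" "0 < 1 + L + s" using L0 s_lower by linarith+
      then show ?thesis unfolding g_def lnM L_def[symmetric] by (simp add: field_simps)
    qed
    finally have "1 / (real (Suc M) * (1 + ln (y / real (Suc M)))\<^sup>2) \<le> 2 * (g (Suc M) - g M)"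
      by (simp only: L_def)
    moreover have "(\<Sum>M=1..M. 1 / (real M * (1 + ln (y / real M))\<^sup>2)) \<le> 1 + 2 * (g M - g 1)"
      using Suc My by (intro Suc.IH) auto
    ultimately show ?case by (simp add: sum.cl_ivl_Suc)
  qed
  moreover have "0 \<le> ln (y / real Y)" using assms by (intro ln_ge_zero) (simp add: field_simps)
  then have "g Y \<le> 1" by (simp add: g_def)
  moreover have "0 \<le> g 1" using y by (simp add: g_def)
  ultimately show ?thesis using assms by fastforce
qed
text \<open>
  For fixed \<open>M\<close>, split the \<open>d\<close> at \<open>\<parallel>d\<theta>\<parallel> = \<surd>(M/y)\<close>. Above this threshold the second entry of the minimum
  makes each term at most \<open>1/(y M)\<close>, in total \<open>2/y\<close>. Below it each term is at most \<open>1/M\<^sup>2\<close>, and only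
  \<open>O(M / (1 + ln (y/M))\<^sup>2)\<close> values of \<open>d\<close> occur.
\<close>

lemma diophantine_sum_bounded:
  fixes \<theta> :: real
  assumes "C > 0"
    and dio: "\<And>q::nat. q > 0 \<Longrightarrow> nint_dist (real q * \<theta>) \<ge> C * exp (- (real q powr (1/4)))"
  obtains B where "B > 0" and
    "\<And>y Y. 1 \<le> y \<Longrightarrow> real Y \<le> y \<Longrightarrow>
      (\<Sum>M=1..Y. \<Sum>d=1..2*M. (min (1 / real M) (1 / (y * nint_dist (real d * \<theta>))))\<^sup>2) \<le> B"
proof -
  obtain \<kappa> where \<kappa>: "\<kappa> > 0" and card_le: "\<And>\<delta> K. 0 < \<delta> \<Longrightarrow> \<delta> \<le> 1 \<Longrightarrow>
      real (card {d\<in>{1..K}. nint_dist (real d * \<theta>) < \<delta>}) \<le> \<kappa> * real K / (1 + ln (1 / \<delta>))\<^sup>2"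
    using card_near_integers_log[OF assms] by blast
  have "(\<Sum>M=1..Y. \<Sum>d=1..2*M. (min (1 / real M) (1 / (y * nint_dist (real d * \<theta>))))\<^sup>2) \<le> 2 + 24 * \<kappa>"
    if y: "1 \<le> y" "real Y \<le> y" for y Y
  proof -
    have inner: "(\<Sum>d=1..2*M. (min (1 / real M) (1 / (y * nint_dist (real d * \<theta>))))\<^sup>2) \<le>
        2 / y + 8 * \<kappa> * (1 / (real M * (1 + ln (y / real M))\<^sup>2))" if M: "M \<in> {1..Y}" for M
    proof -
      define \<delta> where "\<delta> = sqrt (real M / y)"
      have M0: "0 < real M" "real M \<le> y" using M y(2) by auto
      have y0: "0 < y" using y by simp
      have d0: "0 < \<delta>" "\<delta> \<le> 1" using M0 y0 by (auto simp: \<delta>_def)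
      have d2: "\<delta>\<^sup>2 = real M / y" using M0 y0 by (simp add: \<delta>_def)
      define l where "l = ln (y / real M)"
      have l0: "0 \<le> l" using M0 by (simp add: l_def)
      have lnd: "ln (1 / \<delta>) = l / 2"
        using M0 y0 d0 by (simp add: \<delta>_def l_def ln_div ln_sqrt field_simps)
      have term_le: "(min (1 / real M) (1 / (y * nint_dist (real d * \<theta>))))\<^sup>2 \<le>
          1 / (y * real M) + (if nint_dist (real d * \<theta>) < \<delta> then 1 / (real M)\<^sup>2 else 0)" for d
      proof (cases "nint_dist (real d * \<theta>) < \<delta>")
        case True
        have "(min (1 / real M) (1 / (y * nint_dist (real d * \<theta>))))\<^sup>2 \<le> (1 / real M)\<^sup>2"
          using M0 y0 by (intro power_mono) auto
        then show ?thesis using True M0 y0 by (simp add: power_divide add_increasing)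
      next
        case False
        have "1 / (y * nint_dist (real d * \<theta>)) \<le> 1 / (y * \<delta>)"
          using False y0 d0 by (intro divide_left_mono mult_left_mono mult_pos_pos) auto
        then have "(min (1 / real M) (1 / (y * nint_dist (real d * \<theta>))))\<^sup>2 \<le> (1 / (y * \<delta>))\<^sup>2"
          using y0 by (intro power_mono) auto
        also have "\<dots> = 1 / (y * real M)"
          using y0 by (simp add: power_divide power_mult_distrib d2) (simp add: power2_eq_square)
        finally show ?thesis using False by simp
      qed
      have "(\<Sum>d=1..2*M. (min (1 / real M) (1 / (y * nint_dist (real d * \<theta>))))\<^sup>2) \<le>
          (\<Sum>d=1..2*M. 1 / (y * real M) + (if nint_dist (real d * \<theta>) < \<delta> then 1 / (real M)\<^sup>2 else 0))"
        by (intro sum_mono term_le)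
      also have "\<dots> = 2 / y + real (card {d\<in>{1..2*M}. nint_dist (real d * \<theta>) < \<delta>}) / (real M)\<^sup>2"
      proof -
        have "(\<Sum>d=1..2*M. if nint_dist (real d * \<theta>) < \<delta> then 1 / (real M)\<^sup>2 else 0) =
            (\<Sum>d\<in>{d\<in>{1..2*M}. nint_dist (real d * \<theta>) < \<delta>}. 1 / (real M)\<^sup>2)"
          by (rule sum.inter_filter[symmetric]) simp
        then show ?thesis using M0 y0 by (simp add: sum.distrib)
      qed
      also have "\<dots> \<le> 2 / y + (\<kappa> * real (2 * M) / (1 + ln (1 / \<delta>))\<^sup>2) / (real M)\<^sup>2"
        by (intro add_left_mono divide_right_mono card_le d0) auto
      also have "(\<kappa> * real (2 * M) / (1 + ln (1 / \<delta>))\<^sup>2) / (real M)\<^sup>2 =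
          2 * \<kappa> / real M * (1 / (1 + l / 2)\<^sup>2)"
        using M0 by (simp add: lnd power2_eq_square mult_ac)
      also have "\<dots> \<le> 2 * \<kappa> / real M * (1 / ((1 + l) / 2)\<^sup>2)"
      proof -
        have "((1 + l) / 2)\<^sup>2 \<le> (1 + l / 2)\<^sup>2" using l0 by (intro power_mono) auto
        moreover have "0 < ((1 + l) / 2)\<^sup>2" using l0 by (intro zero_less_power) auto
        ultimately show ?thesis using \<kappa> M0 by (intro mult_left_mono frac_le) auto
      qed
      also have "\<dots> = 8 * \<kappa> * (1 / (real M * (1 + l)\<^sup>2))" by (simp add: power_divide)
      finally show ?thesis by (simp add: l_def)
    qed
    show ?thesis
    proof (cases "Y = 0")
      case False
      have "(\<Sum>M=1..Y. \<Sum>d=1..2*M. (min (1 / real M) (1 / (y * nint_dist (real d * \<theta>))))\<^sup>2) \<le>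
        (\<Sum>M=1..Y. 2 / y + 8 * \<kappa> * (1 / (real M * (1 + ln (y / real M))\<^sup>2)))"
        by (intro sum_mono inner)
      also have "\<dots> = 2 * (real Y / y) + 8 * \<kappa> * (\<Sum>M=1..Y. 1 / (real M * (1 + ln (y / real M))\<^sup>2))"
        by (simp add: sum.distrib sum_distrib_left)
      also have "\<dots> \<le> 2 * 1 + 8 * \<kappa> * 3"
        using False y \<kappa> by (intro add_mono mult_left_mono sum_inverse_log_squared_le) auto
      finally show ?thesis by simp
    qed (use \<kappa> in auto)
  qed
  then show ?thesis using that[of "2 + 24 * \<kappa>"] \<kappa> by auto
qed

text \<open>
  A pair of maximum \<open>M\<close> lies on one of the four sides of a square, and on each side it is determined
  by the absolute value of its difference.
\<close>

lemma sum_pairs_by_max_and_difference: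
  fixes P :: "(int \<times> int) set" and \<phi> :: "nat \<Rightarrow> nat \<Rightarrow> real"
  assumes "finite P" and P: "\<And>a b. (a, b) \<in> P \<Longrightarrow> a \<noteq> b \<and> max \<bar>a\<bar> \<bar>b\<bar> \<le> int Y"
    and nonneg: "\<And>M d. 0 \<le> \<phi> M d"
  shows "(\<Sum>(a, b)\<in>P. \<phi> (nat (max \<bar>a\<bar> \<bar>b\<bar>)) (nat \<bar>a - b\<bar>)) \<le> 4 * (\<Sum>M=1..Y. \<Sum>d=1..2*M. \<phi> M d)"
proof -
  define T where "T = (UNIV :: (bool \<times> bool) set) \<times> (SIGMA M:{1..Y}. {1..2*M})"
  define side where "side p = (\<bar>snd p\<bar> \<le> \<bar>fst p\<bar>, if \<bar>snd p\<bar> \<le> \<bar>fst p\<bar> then fst p > 0 else snd p > (0::int))"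
    for p :: "int \<times> int"
  define j where "j p = (side p, nat (max \<bar>fst p\<bar> \<bar>snd p\<bar>), nat \<bar>fst p - snd p\<bar>)" for p
  have inj: "inj_on j P"
  proof (rule inj_onI)
    fix p q assume "j p = j q"
    then have *: "side p = side q" "max \<bar>fst p\<bar> \<bar>snd p\<bar> = max \<bar>fst q\<bar> \<bar>snd q\<bar>"
        "\<bar>fst p - snd p\<bar> = \<bar>fst q - snd q\<bar>"
      by (auto simp: j_def le_max_iff_disj elim!: eq_nat_nat_iff[THEN iffD1, rotated 2])
    have "fst p = fst q \<and> snd p = snd q"
    proof (cases "\<bar>snd p\<bar> \<le> \<bar>fst p\<bar>")
      case True
      then have "\<bar>snd q\<bar> \<le> \<bar>fst q\<bar>" "0 < fst p \<longleftrightarrow> 0 < fst q" using *(1) by (auto simp: side_def)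
      moreover from this(1) True have "\<bar>fst p\<bar> = \<bar>fst q\<bar>" using *(2) by (simp add: max_def split: if_splits)
      ultimately have "fst p = fst q" by linarith
      then show ?thesis using True \<open>\<bar>snd q\<bar> \<le> \<bar>fst q\<bar>\<close> *(3) by linarith
    next
      case False
      then have "\<not> \<bar>snd q\<bar> \<le> \<bar>fst q\<bar>" "0 < snd p \<longleftrightarrow> 0 < snd q" using *(1) by (auto simp: side_def)
      moreover from this(1) False have "\<bar>snd p\<bar> = \<bar>snd q\<bar>" using *(2) by (simp add: max_def split: if_splits)
      ultimately have "snd p = snd q" by linarith
      then show ?thesis using False \<open>\<not> \<bar>snd q\<bar> \<le> \<bar>fst q\<bar>\<close> *(3) by linarith
    qed
    then show "p = q" by (simp add: prod_eq_iff)
  qed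
  have sub: "j ` P \<subseteq> T"
  proof (rule image_subsetI)
    fix p assume "p \<in> P"
    then have "fst p \<noteq> snd p" "max \<bar>fst p\<bar> \<bar>snd p\<bar> \<le> int Y" using P[of "fst p" "snd p"] by auto
    then show "j p \<in> T" unfolding j_def T_def by auto
  qed
  have "(\<Sum>(a, b)\<in>P. \<phi> (nat (max \<bar>a\<bar> \<bar>b\<bar>)) (nat \<bar>a - b\<bar>)) = (\<Sum>(s, M, d)\<in>j ` P. \<phi> M d)"
    by (subst sum.reindex[OF inj]) (simp add: j_def case_prod_unfold)
  also have "\<dots> \<le> (\<Sum>(s, M, d)\<in>T. \<phi> M d)"
    by (intro sum_mono2 sub) (auto simp: T_def nonneg)
  also have "\<dots> = 4 * (\<Sum>M=1..Y. \<Sum>d=1..2*M. \<phi> M d)"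
    by (simp add: T_def sum.cartesian_product[symmetric] sum.Sigma card_cartesian_product UNIV_bool)
  finally show ?thesis .
qed

text \<open>
  The only consequence of the Diophantine condition that the fourth moments need, both for short
  and for long sums.
\<close>

definition bounded_pair_sums :: "real \<Rightarrow> real \<Rightarrow> bool" where
  "bounded_pair_sums \<theta> B \<longleftrightarrow> B > 0 \<and>
    (\<forall>y P. 1 \<le> y \<longrightarrow> finite P \<longrightarrow> (\<forall>(a, b)\<in>P. a \<noteq> b \<and> real_of_int (max \<bar>a\<bar> \<bar>b\<bar>) \<le> y) \<longrightarrow>
      (\<Sum>(a, b)\<in>P. (min (1 / of_int (max \<bar>a\<bar> \<bar>b\<bar>)) (1 / (y * nint_dist (of_int (a - b) * \<theta>))))\<^sup>2) \<le> B)"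

lemma diophantine_pair_sum_bounded:
  fixes \<theta> :: real
  assumes "C > 0"
    and dio: "\<And>q::nat. q > 0 \<Longrightarrow> nint_dist (real q * \<theta>) \<ge> C * exp (- (real q powr (1/4)))"
  obtains B where "bounded_pair_sums \<theta> B"
proof -
  obtain B where B: "B > 0" and sum_le: "\<And>y Y. 1 \<le> y \<Longrightarrow> real Y \<le> y \<Longrightarrow>
      (\<Sum>M=1..Y. \<Sum>d=1..2*M. (min (1 / real M) (1 / (y * nint_dist (real d * \<theta>))))\<^sup>2) \<le> B"
    using diophantine_sum_bounded[OF assms] by blast
  have "(\<Sum>(a, b)\<in>P. (min (1 / of_int (max \<bar>a\<bar> \<bar>b\<bar>)) (1 / (y * nint_dist (of_int (a - b) * \<theta>))))\<^sup>2) \<le> 4 * B"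
    if y: "1 \<le> y" and "finite P" and P: "\<And>a b. (a, b) \<in> P \<Longrightarrow> a \<noteq> b \<and> real_of_int (max \<bar>a\<bar> \<bar>b\<bar>) \<le> y"
    for y and P :: "(int \<times> int) set"
  proof -
    define Y where "Y = nat \<lfloor>y\<rfloor>"
    define \<phi> where "\<phi> M d = (min (1 / real M) (1 / (y * nint_dist (real d * \<theta>))))\<^sup>2" for M d :: nat
    have nd: "nint_dist (real (nat \<bar>a - b\<bar>) * \<theta>) = nint_dist (of_int (a - b) * \<theta>)" for a b
    proof (cases "a \<ge> b")
      case False
      then have "real (nat \<bar>a - b\<bar>) * \<theta> = - (of_int (a - b) * \<theta>)" by (simp add: algebra_simps)
      then show ?thesis by (simp only: nint_dist_minus)
    qed simp
    have "(\<Sum>(a, b)\<in>P. (min (1 / of_int (max \<bar>a\<bar> \<bar>b\<bar>)) (1 / (y * nint_dist (of_int (a - b) * \<theta>))))\<^sup>2) =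
        (\<Sum>(a, b)\<in>P. \<phi> (nat (max \<bar>a\<bar> \<bar>b\<bar>)) (nat \<bar>a - b\<bar>))"
      unfolding \<phi>_def nd by (intro sum.cong refl) auto
    also have "\<dots> \<le> 4 * (\<Sum>M=1..Y. \<Sum>d=1..2*M. \<phi> M d)"
    proof (rule sum_pairs_by_max_and_difference[OF \<open>finite P\<close>])
      fix a b assume "(a, b) \<in> P"
      from P[OF this] show "a \<noteq> b \<and> max \<bar>a\<bar> \<bar>b\<bar> \<le> int Y"
        using y by (auto simp: Y_def le_floor_iff)
    qed (simp add: \<phi>_def)
    also have "\<dots> \<le> 4 * B"
      unfolding \<phi>_def using y by (intro mult_left_mono sum_le) (auto simp: Y_def)
    finally show ?thesis .
  qed
  note le = this
  have "bounded_pair_sums \<theta> (4 * B)"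
    unfolding bounded_pair_sums_def
  proof (intro conjI allI impI)
    fix y and P :: "(int \<times> int) set"
    assume "1 \<le> y" "finite P" "\<forall>(a, b)\<in>P. a \<noteq> b \<and> real_of_int (max \<bar>a\<bar> \<bar>b\<bar>) \<le> y"
    then show "(\<Sum>(a, b)\<in>P. (min (1 / of_int (max \<bar>a\<bar> \<bar>b\<bar>)) (1 / (y * nint_dist (of_int (a - b) * \<theta>))))\<^sup>2) \<le> 4 * B"
      by (intro le) auto
  qed (use B in simp)
  then show ?thesis by (rule that)
qed

section \<open>Ratios of elements of a short interval modulo a prime\<close>

lemma card_congruent_in_interval:
  fixes S :: "int set" and m :: int and z W :: real
  assumes "finite S" "1 \<le> m" "0 \<le> W"
    and cong: "\<And>s t. s \<in> S \<Longrightarrow> t \<in> S \<Longrightarrow> m dvd s - t"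
    and near: "\<And>s. s \<in> S \<Longrightarrow> \<bar>of_int s - z\<bar> \<le> W"
  shows "real (card S) \<le> 1 + 2 * W / of_int m"
proof (cases "S = {}")
  case True
  then show ?thesis using assms(2,3) by simp
next
  case False
  define s0 where "s0 = Min S"
  have s0: "s0 \<in> S" "\<And>s. s \<in> S \<Longrightarrow> s0 \<le> s" using False assms(1) by (auto simp: s0_def)
  let ?f = "\<lambda>s. (s - s0) div m"
  have m0: "0 < real_of_int m" using assms(2) by simp
  have "inj_on ?f S"
  proof (rule inj_onI)
    fix s t assume st: "s \<in> S" "t \<in> S" "?f s = ?f t"
    have "s - s0 = t - s0"
      using cong[OF st(1) s0(1)] cong[OF st(2) s0(1)] st(3) by (metis dvd_div_mult_self)
    then show "s = t" by simp
  qed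
  moreover have "?f ` S \<subseteq> {0..\<lfloor>2 * W / of_int m\<rfloor>}"
  proof (rule image_subsetI)
    fix s assume s: "s \<in> S"
    have "real_of_int (s - s0) \<le> 2 * W" using near[OF s] near[OF s0(1)] by simp
    moreover have "real_of_int (?f s) * of_int m \<le> of_int (s - s0)"
      unfolding of_int_mult[symmetric] of_int_le_iff
      using cong[OF s s0(1)] by simp
    ultimately have "real_of_int (?f s) \<le> 2 * W / of_int m"
      using m0 by (simp add: pos_le_divide_eq)
    moreover have "0 \<le> ?f s" using s0(2)[OF s] assms(2) by (simp add: pos_imp_zdiv_nonneg_iff)
    ultimately show "?f s \<in> {0..\<lfloor>2 * W / of_int m\<rfloor>}" by (simp add: le_floor_iff)
  qed
  ultimately have "card S \<le> card {0..\<lfloor>2 * W / of_int m\<rfloor>}"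
    by (intro card_inj_on_le) auto
  moreover have "0 \<le> 2 * W / of_int m" using m0 assms(3) by simp
  ultimately show ?thesis by simp linarith
qed

text \<open>
  Writing \<open>h b - k a = r c\<close> with \<open>h\<close> and \<open>k\<close> close to \<open>z\<close> shows that \<open>c\<close> is close to \<open>(z/r) (b - a)\<close>.
  This limits the number of values of \<open>c\<close>, and if there is any solution at all it makes \<open>(z/r) (a - b)\<close>
  close to an integer. For a given \<open>c\<close>, coprimality fixes the residue of \<open>h\<close> modulo \<open>a\<close> and of \<open>k\<close>
  modulo \<open>b\<close>, and one of these moduli is \<open>M\<close> up to sign.
\<close>

lemma card_proportional_pairs_le:
  fixes I :: "int set" and a b r :: int and z W :: real
  assumes "finite I" "0 < r" "0 \<le> W" and near: "\<And>h. h \<in> I \<Longrightarrow> \<bar>of_int h - z\<bar> \<le> W"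
    and ab: "coprime a b"
  defines "M \<equiv> max \<bar>a\<bar> \<bar>b\<bar>"
  defines "S \<equiv> {(h, k). h \<in> I \<and> k \<in> I \<and> r dvd h * b - k * a}"
  shows "real (card S) \<le> (1 + 4 * W * of_int M / of_int r) * (1 + 2 * W / of_int M)" (is ?card)
    and "S \<noteq> {} \<Longrightarrow> nint_dist (of_int (a - b) * (z / of_int r)) \<le> 2 * W * of_int M / of_int r" (is "_ \<Longrightarrow> ?near")
proof -
  have M1: "1 \<le> M"
  proof -
    have "a \<noteq> 0 \<or> b \<noteq> 0" using ab by auto
    then show ?thesis by (auto simp: M_def)
  qed
  have r0: "0 < real_of_int r" using assms(2) by simp
  have finS: "finite S" unfolding S_def by (rule finite_subset[OF _ finite_cartesian_product[OF assms(1,1)]]) auto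
  define c where "c p = (fst p * b - snd p * a) div r" for p :: "int \<times> int"
  have c: "fst p * b - snd p * a = r * c p" if "p \<in> S" for p
    using that by (auto simp: c_def S_def)
  have c_near: "\<bar>of_int (c p) - z / of_int r * of_int (b - a)\<bar> \<le> 2 * W * of_int M / of_int r" if p: "p \<in> S" for p
  proof -
    have hk: "\<bar>of_int (fst p) - z\<bar> \<le> W" "\<bar>of_int (snd p) - z\<bar> \<le> W"
      using p near by (auto simp: S_def)
    have "of_int r * (of_int (c p) - z / of_int r * of_int (b - a)) = of_int (r * c p) - z * of_int (b - a)"
      using r0 by (simp add: field_simps)
    also have "\<dots> = (of_int (fst p) - z) * of_int b - (of_int (snd p) - z) * of_int a"
      unfolding c[OF p, symmetric] by (simp add: algebra_simps)
    also have "\<bar>\<dots>\<bar> \<le> \<bar>of_int (fst p) - z\<bar> * \<bar>of_int b\<bar> + \<bar>of_int (snd p) - z\<bar> * \<bar>of_int a\<bar>"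
      unfolding abs_mult[symmetric] by (rule abs_triangle_ineq4)
    also have "\<dots> \<le> W * of_int M + W * of_int M"
      using assms(3) by (intro add_mono mult_mono hk) (auto simp: M_def)
    finally have "of_int r * \<bar>of_int (c p) - z / of_int r * of_int (b - a)\<bar> \<le> 2 * W * of_int M"
      using r0 by (simp add: abs_mult)
    then show ?thesis using r0 by (simp add: pos_le_divide_eq mult.commute)
  qed
  show ?near if "S \<noteq> {}"
  proof -
    obtain p where p: "p \<in> S" using \<open>S \<noteq> {}\<close> by blast
    have "nint_dist (of_int (a - b) * (z / of_int r)) \<le> \<bar>of_int (a - b) * (z / of_int r) - of_int (- c p)\<bar>"
      by (rule nint_dist_le)
    also have "\<dots> = \<bar>of_int (c p) - z / of_int r * of_int (b - a)\<bar>" by (simp add: algebra_simps)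
    finally show ?thesis using c_near[OF p] by linarith
  qed
  have card_c: "real (card (c ` S)) \<le> 1 + 4 * W * of_int M / of_int r"
  proof -
    have "real (card (c ` S)) \<le> 1 + 2 * (2 * W * of_int M / of_int r) / of_int 1"
    proof (rule card_congruent_in_interval[where z = "z / of_int r * of_int (b - a)"])
      fix s assume "s \<in> c ` S"
      then obtain p where "s = c p" "p \<in> S" by blast
      then show "\<bar>of_int s - z / of_int r * of_int (b - a)\<bar> \<le> 2 * W * of_int M / of_int r"
        using c_near by blast
    qed (use finS assms(3) M1 r0 in auto)
    then show ?thesis by simp
  qed
  have fibre: "real (card {p\<in>S. c p = v}) \<le> 1 + 2 * W / of_int M" for v
  proof -
    have *: "real (card {p\<in>S. c p = v}) \<le> 1 + 2 * W / of_int M"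
      if coord: "inj_on f {p\<in>S. c p = v}" "\<And>p. p \<in> S \<Longrightarrow> f p \<in> I"
        "\<And>p q. p \<in> {p\<in>S. c p = v} \<Longrightarrow> q \<in> {p\<in>S. c p = v} \<Longrightarrow> M dvd f p - f q" for f
    proof -
      have "real (card (f ` {p\<in>S. c p = v})) \<le> 1 + 2 * W / of_int M"
        by (rule card_congruent_in_interval[of _ M W z]) (use finS M1 assms(3) coord near in auto)
      then show ?thesis by (simp add: card_image[OF coord(1)])
    qed
    have diff: "(fst p - fst q) * b = (snd p - snd q) * a"
      if "p \<in> {p\<in>S. c p = v}" "q \<in> {p\<in>S. c p = v}" for p q
      using c[of p] c[of q] that by (simp add: algebra_simps)
    show ?thesis
    proof (cases "\<bar>b\<bar> \<le> \<bar>a\<bar>")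
      case True
      then have Ma: "M = \<bar>a\<bar>" "a \<noteq> 0" using M1 by (auto simp: M_def)
      show ?thesis
      proof (rule *[of fst])
        show "inj_on fst {p\<in>S. c p = v}"
        proof (rule inj_onI)
          fix p q assume "p \<in> {p\<in>S. c p = v}" "q \<in> {p\<in>S. c p = v}" "fst p = fst q"
          then show "p = q" using diff[of p q] Ma(2) by (simp add: prod_eq_iff)
        qed
        fix p q assume "p \<in> {p\<in>S. c p = v}" "q \<in> {p\<in>S. c p = v}"
        from diff[OF this] have "a dvd (fst p - fst q) * b" by simp
        then show "M dvd fst p - fst q" using ab Ma(1) by (simp add: coprime_dvd_mult_left_iff)
      qed (auto simp: S_def)
    next
      case False
      then have Mb: "M = \<bar>b\<bar>" "b \<noteq> 0" using M1 by (auto simp: M_def)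
      show ?thesis
      proof (rule *[of snd])
        show "inj_on snd {p\<in>S. c p = v}"
        proof (rule inj_onI)
          fix p q assume "p \<in> {p\<in>S. c p = v}" "q \<in> {p\<in>S. c p = v}" "snd p = snd q"
          then show "p = q" using diff[of p q] Mb(2) by (simp add: prod_eq_iff)
        qed
        fix p q assume "p \<in> {p\<in>S. c p = v}" "q \<in> {p\<in>S. c p = v}"
        from diff[OF this, symmetric] have "b dvd (snd p - snd q) * a" by simp
        then show "M dvd snd p - snd q" using ab Mb(1) by (simp add: coprime_dvd_mult_left_iff coprime_commute)
      qed (auto simp: S_def)
    qed
  qed
  have "real (card S) = (\<Sum>v\<in>c ` S. real (card {p\<in>S. c p = v}))"
    using sum.image_gen[OF finS, of "\<lambda>_. 1 :: real" c] by simp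
  also have "\<dots> \<le> (\<Sum>v\<in>c ` S. 1 + 2 * W / of_int M)" by (intro sum_mono fibre)
  also have "\<dots> = real (card (c ` S)) * (1 + 2 * W / of_int M)" by simp
  also have "\<dots> \<le> (1 + 4 * W * of_int M / of_int r) * (1 + 2 * W / of_int M)"
    using assms(3) M1 by (intro mult_right_mono card_c add_nonneg_nonneg divide_nonneg_nonneg) auto
  finally show ?card .
qed

text \<open>
  Coincidences \<open>h/k = h'/k'\<close> modulo \<open>r\<close>. Their number is the multiplicative energy of \<open>I\<close>.
\<close>

definition ratio_quadruples :: "int \<Rightarrow> int set \<Rightarrow> ((int \<times> int) \<times> (int \<times> int)) set" where
  "ratio_quadruples r I = {((h, k), (h', k')). h \<in> I \<and> k \<in> I \<and> h' \<in> I \<and> k' \<in> I \<and> r dvd h * k' - h' * k}"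

text \<open>
  The bound has the order \<open>W\<^sup>2\<close> of the trivial solutions \<open>(h, k) = (h', k')\<close>. Any other solution has
  \<open>(h', k') = (h, k) + g (a, b)\<close> with \<open>a\<close>, \<open>b\<close> coprime and \<open>0 < g < r\<close>, and the condition on it reduces
  to \<open>h b = k a\<close> modulo \<open>r\<close>. With \<open>M = max(|a|, |b|)\<close> there are \<open>O(W/M)\<close> choices of \<open>g\<close> and \<open>O(W/M)\<close>
  choices of \<open>(h, k)\<close>, and the latter occur only if \<open>\<parallel>(a-b)\<theta>\<parallel> \<le> 2 W M / r\<close>, which is \<open>O(M / W)\<close>.
  That restriction is absorbed by \<open>min (1/M) (1/(2 W \<parallel>(a-b)\<theta>\<parallel>))\<close>.
\<close>

lemma card_ratio_quadruples_le:
  fixes \<theta> W L :: real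
  assumes B: "bounded_pair_sums \<theta> B" and \<theta>: "\<theta> \<notin> \<rat>"
    and r: "prime r" and I: "finite I" "\<And>h. h \<in> I \<Longrightarrow> \<bar>of_int h + of_int r * \<theta>\<bar> \<le> W"
    and W: "1 \<le> W" "2 * W < of_int r" "W\<^sup>2 \<le> L\<^sup>2 * of_int r" and L: "1 \<le> L"
  shows "real (card (ratio_quadruples r I)) \<le> (9 + 8 * (1 + 8 * L\<^sup>2) * (2 + 16 * L ^ 4 * B)) * W\<^sup>2"
proof -
  have r0: "0 < r" using r by (simp add: prime_gt_0_int)
  then have r0': "0 < real_of_int r" by simp
  define z where "z = - (of_int r * \<theta>)"
  have near: "\<bar>of_int h - z\<bar> \<le> W" if "h \<in> I" for h using I(2)[OF that] by (simp add: z_def)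
  define S where "S a b = {(h, k). h \<in> I \<and> k \<in> I \<and> r dvd h * b - k * a}" for a b
  define N where "N a b = nat \<lfloor>2 * W / of_int (max \<bar>a\<bar> \<bar>b\<bar>)\<rfloor>" for a b :: int
  have finS: "finite (S a b)" for a b
    unfolding S_def by (rule finite_subset[OF _ finite_cartesian_product[OF I(1,1)]]) auto
  define Y where "Y = \<lfloor>2 * W\<rfloor>"
  define P where "P = {(a, b). a \<in> {-Y..Y} \<and> b \<in> {-Y..Y} \<and> coprime a b \<and> S a b \<noteq> {}}"
  have finP: "finite P"
    unfolding P_def by (rule finite_subset[of _ "{-Y..Y} \<times> {-Y..Y}"]) auto
  define Q where "Q = ratio_quadruples r I"
  have finQ: "finite Q"
    unfolding Q_def ratio_quadruples_def
    by (rule finite_subset[of _ "(I \<times> I) \<times> (I \<times> I)"]) (use I(1) in auto)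
  define Q0 where "Q0 = {q\<in>Q. fst q = snd q}"
  define Q1 where "Q1 = {q\<in>Q. fst q \<noteq> snd q}"
  have "card Q = card Q0 + card Q1"
    unfolding Q0_def Q1_def using finQ by (subst card_Un_disjoint[symmetric]) (auto intro: arg_cong[where f = card])
  have cardI: "real (card I) \<le> 3 * W"
    using card_congruent_in_interval[of I 1 W z] I(1) near W(1) by simp
  have "real (card Q0) \<le> 9 * W\<^sup>2"
  proof -
    have "card Q0 \<le> card (I \<times> I)"
      by (rule card_inj_on_le[of fst]) (auto simp: Q0_def Q_def ratio_quadruples_def inj_on_def I(1))
    then have "real (card Q0) \<le> real (card I) * real (card I)"
      by (simp add: card_cartesian_product flip: of_nat_mult)
    also have "\<dots> \<le> (3 * W) * (3 * W)" using cardI W(1) by (intro mult_mono) auto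
    finally show ?thesis by (simp add: power2_eq_square)
  qed
  moreover have "real (card Q1) \<le> (\<Sum>(a, b)\<in>P. real (N a b) * real (card (S a b)))"
  proof -
    \<comment> \<open>A nontrivial solution is encoded by its reduced direction, the multiple of it, and its start.\<close>
    define \<psi> where "\<psi> q = (case q of ((h, k), (h', k')) \<Rightarrow>
      let g = gcd (h' - h) (k' - k) in (((h' - h) div g, (k' - k) div g), (nat g, (h, k))))" for q :: "(int \<times> int) \<times> (int \<times> int)"
    have "inj_on \<psi> Q1"
    proof (rule inj_on_inverseI)
      fix q assume "q \<in> Q1"
      show "(\<lambda>((a, b), (g, (h, k))). ((h, k), (h + int g * a, k + int g * b))) (\<psi> q) = q"
        by (auto simp: \<psi>_def Let_def split: prod.splits)
    qed
    moreover have "\<psi> ` Q1 \<subseteq> Sigma P (\<lambda>(a, b). {1..N a b} \<times> S a b)"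
    proof (rule image_subsetI)
      fix q assume q: "q \<in> Q1"
      obtain h k h' k' where hk: "q = ((h, k), (h', k'))" by (metis prod.exhaust)
      have mem: "h \<in> I" "k \<in> I" "h' \<in> I" "k' \<in> I" "r dvd h * k' - h' * k" "(h, k) \<noteq> (h', k')"
        using q by (auto simp: hk Q1_def Q_def ratio_quadruples_def)
      define g where "g = gcd (h' - h) (k' - k)"
      define a where "a = (h' - h) div g"
      define b where "b = (k' - k) div g"
      have g: "0 < g" using mem(6) by (auto simp: g_def)
      have ab: "h' - h = g * a" "k' - k = g * b" by (simp_all add: a_def b_def g_def)
      have cop: "coprime a b" unfolding a_def b_def g_def by (rule div_gcd_coprime) (use mem(6) in auto)
      have hW: "\<bar>real_of_int g * of_int a\<bar> \<le> 2 * W" "\<bar>real_of_int g * of_int b\<bar> \<le> 2 * W"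
        unfolding of_int_mult[symmetric] ab[symmetric]
        using near[OF mem(1)] near[OF mem(2)] near[OF mem(3)] near[OF mem(4)] by (auto simp: abs_le_iff)
      then have gM: "of_int g * of_int (max \<bar>a\<bar> \<bar>b\<bar>) \<le> 2 * W"
        using g by (auto simp: max_def abs_mult)
      have M1: "1 \<le> max \<bar>a\<bar> \<bar>b\<bar>"
      proof -
        have "a \<noteq> 0 \<or> b \<noteq> 0" using cop by auto
        then show ?thesis by auto
      qed
      have "real_of_int g \<le> of_int g * of_int (max \<bar>a\<bar> \<bar>b\<bar>)"
        unfolding of_int_mult[symmetric] of_int_le_iff using M1 g by simp
      then have g_less: "g < r" using gM W(2) by simp
      have "real_of_int (max \<bar>a\<bar> \<bar>b\<bar>) \<le> of_int g * of_int (max \<bar>a\<bar> \<bar>b\<bar>)"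
        unfolding of_int_mult[symmetric] of_int_le_iff
        using M1 g mult_right_mono[of 1 g "max \<bar>a\<bar> \<bar>b\<bar>"] by simp
      then have "max \<bar>a\<bar> \<bar>b\<bar> \<le> Y" using gM by (simp add: Y_def le_floor_iff)
      then have Yab: "a \<in> {-Y..Y}" "b \<in> {-Y..Y}" by auto
      have "real_of_int g \<le> 2 * W / of_int (max \<bar>a\<bar> \<bar>b\<bar>)"
        using gM M1 by (simp add: pos_le_divide_eq)
      then have gN: "nat g \<in> {1..N a b}" using g by (auto simp: N_def le_nat_iff le_floor_iff)
      have "h * k' - h' * k = g * (h * b - k * a)"
        using ab by (simp add: algebra_simps)
      then have "r dvd g * (h * b - k * a)" using mem(5) by simp
      moreover have "\<not> r dvd g" using g g_less zdvd_not_zless by blast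
      ultimately have "r dvd h * b - k * a" using r by (simp add: prime_dvd_mult_iff)
      then have S: "(h, k) \<in> S a b" using mem by (simp add: S_def)
      have "\<psi> q = ((a, b), (nat g, (h, k)))" by (simp add: \<psi>_def hk g_def a_def b_def Let_def)
      then show "\<psi> q \<in> Sigma P (\<lambda>(a, b). {1..N a b} \<times> S a b)"
        using S gN cop Yab by (auto simp: P_def)
    qed
    ultimately have "card Q1 \<le> card (Sigma P (\<lambda>(a, b). {1..N a b} \<times> S a b))"
      using finP finS by (intro card_inj_on_le) auto
    also have "\<dots> = (\<Sum>(a, b)\<in>P. N a b * card (S a b))"
      using finP finS by (subst card_SigmaI) (auto simp: card_cartesian_product intro!: sum.cong)
    finally have "real (card Q1) \<le> real (\<Sum>(a, b)\<in>P. N a b * card (S a b))" by (simp only: of_nat_le_iff)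
    then show ?thesis by (simp add: case_prod_unfold)
  qed
  moreover have "(\<Sum>(a, b)\<in>P. real (N a b) * real (card (S a b))) \<le>
      8 * W\<^sup>2 * (1 + 8 * L\<^sup>2) * (2 + 16 * L ^ 4 * B)"
  proof -
    define H where "H = 8 * W\<^sup>2 * (1 + 8 * L\<^sup>2)"
    have H0: "0 \<le> H" by (simp add: H_def)
    \<comment> \<open>The interval is at most of the order of the square root of r; this is where the sum must be long.\<close>
    have rW: "W / of_int r \<le> L\<^sup>2 / W"
      using W(1,3) r0' by (simp add: field_simps power2_eq_square)
    have PM: "1 \<le> max \<bar>a\<bar> \<bar>b\<bar>" "real_of_int (max \<bar>a\<bar> \<bar>b\<bar>) \<le> 2 * W" if "(a, b) \<in> P" for a b
    proof -
      have "a \<noteq> 0 \<or> b \<noteq> 0" using that by (auto simp: P_def)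
      then show "1 \<le> max \<bar>a\<bar> \<bar>b\<bar>" by auto
      have "max \<bar>a\<bar> \<bar>b\<bar> \<le> Y" using that by (auto simp: P_def)
      then show "real_of_int (max \<bar>a\<bar> \<bar>b\<bar>) \<le> 2 * W" by (simp add: Y_def le_floor_iff)
    qed
    have term_le: "real (N a b) * real (card (S a b)) \<le> H * (1 / of_int (max \<bar>a\<bar> \<bar>b\<bar>))\<^sup>2" if "(a, b) \<in> P" for a b
    proof -
      define M where "M = real_of_int (max \<bar>a\<bar> \<bar>b\<bar>)"
      have M: "1 \<le> M" "M \<le> 2 * W" using PM[OF that] by (auto simp: M_def)
      have "real (card (S a b)) \<le> (1 + 4 * W * M / of_int r) * (1 + 2 * W / M)"
        unfolding S_def M_def
        by (rule card_proportional_pairs_le(1)[OF I(1) r0 _ near]) (use W(1) that in \<open>auto simp: P_def\<close>)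
      also have "\<dots> \<le> (1 + 8 * L\<^sup>2) * (4 * W / M)"
      proof (intro mult_mono)
        have "4 * W * M / of_int r \<le> 4 * W * (2 * W) / of_int r"
          using M W(1) r0' by (intro divide_right_mono mult_left_mono) auto
        also have "\<dots> = 8 * (W\<^sup>2 / of_int r)" by (simp add: power2_eq_square)
        also have "\<dots> \<le> 8 * L\<^sup>2" using W(3) r0' by (simp add: pos_divide_le_eq)
        finally show "1 + 4 * W * M / of_int r \<le> 1 + 8 * L\<^sup>2" by simp
        show "1 + 2 * W / M \<le> 4 * W / M" using M W(1) by (simp add: field_simps)
      qed (use M W(1) in auto)
      finally have "real (card (S a b)) \<le> (1 + 8 * L\<^sup>2) * (4 * W / M)" .
      moreover have "real (N a b) \<le> 2 * W / M"
      proof -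
        have "0 \<le> 2 * W / M" using M W(1) by simp
        then show ?thesis unfolding N_def M_def[symmetric] by linarith
      qed
      ultimately have "real (N a b) * real (card (S a b)) \<le> (2 * W / M) * ((1 + 8 * L\<^sup>2) * (4 * W / M))"
        using M W(1) by (intro mult_mono) auto
      also have "\<dots> = H * (1 / M)\<^sup>2" by (simp add: H_def power2_eq_square)
      finally show ?thesis by (simp add: M_def)
    qed
    have min_le: "(1 / of_int (max \<bar>a\<bar> \<bar>b\<bar>))\<^sup>2 \<le> 16 * L ^ 4 *
        (min (1 / of_int (max \<bar>a\<bar> \<bar>b\<bar>)) (1 / (2 * W * nint_dist (of_int (a - b) * \<theta>))))\<^sup>2"
      if P: "(a, b) \<in> P" and "a \<noteq> b" for a b
    proof -
      define M where "M = real_of_int (max \<bar>a\<bar> \<bar>b\<bar>)"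
      define t where "t = nint_dist (of_int (a - b) * \<theta>)"
      have M: "1 \<le> M" using PM[OF P] by (auto simp: M_def)
      have "of_int (a - b) * \<theta> \<notin> \<int>"
      proof
        assume "of_int (a - b) * \<theta> \<in> \<int>"
        then have "of_int (a - b) * \<theta> / of_int (a - b) \<in> \<rat>"
          using Ints_subset_Rats by (intro Rats_divide) auto
        then show False using \<theta> \<open>a \<noteq> b\<close> by simp
      qed
      then have t0: "0 < t" unfolding t_def by (rule nint_dist_pos)
      have "nint_dist (of_int (a - b) * (z / of_int r)) \<le> 2 * W * M / of_int r"
        unfolding M_def
        by (rule card_proportional_pairs_le(2)[OF I(1) r0 _ near]) (use W(1) P in \<open>auto simp: P_def S_def\<close>)
      also have "of_int (a - b) * (z / of_int r) = - (of_int (a - b) * \<theta>)"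
        using r0' by (simp add: z_def)
      finally have "t \<le> 2 * M * (W / of_int r)" by (simp add: t_def mult_ac)
      also have "\<dots> \<le> 2 * M * (L\<^sup>2 / W)" using rW M by (intro mult_left_mono) auto
      finally have "1 / M \<le> 4 * L\<^sup>2 * (1 / (2 * W * t))"
        using t0 M W(1) by (simp add: field_simps)
      moreover have "1 / M \<le> 4 * L\<^sup>2 * (1 / M)"
      proof -
        have "1 \<le> L\<^sup>2" using L by simp
        then have "1 * (1 / M) \<le> (4 * L\<^sup>2) * (1 / M)" using M by (intro mult_right_mono) auto
        then show ?thesis by simp
      qed
      ultimately have "1 / M \<le> 4 * L\<^sup>2 * min (1 / M) (1 / (2 * W * t))" by (simp add: min_def)
      then have "(1 / M)\<^sup>2 \<le> (4 * L\<^sup>2 * min (1 / M) (1 / (2 * W * t)))\<^sup>2"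
        using M by (intro power_mono) auto
      then show ?thesis by (simp add: M_def t_def power_mult_distrib flip: power_mult)
    qed
    have "(\<Sum>(a, b)\<in>P. real (N a b) * real (card (S a b))) \<le> (\<Sum>(a, b)\<in>P. H * (1 / of_int (max \<bar>a\<bar> \<bar>b\<bar>))\<^sup>2)"
      using term_le by (intro sum_mono) auto
    also have "\<dots> = H * (\<Sum>(a, b)\<in>P. (1 / of_int (max \<bar>a\<bar> \<bar>b\<bar>))\<^sup>2)"
      by (simp add: sum_distrib_left case_prod_unfold)
    also have "(\<Sum>(a, b)\<in>P. (1 / real_of_int (max \<bar>a\<bar> \<bar>b\<bar>))\<^sup>2) =
        (\<Sum>(a, b)\<in>{p\<in>P. fst p = snd p}. (1 / real_of_int (max \<bar>a\<bar> \<bar>b\<bar>))\<^sup>2) +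
        (\<Sum>(a, b)\<in>{p\<in>P. fst p \<noteq> snd p}. (1 / real_of_int (max \<bar>a\<bar> \<bar>b\<bar>))\<^sup>2)"
      using finP by (subst sum.union_disjoint[symmetric]) (auto intro!: sum.cong)
    also have "\<dots> \<le> 2 + 16 * L ^ 4 * B"
    proof (rule add_mono)
      \<comment> \<open>Coprime entries that are equal are units.\<close>
      have "{p\<in>P. fst p = snd p} \<subseteq> {(1, 1), (-1, -1)}" by (auto simp: P_def zdvd1_eq abs_if split: if_splits)
      then have "(\<Sum>(a, b)\<in>{p\<in>P. fst p = snd p}. (1 / real_of_int (max \<bar>a\<bar> \<bar>b\<bar>))\<^sup>2) \<le>
          (\<Sum>(a, b)\<in>{(1, 1), (-1, -1)}. (1 / real_of_int (max \<bar>a\<bar> \<bar>b\<bar>))\<^sup>2)"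
        by (intro sum_mono2) auto
      then show "(\<Sum>(a, b)\<in>{p\<in>P. fst p = snd p}. (1 / real_of_int (max \<bar>a\<bar> \<bar>b\<bar>))\<^sup>2) \<le> 2" by simp
      have "(\<Sum>(a, b)\<in>{p\<in>P. fst p \<noteq> snd p}. (1 / real_of_int (max \<bar>a\<bar> \<bar>b\<bar>))\<^sup>2) \<le>
          (\<Sum>(a, b)\<in>{p\<in>P. fst p \<noteq> snd p}. 16 * L ^ 4 *
          (min (1 / of_int (max \<bar>a\<bar> \<bar>b\<bar>)) (1 / (2 * W * nint_dist (of_int (a - b) * \<theta>))))\<^sup>2)"
        using min_le by (intro sum_mono) auto
      also have "\<dots> = 16 * L ^ 4 * (\<Sum>(a, b)\<in>{p\<in>P. fst p \<noteq> snd p}.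
          (min (1 / of_int (max \<bar>a\<bar> \<bar>b\<bar>)) (1 / (2 * W * nint_dist (of_int (a - b) * \<theta>))))\<^sup>2)"
        by (simp add: sum_distrib_left case_prod_unfold)
      also have "\<dots> \<le> 16 * L ^ 4 * B"
      proof (intro mult_left_mono)
        have "\<forall>(a, b)\<in>{p\<in>P. fst p \<noteq> snd p}. a \<noteq> b \<and> real_of_int (max \<bar>a\<bar> \<bar>b\<bar>) \<le> 2 * W"
          using PM(2) by auto
        moreover have "1 \<le> 2 * W" "finite {p\<in>P. fst p \<noteq> snd p}" using W(1) finP by auto
        ultimately show "(\<Sum>(a, b)\<in>{p\<in>P. fst p \<noteq> snd p}.
          (min (1 / of_int (max \<bar>a\<bar> \<bar>b\<bar>)) (1 / (2 * W * nint_dist (of_int (a - b) * \<theta>))))\<^sup>2) \<le> B"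
          using B unfolding bounded_pair_sums_def by blast
      qed (use L in auto)
      finally show "(\<Sum>(a, b)\<in>{p\<in>P. fst p \<noteq> snd p}. (1 / real_of_int (max \<bar>a\<bar> \<bar>b\<bar>))\<^sup>2) \<le> 16 * L ^ 4 * B" .
    qed
    finally show ?thesis using H0 by (simp add: H_def mult_left_mono)
  qed
  ultimately have "real (card Q) \<le> 9 * W\<^sup>2 + 8 * W\<^sup>2 * (1 + 8 * L\<^sup>2) * (2 + 16 * L ^ 4 * B)"
    using \<open>card Q = card Q0 + card Q1\<close> by simp
  moreover have "9 * u + 8 * u * v * t = (9 + 8 * v * t) * u" for u v t :: real by (simp add: algebra_simps)
  ultimately show ?thesis by (simp only: Q_def)
qed

section \<open>Mixed sums with a Lipschitz weight: the fourth moment of a short sum\<close>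

text \<open>
  Turns a sum over coincidences \<open>k i = k j\<close> into a sum of squares, so that cancellation inside each
  fibre can be used.
\<close>

lemma double_sum_over_fibres:
  fixes c :: "'i \<Rightarrow> complex"
  assumes "finite X"
  shows "(\<Sum>i\<in>X. \<Sum>j\<in>X. if k i = k j then c i * cnj (c j) else 0) =
    of_real (\<Sum>v\<in>k ` X. (cmod (\<Sum>i\<in>{i\<in>X. k i = v}. c i))\<^sup>2)"
proof -
  have "(\<Sum>i\<in>X. \<Sum>j\<in>X. if k i = k j then c i * cnj (c j) else 0) =
    (\<Sum>v\<in>k ` X. \<Sum>i\<in>{i\<in>X. k i = v}. \<Sum>j\<in>X. if k i = k j then c i * cnj (c j) else 0)"
    by (rule sum.image_gen[OF assms])
  also have "\<dots> = (\<Sum>v\<in>k ` X. \<Sum>i\<in>{i\<in>X. k i = v}. \<Sum>j\<in>{j\<in>X. k j = v}. c i * cnj (c j))"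
  proof (rule sum.cong[OF refl], rule sum.cong[OF refl])
    fix v i assume "i \<in> {i \<in> X. k i = v}"
    then show "(\<Sum>j\<in>X. if k i = k j then c i * cnj (c j) else 0) = (\<Sum>j\<in>{j\<in>X. k j = v}. c i * cnj (c j))"
      unfolding sum.inter_filter[OF assms] by (intro sum.cong) auto
  qed
  also have "\<dots> = (\<Sum>v\<in>k ` X. (\<Sum>i\<in>{i\<in>X. k i = v}. c i) * cnj (\<Sum>i\<in>{i\<in>X. k i = v}. c i))"
    by (simp only: sum_product cnj_sum)
  finally show ?thesis by (simp only: of_real_sum complex_norm_square)
qed

text \<open>
  A smooth function with support in \<open>[0, 1]\<close> is Lipschitz, and by continuity it vanishes at the end
  points too. Hence the sum over \<open>1 \<le> n \<le> x\<close> is a sum over \<open>0 < n < r\<close> even if \<open>x = r\<close>.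
\<close>

locale lipschitz_weight =
  fixes w :: "real \<Rightarrow> real" and A K :: real
  assumes A_pos: "A > 0" and K_pos: "K > 0"
    and abs_w_le: "\<bar>w t\<bar> \<le> A"
    and w_lipschitz: "\<bar>w s - w t\<bar> \<le> K * \<bar>s - t\<bar>"
    and w_outside: "t \<le> 0 \<or> 1 \<le> t \<Longrightarrow> w t = 0"
begin

definition twist :: "real \<Rightarrow> real \<Rightarrow> nat \<Rightarrow> complex" where
  "twist \<theta> x n = e (real n * \<theta>) * of_real (w (real n / x))"

definition mixed_sum :: "real \<Rightarrow> real \<Rightarrow> (nat \<Rightarrow> complex) \<Rightarrow> complex" where
  "mixed_sum \<theta> x chi = (\<Sum>n | 1 \<le> n \<and> real n \<le> x. chi n * e (real n * \<theta>) * of_real (w (real n / x)))"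

lemma cmod_twist: "cmod (twist \<theta> x n) = \<bar>w (real n / x)\<bar>"
  by (simp add: twist_def norm_mult)

lemma twist_outside: "0 < x \<Longrightarrow> n = 0 \<or> x \<le> real n \<Longrightarrow> twist \<theta> x n = 0"
  by (auto simp: twist_def w_outside)

lemma mixed_sum_eq:
  assumes "0 < x"
  shows "mixed_sum \<theta> x chi = (\<Sum>n\<in>{1..nat \<lfloor>x\<rfloor>}. twist \<theta> x n * chi n)"
proof -
  have "{n. 1 \<le> n \<and> real n \<le> x} = {1..nat \<lfloor>x\<rfloor>}" using assms by (auto simp: le_nat_floor le_floor_iff le_nat_iff)
  then show ?thesis by (simp add: mixed_sum_def twist_def mult_ac)
qed

lemma mixed_sum_eq_residues:
  assumes "0 < x" "x \<le> real r"
  shows "mixed_sum \<theta> x chi = (\<Sum>n\<in>{1..<r}. twist \<theta> x n * chi n)"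
proof -
  have "mixed_sum \<theta> x chi = (\<Sum>n\<in>{1..nat \<lfloor>x\<rfloor>} \<union> {1..<r}. twist \<theta> x n * chi n)"
    unfolding mixed_sum_eq[OF assms(1)]
    by (rule sum.mono_neutral_left) (use assms in \<open>auto simp: not_le le_nat_iff le_floor_iff intro!: twist_outside\<close>)
  also have "\<dots> = (\<Sum>n\<in>{1..<r}. twist \<theta> x n * chi n)"
    by (rule sum.mono_neutral_right) (use assms in \<open>auto intro!: twist_outside\<close>)
  finally show ?thesis .
qed

definition weight_energy :: "real \<Rightarrow> nat \<Rightarrow> real" where
  "weight_energy x r = (\<Sum>n<r. (w (real n / x))\<^sup>2)"

lemma weight_energy_eq:
  assumes "0 < x"
  shows "weight_energy x r = (\<Sum>n\<in>{1..<r}. (w (real n / x))\<^sup>2)"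
  unfolding weight_energy_def
  by (rule sum.mono_neutral_right) (use assms in \<open>auto simp: w_outside Suc_le_eq\<close>)

lemma sum_abs_weight_le:
  assumes "0 < x"
  shows "(\<Sum>n<r. \<bar>w (real n / x)\<bar>) \<le> A * x"
proof -
  have "(\<Sum>n<r. \<bar>w (real n / x)\<bar>) \<le> (\<Sum>n<r. if n \<in> {1..nat \<lfloor>x\<rfloor>} then A else 0)"
  proof (intro sum_mono)
    fix n
    show "\<bar>w (real n / x)\<bar> \<le> (if n \<in> {1..nat \<lfloor>x\<rfloor>} then A else 0)"
    proof (cases "0 < n \<and> real n \<le> x")
      case True
      then show ?thesis using abs_w_le[of "real n / x"] assms by (auto simp: le_nat_iff le_floor_iff)
    next
      case False
      then have "w (real n / x) = 0" using assms by (intro w_outside) auto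
      then show ?thesis using A_pos by simp
    qed
  qed
  also have "\<dots> = (\<Sum>n\<in>{..<r} \<inter> {1..nat \<lfloor>x\<rfloor>}. A)"
    by (rule sum.inter_restrict[symmetric]) simp
  also have "\<dots> \<le> (\<Sum>n\<in>{1..nat \<lfloor>x\<rfloor>}. A)" using A_pos by (intro sum_mono2) auto
  also have "\<dots> \<le> x * A" using assms A_pos by (auto intro!: mult_right_mono)
  finally show ?thesis by (simp add: mult.commute)
qed

lemma weight_energy_le:
  assumes "0 < x"
  shows "weight_energy x r \<le> A\<^sup>2 * x"
proof -
  have "weight_energy x r \<le> (\<Sum>n<r. A * \<bar>w (real n / x)\<bar>)"
    unfolding weight_energy_def
  proof (intro sum_mono)
    fix n
    have "\<bar>w (real n / x)\<bar> * \<bar>w (real n / x)\<bar> \<le> A * \<bar>w (real n / x)\<bar>"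
      by (intro mult_right_mono abs_w_le) auto
    then show "(w (real n / x))\<^sup>2 \<le> A * \<bar>w (real n / x)\<bar>" by (simp add: power2_eq_square)
  qed
  also have "\<dots> \<le> A * (A * x)"
    unfolding sum_distrib_left[symmetric] using A_pos assms by (intro mult_left_mono sum_abs_weight_le) auto
  finally show ?thesis by (simp add: power2_eq_square mult_ac)
qed

lemma mixed_sum_second_moment:
  assumes "prime r" "0 < x" "x \<le> real r"
  shows "(\<Sum>chi\<in>dirichlet_characters r. (cmod (mixed_sum \<theta> x chi))\<^sup>2) = (real r - 1) * weight_energy x r"
proof -
  have "complex_of_real (\<Sum>chi\<in>dirichlet_characters r. (cmod (mixed_sum \<theta> x chi))\<^sup>2) =
    (\<Sum>chi\<in>dirichlet_characters r. (\<Sum>n\<in>{1..<r}. twist \<theta> x n * chi n) * cnj (\<Sum>n\<in>{1..<r}. twist \<theta> x n * chi n))"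
    unfolding of_real_sum complex_norm_square mixed_sum_eq_residues[OF assms(2,3)] ..
  also have "\<dots> = complex_of_real ((real r - 1) * (\<Sum>n\<in>{1..<r}. (cmod (twist \<theta> x n))\<^sup>2))"
    by (rule character_linear_moment) (use assms(1) in \<open>auto simp: cong_def coprime_residue\<close>)
  finally show ?thesis
    unfolding of_real_eq_iff by (simp add: cmod_twist weight_energy_eq[OF assms(2)])
qed

text \<open>
  The fibre of the fraction \<open>a/b\<close>: a sum over the common factor \<open>g\<close>, with phase \<open>g (a-b) \<theta>\<close> and the
  slowly varying amplitude \<open>w (g a/x) w (g b/x)\<close>. The first entry of the minimum is the trivial bound,
  the second comes from partial summation.
\<close>

lemma mixed_sum_fibre_bound:
  fixes a b G :: nat
  assumes x: "1 \<le> x" and ab: "1 \<le> a" "1 \<le> b" and G: "real G * real (max a b) \<le> x"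
    and t: "0 < nint_dist (real_of_int (int a - int b) * \<theta>)"
  shows "cmod (\<Sum>g\<in>{1..G}. twist \<theta> x (g * a) * cnj (twist \<theta> x (g * b))) \<le>
    (A\<^sup>2 + 2 * A * K) * x * min (1 / real (max a b)) (1 / (x * nint_dist (real_of_int (int a - int b) * \<theta>)))"
proof -
  define t where "t = real_of_int (int a - int b) * \<theta>"
  define M where "M = real (max a b)"
  define f where "f g = w (real (g * a) / x) * w (real (g * b) / x)" for g :: nat
  define S where "S = (\<Sum>g\<in>{1..G}. twist \<theta> x (g * a) * cnj (twist \<theta> x (g * b)))"
  have M: "1 \<le> M" "real a \<le> M" "real b \<le> M" using ab by (auto simp: M_def)
  have tp: "0 < nint_dist t" using t by (simp add: t_def)
  have tw: "twist \<theta> x (g * a) * cnj (twist \<theta> x (g * b)) = of_real (f g) * e (real g * t)" for g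
  proof -
    have "twist \<theta> x (g * a) * cnj (twist \<theta> x (g * b)) = of_real (f g) * (e (real (g * a) * \<theta>) * e (- (real (g * b) * \<theta>)))"
      by (simp add: twist_def f_def cnj_e)
    also have "e (real (g * a) * \<theta>) * e (- (real (g * b) * \<theta>)) = e (real g * t)"
      unfolding e_add[symmetric] t_def by (simp add: algebra_simps)
    finally show ?thesis .
  qed
  have f_le: "\<bar>f g\<bar> \<le> A\<^sup>2" for g
    unfolding f_def abs_mult power2_eq_square using A_pos by (intro mult_mono abs_w_le) auto
  have f0: "f 0 = 0" by (simp add: f_def w_outside)
  have S_eq: "S = (\<Sum>g\<le>G. of_real (f g) * e (real g * t))"
    unfolding S_def tw by (rule sum.mono_neutral_left) (auto simp: f0 Suc_le_eq)
  have S_le1: "cmod S \<le> real G * A\<^sup>2"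
  proof -
    have "cmod S \<le> (\<Sum>g\<in>{1..G}. A\<^sup>2)"
      unfolding S_def tw by (rule sum_norm_le) (simp add: norm_mult f_le)
    then show ?thesis by simp
  qed
  have f_diff: "\<bar>f (Suc g) - f g\<bar> \<le> 2 * A * K * M / x" for g
  proof -
    have "f (Suc g) - f g = (w (real (Suc g * a) / x) - w (real (g * a) / x)) * w (real (Suc g * b) / x)
        + w (real (g * a) / x) * (w (real (Suc g * b) / x) - w (real (g * b) / x))"
      by (simp add: f_def algebra_simps)
    also have "\<bar>\<dots>\<bar> \<le> \<bar>w (real (Suc g * a) / x) - w (real (g * a) / x)\<bar> * \<bar>w (real (Suc g * b) / x)\<bar>
        + \<bar>w (real (g * a) / x)\<bar> * \<bar>w (real (Suc g * b) / x) - w (real (g * b) / x)\<bar>"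
      by (metis abs_mult abs_triangle_ineq)
    also have "\<dots> \<le> (K * (M / x)) * A + A * (K * (M / x))"
    proof -
      have *: "\<bar>w (real (Suc g * m) / x) - w (real (g * m) / x)\<bar> \<le> K * (M / x)" if "real m \<le> M" for m
      proof -
        have "\<bar>w (real (Suc g * m) / x) - w (real (g * m) / x)\<bar> \<le> K * \<bar>real (Suc g * m) / x - real (g * m) / x\<bar>"
          by (rule w_lipschitz)
        also have "real (Suc g * m) / x - real (g * m) / x = real m / x"
          by (simp add: diff_divide_distrib[symmetric] algebra_simps)
        also have "K * \<bar>real m / x\<bar> \<le> K * (M / x)"
          using that x K_pos by (intro mult_left_mono) (auto intro: divide_right_mono)
        finally show ?thesis .
      qed
      show ?thesis
        using *[OF M(2)] *[OF M(3)] A_pos K_pos M x by (intro add_mono mult_mono abs_w_le) auto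
    qed
    finally show ?thesis by (simp add: algebra_simps)
  qed
  have "cmod ((1 - e t) * S) \<le> A\<^sup>2 + 2 * A * K"
  proof -
    have "(1 - e t) * S = (\<Sum>g<G. (f (Suc g) - f g) * e (real (Suc g) * t)) - f G * e (real (Suc G) * t)"
      unfolding S_eq abel_summation_e by (simp add: f0)
    also have "cmod \<dots> \<le> cmod (\<Sum>g<G. (f (Suc g) - f g) * e (real (Suc g) * t)) + cmod (f G * e (real (Suc G) * t))"
      by (rule norm_triangle_ineq4)
    also have "\<dots> \<le> (\<Sum>g<G. 2 * A * K * M / x) + A\<^sup>2"
    proof (rule add_mono)
      show "cmod (\<Sum>g<G. (f (Suc g) - f g) * e (real (Suc g) * t)) \<le> (\<Sum>g<G. 2 * A * K * M / x)"
      proof (rule sum_norm_le)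
        fix g
        show "cmod ((f (Suc g) - f g) * e (real (Suc g) * t)) \<le> 2 * A * K * M / x"
          using f_diff[of g] by (simp add: norm_mult flip: of_real_diff)
      qed
    qed (simp add: norm_mult f_le)
    also have "(\<Sum>g<G. 2 * A * K * M / x) = 2 * A * K * ((real G * M) / x)" by simp
    also have "\<dots> \<le> 2 * A * K * 1"
      using A_pos K_pos G x by (intro mult_left_mono) (auto simp: M_def)
    finally show ?thesis by simp
  qed
  moreover have "4 * nint_dist t * cmod S \<le> cmod ((1 - e t) * S)"
    unfolding norm_mult by (intro mult_right_mono nint_dist_le_cmod) auto
  moreover have "nint_dist t * cmod S \<le> 4 * nint_dist t * cmod S" by (simp add: mult_nonneg_nonneg)
  ultimately have "nint_dist t * cmod S \<le> A\<^sup>2 + 2 * A * K" by linarith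
  then have le2: "cmod S \<le> (A\<^sup>2 + 2 * A * K) * x * (1 / (x * nint_dist t))"
  proof -
    have "cmod S \<le> (A\<^sup>2 + 2 * A * K) / nint_dist t"
      using \<open>nint_dist t * cmod S \<le> A\<^sup>2 + 2 * A * K\<close> tp by (simp add: pos_le_divide_eq mult.commute)
    then show ?thesis using x by simp
  qed
  have "real G \<le> x / M" using G M by (simp add: field_simps M_def)
  then have "cmod S \<le> x / M * A\<^sup>2"
    using S_le1 by (meson mult_right_mono order_trans zero_le_power2)
  also have "\<dots> \<le> (A\<^sup>2 + 2 * A * K) * x * (1 / M)"
    using A_pos K_pos x M by (simp add: field_simps)
  finally have le1: "cmod S \<le> (A\<^sup>2 + 2 * A * K) * x * (1 / M)" .
  show ?thesis using le1 le2 unfolding S_def t_def M_def by (simp add: min_def)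
qed

text \<open>
  Products of two indices stay below \<open>r\<close>, so that congruent products are equal and the fourth moment
  splits over reduced fractions. The fraction \<open>1/1\<close> is estimated trivially; all others have \<open>a \<noteq> b\<close>.
\<close>

lemma mixed_sum_fourth_moment_small:
  assumes r: "prime r" and x: "1 \<le> x" "x\<^sup>2 \<le> real r" and \<theta>: "\<theta> \<notin> \<rat>" and B: "bounded_pair_sums \<theta> B"
  shows "(\<Sum>chi\<in>dirichlet_characters r. (cmod (mixed_sum \<theta> x chi)) ^ 4) \<le>
    (real r - 1) * ((A ^ 4 + (A\<^sup>2 + 2 * A * K)\<^sup>2 * B) * x\<^sup>2)"
proof -
  let ?D = "dirichlet_characters r"
  define N where "N = nat \<lfloor>x\<rfloor>"
  define X where "X = {1..N} \<times> {1..N}"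
  define c where "c p = twist \<theta> x (fst p) * cnj (twist \<theta> x (snd p))" for p
  define k where "k p = (fst p div gcd (fst p) (snd p), snd p div gcd (fst p) (snd p))" for p :: "nat \<times> nat"
  have N: "real N \<le> x" "1 \<le> N" using x(1) by (auto simp: N_def le_nat_iff)
  have r1: "1 < r" using r by (rule prime_gt_1_nat)
  have finX: "finite X" by (simp add: X_def)
  have prod_le: "m * n \<le> r" if "m \<in> {1..N}" "n \<in> {1..N}" for m n
  proof -
    have "real m \<le> x" "real n \<le> x" using that N(1) by auto
    then have "real m * real n \<le> x * x" using x(1) by (intro mult_mono) auto
    then have "real (m * n) \<le> real r" using x(2) by (simp add: power2_eq_square)
    then show ?thesis by (simp only: of_nat_le_iff)
  qed
  have cop: "coprime m r" if "m \<in> {1..N}" for m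
  proof -
    have "m < r"
    proof (rule ccontr)
      assume "\<not> m < r"
      then have "m * m \<le> m" using prod_le[OF that that] by linarith
      then have "m = 1" using that by auto
      then show False using \<open>\<not> m < r\<close> r1 by simp
    qed
    then show ?thesis using that r by (intro coprime_residue) auto
  qed
  have prod_less: "m * n < r" if "m \<in> {1..N}" "n \<in> {1..N}" for m n
  proof -
    have "coprime (m * n) r" using cop that by simp
    then have "m * n \<noteq> r" using r1 by auto
    then show ?thesis using prod_le[OF that] by simp
  qed
  have k_eq: "[fst p * snd q = fst q * snd p] (mod r) \<longleftrightarrow> k p = k q" if "p \<in> X" "q \<in> X" for p q
  proof -
    obtain m n m' n' where pq: "p = (m, n)" "q = (m', n')" by (metis prod.exhaust)
    have pos: "m > 0" "n > 0" "m' > 0" "n' > 0" using that pq by (auto simp: X_def)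
    have "[m * n' = m' * n] (mod r) \<longleftrightarrow> m * n' = m' * n"
      using prod_less that pq by (auto simp: X_def cong_def)
    also have "\<dots> \<longleftrightarrow> k p = k q"
    proof
      define g g' where "g = gcd m n" and "g' = gcd m' n'"
      obtain a b where ab: "m = g * a" "n = g * b" "coprime a b"
        using gcd_coprime_exists[of m n] pos unfolding g_def by (auto simp: mult.commute)
      obtain a' b' where ab': "m' = g' * a'" "n' = g' * b'" "coprime a' b'"
        using gcd_coprime_exists[of m' n'] pos unfolding g'_def by (auto simp: mult.commute)
      have g: "g > 0" "g' > 0" using pos by (auto simp: g_def g'_def)
      have kp: "k p = (a, b)" "k q = (a', b')"
        using g ab(1,2) ab'(1,2) unfolding pq k_def fst_conv snd_conv g_def[symmetric] g'_def[symmetric] by auto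
      {
        assume "m * n' = m' * n"
        then have "(g * g') * (a * b') = (g * g') * (a' * b)" by (simp add: ab(1,2) ab'(1,2) mult_ac)
        then have "a * b' = a' * b" using g by simp
        then have "a = a' \<and> b = b'"
          using ab(3) ab'(3) coprime_crossproduct_nat[of a b a' b'] by (auto simp: coprime_commute)
        then show "k p = k q" by (simp add: kp)
      }
      {
        assume "k p = k q"
        then show "m * n' = m' * n" by (simp add: kp ab(1,2) ab'(1,2))
      }
    qed
    finally show ?thesis by (simp add: pq)
  qed
  have "(\<Sum>chi\<in>?D. (cmod (mixed_sum \<theta> x chi)) ^ 4) =
      (\<Sum>chi\<in>?D. (cmod (\<Sum>p\<in>X. c p * (chi (fst p) * cnj (chi (snd p)))))\<^sup>2)"
  proof (intro sum.cong refl)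
    fix chi
    have "(\<Sum>p\<in>X. c p * (chi (fst p) * cnj (chi (snd p)))) = mixed_sum \<theta> x chi * cnj (mixed_sum \<theta> x chi)"
      using x(1) by (simp add: mixed_sum_eq N_def[symmetric] X_def c_def sum_product sum.cartesian_product
          case_prod_unfold mult_ac)
    then show "(cmod (mixed_sum \<theta> x chi)) ^ 4 = (cmod (\<Sum>p\<in>X. c p * (chi (fst p) * cnj (chi (snd p)))))\<^sup>2"
      by (simp add: norm_mult power4_eq_xxxx power2_eq_square)
  qed
  moreover have "coprime (fst p) r \<and> coprime (snd p) r" if "p \<in> X" for p
    using that cop by (auto simp: X_def)
  note character_second_moment[OF r finX this]
  ultimately have "complex_of_real (\<Sum>chi\<in>?D. (cmod (mixed_sum \<theta> x chi)) ^ 4) =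
      (of_nat r - 1) * (\<Sum>p\<in>X. \<Sum>q\<in>X. if [fst p * snd q = fst q * snd p] (mod r) then c p * cnj (c q) else 0)"
    by (simp only:)
  also have "(\<Sum>p\<in>X. \<Sum>q\<in>X. if [fst p * snd q = fst q * snd p] (mod r) then c p * cnj (c q) else 0) =
      (\<Sum>p\<in>X. \<Sum>q\<in>X. if k p = k q then c p * cnj (c q) else 0)"
    by (intro sum.cong refl) (simp add: k_eq)
  also have "\<dots> = of_real (\<Sum>v\<in>k ` X. (cmod (\<Sum>p\<in>{p\<in>X. k p = v}. c p))\<^sup>2)"
    by (rule double_sum_over_fibres[OF finX])
  finally have "complex_of_real (\<Sum>chi\<in>?D. (cmod (mixed_sum \<theta> x chi)) ^ 4) =
      complex_of_real ((real r - 1) * (\<Sum>v\<in>k ` X. (cmod (\<Sum>p\<in>{p\<in>X. k p = v}. c p))\<^sup>2))"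
    by simp
  then have moment: "(\<Sum>chi\<in>?D. (cmod (mixed_sum \<theta> x chi)) ^ 4) =
      (real r - 1) * (\<Sum>v\<in>k ` X. (cmod (\<Sum>p\<in>{p\<in>X. k p = v}. c p))\<^sup>2)"
    by (simp only: of_real_eq_iff)
  have kX: "1 \<le> a \<and> 1 \<le> b \<and> a \<le> N \<and> b \<le> N \<and> coprime a b" if ab: "(a, b) \<in> k ` X" for a b
  proof -
    obtain m n where mn: "m \<in> {1..N}" "n \<in> {1..N}" "a = m div gcd m n" "b = n div gcd m n"
      using ab by (auto simp: X_def k_def)
    have "m div gcd m n \<noteq> 0" "n div gcd m n \<noteq> 0"
      using mn(1,2) by (auto simp: dvd_div_eq_0_iff)
    moreover have "coprime (m div gcd m n) (n div gcd m n)"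
      using mn(1) by (intro div_gcd_coprime) auto
    moreover have "m div gcd m n \<le> N" "n div gcd m n \<le> N"
      using mn(1,2) by (meson atLeastAtMost_iff div_le_dividend le_trans)+
    ultimately show ?thesis using mn by simp
  qed
  have fibre: "{p\<in>X. k p = (a, b)} = (\<lambda>g. (g * a, g * b)) ` {1..N div max a b}"
    if ab: "(a, b) \<in> k ` X" for a b
  proof (intro equalityI subsetI)
    note ab' = kX[OF ab]
    have mx: "0 < max a b" using ab' by linarith
    fix p assume "p \<in> {p\<in>X. k p = (a, b)}"
    then obtain m n where mn: "p = (m, n)" "m \<in> {1..N}" "n \<in> {1..N}" "a = m div gcd m n" "b = n div gcd m n"
      by (auto simp: X_def k_def)
    define g where "g = gcd m n"
    have "m = g * a" "n = g * b" by (simp_all add: mn(4,5) g_def)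
    moreover have "g \<in> {1..N div max a b}"
    proof -
      have "g * max a b \<le> N" using mn(2,3) \<open>m = g * a\<close> \<open>n = g * b\<close> by (simp add: max_def)
      moreover have "g \<noteq> 0" using mn(2) \<open>m = g * a\<close> by auto
      ultimately show ?thesis by (simp add: less_eq_div_iff_mult_less_eq[OF mx])
    qed
    ultimately show "p \<in> (\<lambda>g. (g * a, g * b)) ` {1..N div max a b}" using mn(1) by blast
  next
    note ab' = kX[OF ab]
    have mx: "0 < max a b" using ab' by linarith
    fix p assume "p \<in> (\<lambda>g. (g * a, g * b)) ` {1..N div max a b}"
    then obtain g where g0: "p = (g * a, g * b)" "g \<in> {1..N div max a b}" by (rule imageE)
    then have g: "p = (g * a, g * b)" "1 \<le> g" "g \<le> N div max a b" by simp_all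
    have "g * max a b \<le> N" using g(3) by (simp add: less_eq_div_iff_mult_less_eq[OF mx])
    then have "g * a \<le> N" "g * b \<le> N" by (meson le_trans max.cobounded1 max.cobounded2 mult_le_mono2)+
    moreover have "gcd (g * a) (g * b) = g" using ab' by (simp add: gcd_mult_distrib_nat[symmetric])
    ultimately show "p \<in> {p\<in>X. k p = (a, b)}" using g ab' by (auto simp: X_def k_def)
  qed
  have fibre_sum: "(\<Sum>p\<in>{p\<in>X. k p = (a, b)}. c p) =
      (\<Sum>g\<in>{1..N div max a b}. twist \<theta> x (g * a) * cnj (twist \<theta> x (g * b)))"
    if ab: "(a, b) \<in> k ` X" for a b
    unfolding fibre[OF ab] using kX[OF ab] by (subst sum.reindex) (auto simp: inj_on_def c_def)
  have Gle: "real (N div max a b) * real (max a b) \<le> x" for a b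
  proof -
    have "real (N div max a b * max a b) \<le> real N" by (simp only: of_nat_le_iff div_times_less_eq_dividend)
    then show ?thesis using N(1) by simp
  qed
  define D where "D = A\<^sup>2 + 2 * A * K"
  have D0: "0 \<le> D" using A_pos K_pos by (simp add: D_def)
  define P where "P = {(a, b)\<in>k ` X. a \<noteq> b}"
  have finP: "finite P" unfolding P_def by (rule finite_subset[OF _ finite_imageI[OF finX, of k]]) auto
  have diag: "(cmod (\<Sum>p\<in>{p\<in>X. k p = (1, 1)}. c p))\<^sup>2 \<le> A ^ 4 * x\<^sup>2" if "(1, 1) \<in> k ` X"
  proof -
    have "cmod (\<Sum>p\<in>{p\<in>X. k p = (1, 1)}. c p) \<le> (\<Sum>g\<in>{1..N div max 1 1}. A\<^sup>2)"
      unfolding fibre_sum[OF that]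
      by (rule sum_norm_le) (auto simp: norm_mult cmod_twist power2_eq_square less_imp_le[OF A_pos] simp del: abs_mult_self_eq intro!: mult_mono abs_w_le)
    also have "\<dots> \<le> x * A\<^sup>2" using N by (auto intro: mult_right_mono)
    finally have "(cmod (\<Sum>p\<in>{p\<in>X. k p = (1, 1)}. c p))\<^sup>2 \<le> (x * A\<^sup>2)\<^sup>2" by (intro power_mono) auto
    then show ?thesis by (simp add: power_mult_distrib mult.commute flip: power_mult)
  qed
  have off: "(cmod (\<Sum>p\<in>{p\<in>X. k p = (a, b)}. c p))\<^sup>2 \<le>
      (D * x)\<^sup>2 * (min (1 / real (max a b)) (1 / (x * nint_dist (real_of_int (int a - int b) * \<theta>))))\<^sup>2"
    if "(a, b) \<in> P" for a b
  proof -
    have ab: "(a, b) \<in> k ` X" "a \<noteq> b" using that by (auto simp: P_def)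
    have "real_of_int (int a - int b) * \<theta> \<notin> \<int>"
    proof
      assume "real_of_int (int a - int b) * \<theta> \<in> \<int>"
      then have "real_of_int (int a - int b) * \<theta> / real_of_int (int a - int b) \<in> \<rat>"
        using Ints_subset_Rats by (intro Rats_divide) auto
      then show False using \<theta> ab(2) by simp
    qed
    then have "0 < nint_dist (real_of_int (int a - int b) * \<theta>)" by (rule nint_dist_pos)
    from mixed_sum_fibre_bound[OF x(1) _ _ Gle this] kX[OF ab(1)]
    have "cmod (\<Sum>p\<in>{p\<in>X. k p = (a, b)}. c p) \<le>
      (D * x) * min (1 / real (max a b)) (1 / (x * nint_dist (real_of_int (int a - int b) * \<theta>)))"
      unfolding fibre_sum[OF ab(1)] D_def by blast
    then show ?thesis unfolding power_mult_distrib[symmetric] by (intro power_mono) auto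
  qed
  have "(\<Sum>v\<in>k ` X. (cmod (\<Sum>p\<in>{p\<in>X. k p = v}. c p))\<^sup>2) \<le> A ^ 4 * x\<^sup>2 + (D * x)\<^sup>2 * B"
  proof -
    have "(1, 1) \<in> k ` X" using N(2) by (auto simp: X_def k_def intro!: image_eqI[of _ _ "(1, 1)"])
    have "k ` X = insert (1, 1) P"
    proof
      show "k ` X \<subseteq> insert (1, 1) P"
      proof
        fix v assume v: "v \<in> k ` X"
        obtain a b where ab: "v = (a, b)" by (metis prod.exhaust)
        show "v \<in> insert (1, 1) P"
          using kX[OF v[unfolded ab]] v unfolding ab by (cases "a = b") (auto simp: P_def)
      qed
    qed (use \<open>(1, 1) \<in> k ` X\<close> in \<open>auto simp: P_def\<close>)
    moreover have "(1, 1) \<notin> P" by (simp add: P_def)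
    ultimately have "(\<Sum>v\<in>k ` X. (cmod (\<Sum>p\<in>{p\<in>X. k p = v}. c p))\<^sup>2) =
        (cmod (\<Sum>p\<in>{p\<in>X. k p = (1, 1)}. c p))\<^sup>2 + (\<Sum>v\<in>P. (cmod (\<Sum>p\<in>{p\<in>X. k p = v}. c p))\<^sup>2)"
      using finP by simp
    also have "(\<Sum>v\<in>P. (cmod (\<Sum>p\<in>{p\<in>X. k p = v}. c p))\<^sup>2) \<le>
        (\<Sum>(a, b)\<in>P. (D * x)\<^sup>2 * (min (1 / real (max a b)) (1 / (x * nint_dist (real_of_int (int a - int b) * \<theta>))))\<^sup>2)"
      using off by (intro sum_mono) auto
    also have "\<dots> = (D * x)\<^sup>2 * (\<Sum>(a, b)\<in>P. (min (1 / real (max a b)) (1 / (x * nint_dist (real_of_int (int a - int b) * \<theta>))))\<^sup>2)"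
      by (simp add: sum_distrib_left case_prod_unfold)
    also have "(\<Sum>(a, b)\<in>P. (min (1 / real (max a b)) (1 / (x * nint_dist (real_of_int (int a - int b) * \<theta>))))\<^sup>2) =
        (\<Sum>(a, b)\<in>map_prod int int ` P. (min (1 / of_int (max \<bar>a\<bar> \<bar>b\<bar>)) (1 / (x * nint_dist (of_int (a - b) * \<theta>))))\<^sup>2)"
      by (subst sum.reindex) (auto simp: inj_on_def case_prod_unfold of_nat_max of_int_max intro!: sum.cong)
    also have "\<dots> \<le> B"
    proof -
      have "\<forall>(a, b)\<in>map_prod int int ` P. a \<noteq> b \<and> real_of_int (max \<bar>a\<bar> \<bar>b\<bar>) \<le> x"
        using kX N(1) unfolding P_def by fastforce
      then show ?thesis using B x(1) finP unfolding bounded_pair_sums_def by blast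
    qed
    finally show ?thesis using diag \<open>(1, 1) \<in> k ` X\<close> by (simp add: mult_left_mono)
  qed
  also have "\<dots> = (A ^ 4 + D\<^sup>2 * B) * x\<^sup>2" by (simp add: algebra_simps power_mult_distrib)
  finally show ?thesis unfolding moment D_def[symmetric] using r1 by (intro mult_left_mono) auto
qed

section \<open>The dual sum\<close>

definition fourier :: "real \<Rightarrow> real \<Rightarrow> nat \<Rightarrow> nat \<Rightarrow> complex" where
  "fourier \<theta> x r h = (\<Sum>n<r. twist \<theta> x n * e (real (h * n) / real r))"

lemma fourier_eq:
  "fourier \<theta> x r h = (\<Sum>n<r. of_real (w (real n / x)) * e (real n * (\<theta> + real h / real r)))"
  unfolding fourier_def twist_def
proof (rule sum.cong[OF refl])
  fix n
  have "e (real n * (\<theta> + real h / real r)) = e (real n * \<theta>) * e (real (h * n) / real r)"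
    unfolding e_add[symmetric] by (simp add: algebra_simps)
  then show "e (real n * \<theta>) * of_real (w (real n / x)) * e (real (h * n) / real r) =
      of_real (w (real n / x)) * e (real n * (\<theta> + real h / real r))" by simp
qed

lemma sum_fourier_squared:
  assumes "0 < r"
  shows "(\<Sum>h<r. (cmod (fourier \<theta> x r h))\<^sup>2) = real r * weight_energy x r"
  unfolding fourier_def plancherel_mod[OF assms] weight_energy_def by (simp add: cmod_twist)

lemma cmod_fourier_le:
  assumes "0 < x"
  shows "cmod (fourier \<theta> x r h) \<le> A * x"
proof -
  have "cmod (fourier \<theta> x r h) \<le> (\<Sum>n<r. \<bar>w (real n / x)\<bar>)"
    unfolding fourier_def by (rule sum_norm_le) (simp add: norm_mult cmod_twist)
  also have "\<dots> \<le> A * x" by (rule sum_abs_weight_le[OF assms])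
  finally show ?thesis .
qed

lemma sum_fourier:
  assumes "0 < r"
  shows "(\<Sum>h<r. fourier \<theta> x r h) = 0"
proof -
  have "(\<Sum>h<r. fourier \<theta> x r h) = (\<Sum>n<r. twist \<theta> x n * (\<Sum>h<r. e (real (h * n) / real r) * cnj (e (real (h * 0) / real r))))"
    unfolding fourier_def by (subst sum.swap) (simp add: sum_distrib_left)
  also have "\<dots> = (\<Sum>n<r. if n = 0 then twist \<theta> x 0 * of_nat r else 0)"
  proof (rule sum.cong[OF refl])
    fix n assume "n \<in> {..<r}"
    then show "twist \<theta> x n * (\<Sum>h<r. e (real (h * n) / real r) * cnj (e (real (h * 0) / real r))) =
        (if n = 0 then twist \<theta> x 0 * of_nat r else 0)"
      using sum_additive_characters[of n r 0] assms by (simp only: lessThan_iff) auto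
  qed
  also have "\<dots> = 0" by (simp add: twist_def w_outside)
  finally show ?thesis .
qed

text \<open>
  The coefficients of \<open>1 - e (\<theta> + h/r)\<close> times the transform. The one at \<open>0\<close> carries the boundary term
  of the partial summation, wrapped around modulo \<open>r\<close>.
\<close>

definition difference_coefficient :: "real \<Rightarrow> real \<Rightarrow> nat \<Rightarrow> nat \<Rightarrow> complex" where
  "difference_coefficient \<theta> x r n =
    (if n = 0 then - (of_real (w (real (r - 1) / x)) * e (real r * \<theta>))
     else of_real (w (real n / x) - w (real (n - 1) / x)) * e (real n * \<theta>))"

lemma fourier_difference:
  assumes "0 < r"
  shows "(1 - e (\<theta> + real h / real r)) * fourier \<theta> x r h =
    (\<Sum>n<r. difference_coefficient \<theta> x r n * e (real (h * n) / real r))"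
proof -
  obtain K where K: "r = Suc K" using assms gr0_implies_Suc by blast
  define t where "t = \<theta> + real h / real r"
  have split: "e (real n * t) = e (real n * \<theta>) * e (real (h * n) / real r)" for n
    unfolding e_add[symmetric] t_def by (simp add: algebra_simps)
  have top: "e (real r * t) = e (real r * \<theta>)"
    unfolding split using assms by simp
  have F: "fourier \<theta> x r h = (\<Sum>n\<le>K. of_real (w (real n / x)) * e (real n * t))"
    unfolding fourier_eq t_def K lessThan_Suc_atMost ..
  have "(1 - e t) * fourier \<theta> x r h =
      of_real (w (real 0 / x)) + (\<Sum>n<K. of_real (w (real (Suc n) / x) - w (real n / x)) * e (real (Suc n) * t))
      - of_real (w (real K / x)) * e (real (Suc K) * t)"
    using abel_summation_e[of t "\<lambda>n. w (real n / x)" K] unfolding F by simp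
  also have "\<dots> = difference_coefficient \<theta> x r 0 +
      (\<Sum>n<K. difference_coefficient \<theta> x r (Suc n) * e (real (h * Suc n) / real r))"
    unfolding K[symmetric] top split[of "Suc _"] by (simp add: difference_coefficient_def w_outside K mult.assoc)
  also have "\<dots> = (\<Sum>n<r. difference_coefficient \<theta> x r n * e (real (h * n) / real r))"
    unfolding K sum.lessThan_Suc_shift by simp
  finally show ?thesis by (simp add: t_def)
qed

lemma difference_coefficient_le:
  assumes "1 \<le> x" "x \<le> real r"
  shows "cmod (difference_coefficient \<theta> x r n) \<le> (if n \<in> {..Suc (nat \<lfloor>x\<rfloor>)} then K / x else 0)"
proof -
  have lip: "\<bar>w (real (Suc m) / x) - w (real m / x)\<bar> \<le> K / x" for m
  proof -
    have "\<bar>w (real (Suc m) / x) - w (real m / x)\<bar> \<le> K * \<bar>real (Suc m) / x - real m / x\<bar>" by (rule w_lipschitz)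
    also have "real (Suc m) / x - real m / x = 1 / x" by (simp add: diff_divide_distrib[symmetric])
    finally show ?thesis using assms by simp
  qed
  have r: "r = Suc (r - 1)" using assms by (cases r) auto
  show ?thesis
  proof (cases n)
    case 0
    have "w (real r / x) = 0" using assms by (intro w_outside) auto
    then have "\<bar>w (real (r - 1) / x)\<bar> \<le> K / x" using lip[of "r - 1"] r by simp
    then show ?thesis using 0 by (simp add: difference_coefficient_def norm_mult)
  next
    case (Suc m)
    show ?thesis
    proof (cases "n \<le> Suc (nat \<lfloor>x\<rfloor>)")
      case True
      then show ?thesis using Suc lip[of m]
        by (simp add: difference_coefficient_def norm_mult flip: of_real_diff)
    next
      case False
      then have "nat \<lfloor>x\<rfloor> < m" using Suc by simp
      then have "x \<le> real m" using assms by linarith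
      then have "w (real m / x) = 0" "w (real n / x) = 0" using assms Suc by (auto intro!: w_outside)
      then show ?thesis using Suc False by (simp add: difference_coefficient_def)
    qed
  qed
qed

lemma sum_difference_coefficient_le:
  assumes "1 \<le> x" "x \<le> real r" "0 < p"
  shows "(\<Sum>n<r. cmod (difference_coefficient \<theta> x r n) ^ p) \<le> 3 * x * (K / x) ^ p"
proof -
  have "(\<Sum>n<r. cmod (difference_coefficient \<theta> x r n) ^ p) \<le> (\<Sum>n<r. if n \<in> {..Suc (nat \<lfloor>x\<rfloor>)} then (K / x) ^ p else 0)"
  proof (intro sum_mono)
    fix n
    have "cmod (difference_coefficient \<theta> x r n) ^ p \<le> (if n \<in> {..Suc (nat \<lfloor>x\<rfloor>)} then K / x else 0) ^ p"
      by (intro power_mono difference_coefficient_le assms) auto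
    then show "cmod (difference_coefficient \<theta> x r n) ^ p \<le> (if n \<in> {..Suc (nat \<lfloor>x\<rfloor>)} then (K / x) ^ p else 0)"
      using assms(3) by (simp add: zero_power split: if_splits)
  qed
  also have "\<dots> = (\<Sum>n\<in>{..<r} \<inter> {..Suc (nat \<lfloor>x\<rfloor>)}. (K / x) ^ p)"
    by (rule sum.inter_restrict[symmetric]) simp
  also have "\<dots> \<le> (\<Sum>n\<in>{..Suc (nat \<lfloor>x\<rfloor>)}. (K / x) ^ p)"
    using K_pos assms(1) by (intro sum_mono2) auto
  also have "\<dots> = real (nat \<lfloor>x\<rfloor> + 2) * (K / x) ^ p" by simp
  also have "\<dots> \<le> (3 * x) * (K / x) ^ p"
  proof (rule mult_right_mono)
    show "real (nat \<lfloor>x\<rfloor> + 2) \<le> 3 * x" using assms(1) by linarith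
  qed (use K_pos assms(1) in auto)
  finally show ?thesis .
qed

text \<open>
  The frequency \<open>0\<close> must be discarded, because characters vanish there. Its coefficient is bounded
  independently of \<open>x\<close> because \<open>\<theta>\<close> is not an integer.
\<close>

lemma fourier_0_le:
  assumes "1 \<le> x" "x \<le> real r" "\<theta> \<notin> \<int>"
  shows "cmod (fourier \<theta> x r 0) \<le> K / nint_dist \<theta>"
proof -
  have r: "0 < r" using assms by (cases r) auto
  have "4 * nint_dist \<theta> * cmod (fourier \<theta> x r 0) \<le> cmod (1 - e \<theta>) * cmod (fourier \<theta> x r 0)"
    by (intro mult_right_mono nint_dist_le_cmod) auto
  also have "\<dots> = cmod (\<Sum>n<r. difference_coefficient \<theta> x r n)"
    using fourier_difference[OF r, of \<theta> 0 x] by (simp flip: norm_mult)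
  also have "\<dots> \<le> (\<Sum>n<r. cmod (difference_coefficient \<theta> x r n))" by (rule norm_sum)
  also have "\<dots> \<le> 3 * K"
    using sum_difference_coefficient_le[OF assms(1,2), of 1 \<theta>] assms(1) by simp
  also have "\<dots> \<le> 4 * K" using K_pos by simp
  finally show ?thesis using nint_dist_pos[OF assms(3)] by (simp add: pos_le_divide_eq mult.commute)
qed

text \<open>
  Plancherel for the differences: they have size \<open>O(1/x)\<close> at \<open>O(x)\<close> places, while the factor
  \<open>1 - e (\<theta> + h/r)\<close> exceeds \<open>4 L/x\<close> on the tail.
\<close>

lemma fourier_tail_le:
  assumes "1 \<le> x" "x \<le> real r" "0 < L"
  shows "(\<Sum>h\<in>{h. h < r \<and> L / x < nint_dist (\<theta> + real h / real r)}. (cmod (fourier \<theta> x r h))\<^sup>2) \<le> 3 * K\<^sup>2 / (16 * L\<^sup>2) * real r * x"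
proof -
  define T where "T = {h. h < r \<and> L / x < nint_dist (\<theta> + real h / real r)}"
  have r: "0 < r" using assms by (cases r) auto
  have "(4 * (L / x))\<^sup>2 * (\<Sum>h\<in>T. (cmod (fourier \<theta> x r h))\<^sup>2) = (\<Sum>h\<in>T. (4 * (L / x) * cmod (fourier \<theta> x r h))\<^sup>2)"
    by (simp only: sum_distrib_left power_mult_distrib)
  also have "\<dots> \<le> (\<Sum>h\<in>T. (cmod ((1 - e (\<theta> + real h / real r)) * fourier \<theta> x r h))\<^sup>2)"
  proof (intro sum_mono power_mono)
    fix h assume "h \<in> T"
    then have "4 * (L / x) \<le> cmod (1 - e (\<theta> + real h / real r))"
      using nint_dist_le_cmod[of "\<theta> + real h / real r"] by (simp add: T_def)
    then show "4 * (L / x) * cmod (fourier \<theta> x r h) \<le> cmod ((1 - e (\<theta> + real h / real r)) * fourier \<theta> x r h)"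
      unfolding norm_mult by (rule mult_right_mono) simp
  qed (use assms in auto)
  also have "\<dots> \<le> (\<Sum>h<r. (cmod ((1 - e (\<theta> + real h / real r)) * fourier \<theta> x r h))\<^sup>2)"
    by (rule sum_mono2) (auto simp: T_def)
  also have "\<dots> = real r * (\<Sum>n<r. (cmod (difference_coefficient \<theta> x r n))\<^sup>2)"
    unfolding fourier_difference[OF r] by (rule plancherel_mod[OF r])
  also have "\<dots> \<le> real r * (3 * x * (K / x)\<^sup>2)"
    by (intro mult_left_mono sum_difference_coefficient_le assms) auto
  finally have "(\<Sum>h\<in>T. (cmod (fourier \<theta> x r h))\<^sup>2) \<le> real r * (3 * x * (K / x)\<^sup>2) / (4 * (L / x))\<^sup>2"
    using assms by (simp add: pos_le_divide_eq mult.commute)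
  also have "\<dots> = 3 * K\<^sup>2 / (16 * L\<^sup>2) * real r * x" using assms by (simp add: power_divide power_mult_distrib)
  finally show ?thesis by (simp add: T_def)
qed

text \<open>
  Subtracting from \<open>h\<close> the multiple of \<open>r\<close> that is closest to \<open>h + r \<theta>\<close> moves the frequencies into a true
  interval of integers around \<open>-r \<theta>\<close>.
\<close>

lemma card_near_frequency_quadruples_le:
  fixes r :: nat
  assumes B: "bounded_pair_sums \<theta> B" and \<theta>: "\<theta> \<notin> \<rat>" and r: "prime r"
    and x: "x \<le> real r" "real r \<le> x\<^sup>2" "2 * L < x" and L: "1 \<le> L"
  defines "I \<equiv> {h\<in>{1..<r}. nint_dist (\<theta> + real h / real r) \<le> L / x}"
  shows "real (card {(p, q). p \<in> I \<times> I \<and> q \<in> I \<times> I \<and> [fst p * snd q = fst q * snd p] (mod r)}) \<le>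
    (9 + 8 * (1 + 8 * L\<^sup>2) * (2 + 16 * L ^ 4 * B)) * (L * real r / x)\<^sup>2"
proof -
  define H where "H h = int h - round (\<theta> + real h / real r) * int r" for h
  have r0: "0 < r" using r by (rule prime_gt_0_nat)
  have x0: "0 < x" using x(3) L by simp
  have finI: "finite I" by (simp add: I_def)
  have inj: "inj_on H I"
  proof (rule inj_onI)
    fix h k assume hk: "h \<in> I" "k \<in> I" "H h = H k"
    then have "int h - int k = (round (\<theta> + real h / real r) - round (\<theta> + real k / real r)) * int r"
      by (simp add: H_def algebra_simps)
    then have "[int h = int k] (mod int r)" unfolding cong_iff_dvd_diff by simp
    then show "h = k" using hk(1,2) by (auto simp: I_def cong_int_iff cong_def)
  qed
  define S where "S = {(p, q). p \<in> I \<times> I \<and> q \<in> I \<times> I \<and> [fst p * snd q = fst q * snd p] (mod r)}"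
  define f where "f = map_prod (map_prod H H) (map_prod H H)"
  have "inj_on f S"
    using inj unfolding f_def S_def inj_on_def by auto
  moreover have "f ` S \<subseteq> ratio_quadruples (int r) (H ` I)"
  proof (rule image_subsetI)
    fix z assume "z \<in> S"
    then obtain h k h' k' where z: "z = ((h, k), (h', k'))" "h \<in> I" "k \<in> I" "h' \<in> I" "k' \<in> I" "[h * k' = h' * k] (mod r)"
      unfolding S_def by auto
    have Hc: "[H h = int h] (mod int r)" for h
      unfolding H_def cong_iff_dvd_diff by simp
    have "[H h * H k' = int h * int k'] (mod int r)" by (intro cong_mult Hc)
    also have "[int h * int k' = int h' * int k] (mod int r)"
      using z(6) by (simp flip: of_nat_mult add: cong_int_iff)
    also have "[int h' * int k = H h' * H k] (mod int r)" by (intro cong_mult Hc[THEN cong_sym])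
    finally have "int r dvd H h * H k' - H h' * H k" by (simp add: cong_iff_dvd_diff)
    then show "f z \<in> ratio_quadruples (int r) (H ` I)" using z by (simp add: f_def ratio_quadruples_def)
  qed
  moreover have "finite (ratio_quadruples (int r) (H ` I))"
    unfolding ratio_quadruples_def
    by (rule finite_subset[of _ "(H ` I \<times> H ` I) \<times> (H ` I \<times> H ` I)"]) (use finI in auto)
  ultimately have "card S \<le> card (ratio_quadruples (int r) (H ` I))" by (rule card_inj_on_le)
  moreover have "real (card (ratio_quadruples (int r) (H ` I))) \<le>
      (9 + 8 * (1 + 8 * L\<^sup>2) * (2 + 16 * L ^ 4 * B)) * (L * real r / x)\<^sup>2"
  proof (rule card_ratio_quadruples_le[OF B \<theta>])
    show "prime (int r)" using r by simp
    show "\<bar>of_int s + of_int (int r) * \<theta>\<bar> \<le> L * real r / x" if "s \<in> H ` I" for s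
    proof -
      obtain h where h: "s = H h" "h \<in> I" using \<open>s \<in> H ` I\<close> by blast
      have "of_int s + of_int (int r) * \<theta> = real r * ((\<theta> + real h / real r) - of_int (round (\<theta> + real h / real r)))"
        using r0 by (simp add: h(1) H_def field_simps)
      then have "\<bar>of_int s + of_int (int r) * \<theta>\<bar> = real r * nint_dist (\<theta> + real h / real r)"
        by (simp add: abs_mult nint_dist_eq_round)
      also have "\<dots> \<le> real r * (L / x)" using h(2) by (intro mult_left_mono) (auto simp: I_def)
      finally show ?thesis by (simp add: mult.commute)
    qed
    have "1 * x \<le> L * real r" using L x(1) x0 by (intro mult_mono) auto
    then show "1 \<le> L * real r / x" using x0 by (simp add: pos_le_divide_eq)
    show "2 * (L * real r / x) < of_int (int r)" using x(3) x0 r0 by (simp add: pos_divide_less_eq)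
    have "(L * real r / x)\<^sup>2 = L\<^sup>2 * (real r * (real r / x\<^sup>2))" by (simp add: power_divide power_mult_distrib power2_eq_square)
    also have "\<dots> \<le> L\<^sup>2 * (real r * 1)" using x(2) x0 by (intro mult_left_mono) auto
    finally show "(L * real r / x)\<^sup>2 \<le> L\<^sup>2 * of_int (int r)" by simp
  qed (use L finI in auto)
  ultimately show ?thesis unfolding S_def by linarith
qed

section \<open>The first moment\<close>

text \<open>
  The Hoelder inequality with both factors equal to the absolute value of the mixed sum.
\<close>

lemma mixed_sum_first_moment_small:
  assumes r: "prime r" and x: "1 \<le> x" "x\<^sup>2 \<le> real r" "x \<le> real r" and \<theta>: "\<theta> \<notin> \<rat>" and B: "bounded_pair_sums \<theta> B"
    and c: "0 < c" "c * x \<le> weight_energy x r"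
  shows "c ^ 3 / (A ^ 4 + (A\<^sup>2 + 2 * A * K)\<^sup>2 * B) * ((real r - 1)\<^sup>2 * x) \<le>
    (\<Sum>chi\<in>dirichlet_characters r. cmod (mixed_sum \<theta> x chi))\<^sup>2"
proof -
  let ?D = "dirichlet_characters r"
  define D where "D = A ^ 4 + (A\<^sup>2 + 2 * A * K)\<^sup>2 * B"
  define E where "E = (real r - 1) * weight_energy x r"
  define s where "s = (\<Sum>chi\<in>?D. cmod (mixed_sum \<theta> x chi))"
  define R where "R = real r - 1"
  have R: "0 < R" using prime_gt_1_nat[OF r] by (simp add: R_def)
  have D: "0 < D" unfolding D_def using A_pos K_pos B by (intro add_pos_nonneg) (auto simp: bounded_pair_sums_def)
  have E2: "(\<Sum>chi\<in>?D. (cmod (mixed_sum \<theta> x chi))\<^sup>2) = E"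
    unfolding E_def using mixed_sum_second_moment[OF r _ x(3)] x(1) by simp
  have Ec: "R * (c * x) \<le> E" unfolding E_def R_def[symmetric] using c(2) R by (intro mult_left_mono) auto
  have E0: "0 < E" using Ec c(1) x(1) R by (intro less_le_trans[OF _ Ec]) auto
  have "E ^ 4 = (\<Sum>chi\<in>?D. cmod (mixed_sum \<theta> x chi) * cmod (mixed_sum \<theta> x chi)) ^ 4"
    unfolding E2[symmetric] by (simp add: power2_eq_square)
  also have "\<dots> \<le> s\<^sup>2 * (\<Sum>chi\<in>?D. (cmod (mixed_sum \<theta> x chi))\<^sup>2) * (\<Sum>chi\<in>?D. cmod (mixed_sum \<theta> x chi) ^ 4)"
    unfolding s_def by (rule sum_mult_fourth_power_le) (use prime_gt_0_nat[OF r] in \<open>auto intro: finite_dirichlet_characters\<close>)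
  also have "\<dots> \<le> s\<^sup>2 * E * (R * (D * x\<^sup>2))"
    unfolding E2 R_def D_def using E0 by (intro mult_left_mono mixed_sum_fourth_moment_small r x \<theta> B) auto
  finally have "E * E ^ 3 \<le> E * (s\<^sup>2 * (R * (D * x\<^sup>2)))" by (simp add: power_numeral_reduce mult_ac)
  then have "E ^ 3 \<le> s\<^sup>2 * (R * (D * x\<^sup>2))" using E0 by simp
  moreover have "(R * (c * x)) ^ 3 \<le> E ^ 3" using Ec R c(1) x(1) by (intro power_mono) auto
  ultimately have "(R * (c * x)) ^ 3 \<le> s\<^sup>2 * (R * (D * x\<^sup>2))" by linarith
  moreover have "(R * (c * x)) ^ 3 = (c ^ 3 / D * (R\<^sup>2 * x)) * (R * (D * x\<^sup>2))"
    using D by (simp add: field_simps power_numeral_reduce)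
  moreover have "0 < R * (D * x\<^sup>2)" using R D x(1) by simp
  ultimately have "c ^ 3 / D * (R\<^sup>2 * x) \<le> s\<^sup>2" by (simp only: mult_le_cancel_right)
  then show ?thesis by (simp add: D_def s_def R_def)
qed

text \<open>
  The Hoelder inequality for the dual sum \<open>S\<close> and its part \<open>T\<close> near the frequency \<open>-\<theta>\<close>. The principal
  character is removed from the correlation, since for it \<open>S\<close> is unrelated to the mixed sum; its
  contribution is small by \<open>fourier_0_le\<close>. The two last hypotheses express that \<open>x\<close> is large in terms of
  \<open>\<theta>\<close>.
\<close>

lemma mixed_sum_first_moment_large:
  assumes r: "prime r" and \<theta>: "\<theta> \<notin> \<rat>" and B: "bounded_pair_sums \<theta> B"
    and L: "1 \<le> L" "3 * K\<^sup>2 / (16 * L\<^sup>2) \<le> c / 4"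
    and x: "2 * L < x" "x \<le> real r" "real r \<le> x\<^sup>2"
    and c: "0 < c" "c * x \<le> weight_energy x r"
    and big: "(K / nint_dist \<theta>)\<^sup>2 \<le> c / 4 * x" "K / nint_dist \<theta> * A \<le> c / 4 * (x - 1)"
  shows "c ^ 4 / (256 * (A ^ 6 * L\<^sup>2 * (9 + 8 * (1 + 8 * L\<^sup>2) * (2 + 16 * L ^ 4 * B)))) * ((real r - 1)\<^sup>2 * x) \<le>
    (\<Sum>chi\<in>dirichlet_characters r. cmod (mixed_sum \<theta> x chi))\<^sup>2"
proof -
  let ?D = "dirichlet_characters r"
  let ?N = "?D - {principal_character r}"
  have r1: "1 < r" and r0: "0 < r" using prime_gt_1_nat[OF r] by auto
  have x1: "1 \<le> x" using L x by simp
  have finD: "finite ?D" using r0 by (rule finite_dirichlet_characters)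
  have \<theta>Z: "\<theta> \<notin> \<int>" using \<theta> Ints_subset_Rats by auto
  define R where "R = real r - 1"
  have R: "0 < R" "x - 1 \<le> R" using r1 x(2) by (auto simp: R_def)
  define f0 where "f0 = K / nint_dist \<theta>"
  have f0: "0 \<le> f0" using K_pos by (simp add: f0_def)
  define F where "F = fourier \<theta> x r"
  define I where "I = {h\<in>{1..<r}. nint_dist (\<theta> + real h / real r) \<le> L / x}"
  define S where "S chi = (\<Sum>h\<in>{1..<r}. cnj (F h) * chi h)" for chi
  define T where "T chi = (\<Sum>h\<in>I. cnj (F h) * chi h)" for chi
  define J where "J = 9 + 8 * (1 + 8 * L\<^sup>2) * (2 + 16 * L ^ 4 * B)"
  have J: "0 < J" unfolding J_def using B by (intro add_pos_nonneg) (auto simp: bounded_pair_sums_def)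
  have IX: "I \<subseteq> {1..<r}" "finite I" by (auto simp: I_def)
  have F0: "cmod (F 0) \<le> f0" unfolding F_def f0_def by (rule fourier_0_le[OF x1 x(2) \<theta>Z])

  have sum_split: "(\<Sum>h<r. g h) = g 0 + (\<Sum>h\<in>{1..<r}. g h)" for g :: "nat \<Rightarrow> 'z::comm_monoid_add"
    using r0 by (simp add: lessThan_atLeast0 sum.atLeast_Suc_lessThan)

  have nonprincipal: "cmod (S chi) = sqrt r * cmod (mixed_sum \<theta> x chi)" if chi: "chi \<in> ?N" for chi
  proof -
    have chi0: "chi 0 = 0" using dirichlet_charactersD(4)[of chi r 0] chi r1 by auto
    have "S chi = (\<Sum>h<r. chi h * cnj (\<Sum>n<r. twist \<theta> x n * e (real (h * n) / real r)))"
      unfolding S_def F_def sum_split fourier_def by (simp add: chi0 mult.commute)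
    then have "cmod (S chi) = sqrt r * cmod (\<Sum>n<r. chi n * twist \<theta> x n)"
      using nonprincipal_fourier_transform[OF r, of chi "twist \<theta> x"] chi by simp
    also have "(\<Sum>n<r. chi n * twist \<theta> x n) = mixed_sum \<theta> x chi"
      unfolding sum_split using x1 x(2) by (simp add: mixed_sum_eq_residues chi0 mult.commute)
    finally show ?thesis .
  qed

  have energy_I: "real r * (c * x) / 2 \<le> (\<Sum>h\<in>I. (cmod (F h))\<^sup>2)"
  proof -
    define Q where "Q = {h. h < r \<and> L / x < nint_dist (\<theta> + real h / real r)}"
    have "{..<r} \<subseteq> insert 0 (I \<union> Q)" by (auto simp: I_def Q_def)
    then have "(\<Sum>h<r. (cmod (F h))\<^sup>2) \<le> (\<Sum>h\<in>insert 0 (I \<union> Q). (cmod (F h))\<^sup>2)"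
      by (intro sum_mono2) (auto simp: IX Q_def)
    also have "\<dots> \<le> (cmod (F 0))\<^sup>2 + (\<Sum>h\<in>I \<union> Q. (cmod (F h))\<^sup>2)"
      by (cases "0 \<in> I \<union> Q") (auto simp: IX Q_def insert_absorb)
    also have "(\<Sum>h\<in>I \<union> Q. (cmod (F h))\<^sup>2) \<le> (\<Sum>h\<in>I. (cmod (F h))\<^sup>2) + (\<Sum>h\<in>Q. (cmod (F h))\<^sup>2)"
      by (simp add: sum_Un IX Q_def sum_nonneg)
    finally have "(\<Sum>h<r. (cmod (F h))\<^sup>2) \<le> (cmod (F 0))\<^sup>2 + (\<Sum>h\<in>I. (cmod (F h))\<^sup>2) + (\<Sum>h\<in>Q. (cmod (F h))\<^sup>2)"
      by simp
    moreover have "real r * (c * x) \<le> (\<Sum>h<r. (cmod (F h))\<^sup>2)"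
      unfolding F_def sum_fourier_squared[OF r0] using c(2) by (intro mult_left_mono) auto
    moreover have "(cmod (F 0))\<^sup>2 \<le> real r * (c * x) / 4"
    proof -
      have "(cmod (F 0))\<^sup>2 \<le> f0\<^sup>2" using F0 by (intro power_mono) auto
      also have "\<dots> \<le> 1 * (c / 4 * x)" using big(1) by (simp add: f0_def)
      also have "\<dots> \<le> real r * (c / 4 * x)" using r1 c(1) x1 by (intro mult_right_mono) auto
      finally show ?thesis by simp
    qed
    moreover have "(\<Sum>h\<in>Q. (cmod (F h))\<^sup>2) \<le> real r * (c * x) / 4"
    proof -
      have "(\<Sum>h\<in>Q. (cmod (F h))\<^sup>2) \<le> 3 * K\<^sup>2 / (16 * L\<^sup>2) * real r * x"
        unfolding Q_def F_def by (rule fourier_tail_le[OF x1 x(2)]) (use L in auto)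
      also have "\<dots> \<le> c / 4 * real r * x" using L(2) x1 by (intro mult_right_mono) auto
      finally show ?thesis by (simp add: mult_ac)
    qed
    ultimately show ?thesis by linarith
  qed

  \<comment> \<open>By orthogonality the correlation of S with its part T is the mass of F on I.\<close>
  have "(\<Sum>chi\<in>?D. S chi * cnj (T chi)) = complex_of_real (R * (\<Sum>h\<in>I. (cmod (F h))\<^sup>2))"
    unfolding S_def T_def R_def
    using character_linear_moment[OF r, of "{1..<r}" I "\<lambda>h. cnj (F h)"] IX coprime_residue[OF r]
    by (auto simp: cong_def)
  then have "R * (\<Sum>h\<in>I. (cmod (F h))\<^sup>2) = cmod (\<Sum>chi\<in>?D. S chi * cnj (T chi))"
    using R by (simp only: norm_of_real) (simp add: abs_mult sum_nonneg)
  also have "\<dots> \<le> (\<Sum>chi\<in>?D. cmod (S chi) * cmod (T chi))"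
    by (rule sum_norm_le) (simp add: norm_mult)
  also have "\<dots> = cmod (S (principal_character r)) * cmod (T (principal_character r)) + (\<Sum>chi\<in>?N. cmod (S chi) * cmod (T chi))"
    by (rule sum.remove[OF finD principal_character_in])
  also have "cmod (S (principal_character r)) * cmod (T (principal_character r)) \<le> f0 * (real r * (A * x))"
  proof (rule mult_mono)
    have "S (principal_character r) = cnj (\<Sum>h\<in>{1..<r}. F h)"
      unfolding S_def cnj_sum by (rule sum.cong) (auto simp: principal_character_def coprime_residue[OF r])
    \<comment> \<open>The values of F add up to r times the weight at 0, which vanishes.\<close>
    also have "(\<Sum>h\<in>{1..<r}. F h) = - F 0"
      using sum_fourier[OF r0, of \<theta> x] unfolding F_def[symmetric] sum_split by (simp add: eq_neg_iff_add_eq_0 add.commute)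
    finally show "cmod (S (principal_character r)) \<le> f0" using F0 by simp
    have "cmod (T (principal_character r)) \<le> (\<Sum>h\<in>I. A * x)"
      unfolding T_def
    proof (rule sum_norm_le)
      fix h
      have "cmod (cnj (F h) * principal_character r h) \<le> cmod (F h)" by (simp add: principal_character_def norm_mult)
      also have "\<dots> \<le> A * x" unfolding F_def using x1 by (intro cmod_fourier_le) auto
      finally show "cmod (cnj (F h) * principal_character r h) \<le> A * x" .
    qed
    also have "\<dots> = real (card I) * (A * x)" by simp
    also have "\<dots> \<le> real r * (A * x)"
      using card_mono[OF _ IX(1)] A_pos x1 by (intro mult_right_mono) auto
    finally show "cmod (T (principal_character r)) \<le> real r * (A * x)" .
  qed (use f0 in auto)
  also have "f0 * (real r * (A * x)) = (f0 * A) * (real r * x)" by simp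
  also have "\<dots> \<le> (c / 4 * R) * (real r * x)"
  proof (rule mult_right_mono)
    have "f0 * A \<le> c / 4 * (x - 1)" using big(2) by (simp add: f0_def)
    also have "\<dots> \<le> c / 4 * R" using R c(1) by (intro mult_left_mono) auto
    finally show "f0 * A \<le> c / 4 * R" .
  qed (use x1 in auto)
  finally have "R * (\<Sum>h\<in>I. (cmod (F h))\<^sup>2) \<le> (c / 4 * R) * (real r * x) + (\<Sum>chi\<in>?N. cmod (S chi) * cmod (T chi))"
    by simp
  moreover have "R * (real r * (c * x) / 2) \<le> R * (\<Sum>h\<in>I. (cmod (F h))\<^sup>2)"
    using energy_I R by (intro mult_left_mono) auto
  ultimately have cross: "c / 4 * (R * real r * x) \<le> (\<Sum>chi\<in>?N. cmod (S chi) * cmod (T chi))"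
    by (simp add: algebra_simps)

  define s where "s = (\<Sum>chi\<in>?D. cmod (mixed_sum \<theta> x chi))"
  have s1: "(\<Sum>chi\<in>?N. cmod (S chi))\<^sup>2 \<le> real r * s\<^sup>2"
  proof -
    have "(\<Sum>chi\<in>?N. cmod (S chi)) = sqrt r * (\<Sum>chi\<in>?N. cmod (mixed_sum \<theta> x chi))"
      unfolding sum_distrib_left by (rule sum.cong[OF refl]) (rule nonprincipal)
    also have "\<dots> \<le> sqrt r * s"
      unfolding s_def using finD by (intro mult_left_mono sum_mono2) auto
    finally have "(\<Sum>chi\<in>?N. cmod (S chi))\<^sup>2 \<le> (sqrt r * s)\<^sup>2" by (intro power_mono sum_nonneg) auto
    then show ?thesis by (simp add: power_mult_distrib)
  qed
  have s2: "(\<Sum>chi\<in>?N. (cmod (S chi))\<^sup>2) \<le> R * (real r * (A\<^sup>2 * x))"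
  proof -
    have "(\<Sum>chi\<in>?N. (cmod (S chi))\<^sup>2) \<le> (\<Sum>chi\<in>?D. (cmod (S chi))\<^sup>2)"
      using finD by (intro sum_mono2) auto
    also have "complex_of_real (\<Sum>chi\<in>?D. (cmod (S chi))\<^sup>2) = (\<Sum>chi\<in>?D. S chi * cnj (S chi))"
      by (simp only: of_real_sum complex_norm_square)
    then have "(\<Sum>chi\<in>?D. (cmod (S chi))\<^sup>2) = R * (\<Sum>h\<in>{1..<r}. (cmod (F h))\<^sup>2)"
      using character_linear_moment[OF r, of "{1..<r}" "{1..<r}" "\<lambda>h. cnj (F h)"] coprime_residue[OF r]
      unfolding S_def[symmetric] R_def[symmetric] of_real_eq_iff[where 'a = complex, symmetric]
      by (simp add: cong_def)
    also have "\<dots> \<le> R * (\<Sum>h<r. (cmod (F h))\<^sup>2)" using R by (intro mult_left_mono sum_mono2) auto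
    also have "\<dots> \<le> R * (real r * (A\<^sup>2 * x))"
      unfolding F_def sum_fourier_squared[OF r0] using R x1 by (intro mult_left_mono weight_energy_le) auto
    finally show ?thesis .
  qed
  have s4: "(\<Sum>chi\<in>?N. cmod (T chi) ^ 4) \<le> R * ((A * x) ^ 4 * (J * (L * real r / x)\<^sup>2))"
  proof -
    have "(\<Sum>chi\<in>?N. cmod (T chi) ^ 4) \<le> (\<Sum>chi\<in>?D. cmod (T chi) ^ 4)"
      using finD by (intro sum_mono2) auto
    also have "\<dots> \<le> R * (A * x) ^ 4 * card {(p, q). p \<in> I \<times> I \<and> q \<in> I \<times> I \<and> [fst p * snd q = fst q * snd p] (mod r)}"
      unfolding T_def R_def
    proof (rule character_fourth_moment_le[OF r IX(2)])
      show "cmod (cnj (F n)) \<le> A * x" for n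
        unfolding F_def complex_mod_cnj using x1 by (intro cmod_fourier_le) auto
    qed (use IX(1) coprime_residue[OF r] in blast)
    also have "\<dots> \<le> R * (A * x) ^ 4 * (J * (L * real r / x)\<^sup>2)"
      unfolding I_def J_def using R A_pos x1
      by (intro mult_left_mono card_near_frequency_quadruples_le[OF B \<theta> r x(2,3,1) L(1)]) auto
    finally show ?thesis by (simp only: mult.assoc)
  qed

  define H where "H = 256 * (A ^ 6 * L\<^sup>2 * J)"
  have H: "0 < H" unfolding H_def using A_pos L J by simp
  have "(c / 4 * (R * real r * x)) ^ 4 \<le> (\<Sum>chi\<in>?N. cmod (S chi) * cmod (T chi)) ^ 4"
    using cross c(1) R x1 by (intro power_mono) auto
  also have "\<dots> \<le> (\<Sum>chi\<in>?N. cmod (S chi))\<^sup>2 * (\<Sum>chi\<in>?N. (cmod (S chi))\<^sup>2) * (\<Sum>chi\<in>?N. cmod (T chi) ^ 4)"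
    using finD by (intro sum_mult_fourth_power_le) auto
  also have "\<dots> \<le> (real r * s\<^sup>2) * (R * (real r * (A\<^sup>2 * x))) * (R * ((A * x) ^ 4 * (J * (L * real r / x)\<^sup>2)))"
    using R x1 by (intro mult_mono s1 s2 s4 mult_nonneg_nonneg sum_nonneg) auto
  also have "\<dots> = (H * s\<^sup>2 / 256) * (R\<^sup>2 * real r ^ 4 * x ^ 3)"
    using x1 by (simp add: H_def field_simps power_numeral_reduce)
  also have "(c / 4 * (R * real r * x)) ^ 4 = (c ^ 4 / 256 * (R\<^sup>2 * x)) * (R\<^sup>2 * real r ^ 4 * x ^ 3)"
    by (simp add: field_simps power_numeral_reduce)
  finally have "c ^ 4 / 256 * (R\<^sup>2 * x) \<le> H * s\<^sup>2 / 256"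
  proof (rule mult_right_le_imp_le)
    show "0 < R\<^sup>2 * real r ^ 4 * x ^ 3" using R r0 x1 by simp
  qed
  then have "c ^ 4 / H * (R\<^sup>2 * x) \<le> s\<^sup>2" using H by (simp add: field_simps)
  then show ?thesis by (simp add: H_def J_def R_def s_def)
qed

lemma mixed_sum_first_moment_upper:
  assumes r: "prime r" and x: "0 < x" "x \<le> real r"
  shows "(\<Sum>chi\<in>dirichlet_characters r. cmod (mixed_sum \<theta> x chi)) \<le> (real r - 1) * (A * sqrt x)"
proof -
  have r1: "1 < r" using prime_gt_1_nat[OF r] by auto
  have "(\<Sum>chi\<in>dirichlet_characters r. cmod (mixed_sum \<theta> x chi))\<^sup>2 \<le>
      (\<Sum>chi\<in>dirichlet_characters r. (cmod (mixed_sum \<theta> x chi))\<^sup>2) * real (card (dirichlet_characters r))"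
    by (rule sum_squared_le_sum_of_squares)
  also have "\<dots> = (real r - 1)\<^sup>2 * weight_energy x r"
    unfolding mixed_sum_second_moment[OF r x] card_dirichlet_characters[OF r] using r1
    by (simp add: power2_eq_square of_nat_diff)
  also have "\<dots> \<le> (real r - 1)\<^sup>2 * (A\<^sup>2 * x)" by (intro mult_left_mono weight_energy_le x) auto
  also have "\<dots> = ((real r - 1) * (A * sqrt x))\<^sup>2" using x(1) by (simp add: power_mult_distrib)
  finally show ?thesis by (rule power2_le_imp_le) (use r1 A_pos x in auto)
qed

text \<open>
  The second moment is at most the maximum times the first moment. This loses a factor \<open>\<surd>x\<close>, which is
  harmless for bounded \<open>x\<close>.
\<close>

lemma mixed_sum_first_moment_trivial:
  assumes r: "prime r" and x: "0 < x" "x \<le> real r" and c: "c * x \<le> weight_energy x r"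
  shows "(real r - 1) * (c / A) \<le> (\<Sum>chi\<in>dirichlet_characters r. cmod (mixed_sum \<theta> x chi))"
proof -
  have r1: "1 < r" using prime_gt_1_nat[OF r] by auto
  have bound: "cmod (mixed_sum \<theta> x chi) \<le> A * x" if chi: "chi \<in> dirichlet_characters r" for chi
  proof -
    have "cmod (mixed_sum \<theta> x chi) \<le> (\<Sum>n\<in>{1..<r}. \<bar>w (real n / x)\<bar>)"
      unfolding mixed_sum_eq_residues[OF x]
    proof (rule sum_norm_le)
      fix n
      have "cmod (chi n) \<le> 1" using cmod_dirichlet_character[OF chi, of n] r1 by simp
      then show "cmod (twist \<theta> x n * chi n) \<le> \<bar>w (real n / x)\<bar>"
        by (simp add: norm_mult cmod_twist mult_left_le)
    qed
    also have "\<dots> \<le> (\<Sum>n<r. \<bar>w (real n / x)\<bar>)" by (intro sum_mono2) auto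
    finally show ?thesis using sum_abs_weight_le[OF x(1), of r] by linarith
  qed
  have "(real r - 1) * (c * x) \<le> (\<Sum>chi\<in>dirichlet_characters r. (cmod (mixed_sum \<theta> x chi))\<^sup>2)"
    unfolding mixed_sum_second_moment[OF r x] using c r1 by (intro mult_left_mono) auto
  also have "\<dots> \<le> (\<Sum>chi\<in>dirichlet_characters r. (A * x) * cmod (mixed_sum \<theta> x chi))"
    unfolding power2_eq_square by (intro sum_mono mult_right_mono bound) auto
  also have "\<dots> = (A * (\<Sum>chi\<in>dirichlet_characters r. cmod (mixed_sum \<theta> x chi))) * x"
    by (simp add: sum_distrib_left mult_ac)
  finally have "((real r - 1) * c) * x \<le> (A * (\<Sum>chi\<in>dirichlet_characters r. cmod (mixed_sum \<theta> x chi))) * x"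
    by (simp add: mult_ac)
  then have "(real r - 1) * c \<le> A * (\<Sum>chi\<in>dirichlet_characters r. cmod (mixed_sum \<theta> x chi))"
    using x(1) by simp
  then show ?thesis using A_pos by (simp add: field_simps)
qed

text \<open>
  By continuity, \<open>w\<close> is bounded away from \<open>0\<close> on an interval inside \<open>[0, 1]\<close>, which contains a positive
  proportion of the points \<open>n/x\<close>. The threshold depends on \<open>w\<close> alone.
\<close>

lemma weight_energy_lower:
  assumes "t\<^sub>0 \<in> {0..1}" "w t\<^sub>0 \<noteq> 0"
  obtains c X where "0 < c" "1 \<le> X" "\<And>x r. X \<le> x \<Longrightarrow> x \<le> real r \<Longrightarrow> c * x \<le> weight_energy x r"
proof -
  define \<eta> where "\<eta> = \<bar>w t\<^sub>0\<bar> / 2"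
  define \<delta> where "\<delta> = min (\<eta> / K) (min t\<^sub>0 (1 - t\<^sub>0))"
  have t0: "0 < t\<^sub>0" "t\<^sub>0 < 1" using assms w_outside[of t\<^sub>0] by force+
  have \<eta>: "0 < \<eta>" using assms(2) by (simp add: \<eta>_def)
  have \<delta>: "0 < \<delta>" "\<delta> \<le> t\<^sub>0" "\<delta> \<le> 1 - t\<^sub>0" "K * \<delta> \<le> \<eta>"
  proof -
    show "0 < \<delta>" "\<delta> \<le> t\<^sub>0" "\<delta> \<le> 1 - t\<^sub>0" using \<eta> K_pos t0 by (auto simp: \<delta>_def)
    have "\<delta> \<le> \<eta> / K" by (simp add: \<delta>_def)
    then show "K * \<delta> \<le> \<eta>" using K_pos by (simp add: pos_le_divide_eq mult.commute)
  qed
  have large: "\<eta> \<le> \<bar>w t\<bar>" if "\<bar>t - t\<^sub>0\<bar> \<le> \<delta>" for t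
  proof -
    have "\<bar>w t\<^sub>0 - w t\<bar> \<le> K * \<bar>t\<^sub>0 - t\<bar>" by (rule w_lipschitz)
    also have "\<dots> \<le> K * \<delta>" using that K_pos by (intro mult_left_mono) auto
    finally show ?thesis using \<delta>(4) by (simp add: \<eta>_def)
  qed
  have "\<eta>\<^sup>2 * (\<delta> / 2) * x \<le> weight_energy x r" if x: "max 1 (2 / \<delta>) \<le> x" "x \<le> real r" for x and r :: nat
  proof -
    have x1: "1 \<le> x" "2 \<le> \<delta> * x" using x(1) \<delta>(1) by (auto simp: field_simps)
    define m where "m = nat \<lceil>(t\<^sub>0 - \<delta>) * x\<rceil>"
    define k where "k = nat \<lfloor>\<delta> * x\<rfloor>"
    have m: "(t\<^sub>0 - \<delta>) * x \<le> real m" "real m < (t\<^sub>0 - \<delta>) * x + 1"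
    proof -
      have "0 \<le> (t\<^sub>0 - \<delta>) * x" using \<delta>(2) x1 by (intro mult_nonneg_nonneg) auto
      then show "(t\<^sub>0 - \<delta>) * x \<le> real m" "real m < (t\<^sub>0 - \<delta>) * x + 1"
        unfolding m_def by linarith+
    qed
    have k: "real k \<le> \<delta> * x" "\<delta> * x < real k + 1" using x1 by (auto simp: k_def)
    have mem: "\<bar>real n / x - t\<^sub>0\<bar> \<le> \<delta> \<and> n < r" if n: "n \<in> {m..<m + k}" for n
    proof -
      have "real n + 1 \<le> real m + real k" using n by auto
      then have n': "(t\<^sub>0 - \<delta>) * x \<le> real n" "real n < t\<^sub>0 * x"
        using n m k by (auto simp: algebra_simps)
      have "t\<^sub>0 * x \<le> 1 * x" using t0 x1 by (intro mult_right_mono) auto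
      then have "n < r" using n'(2) x(2) by simp
      moreover have "t\<^sub>0 - \<delta> \<le> real n / x" "real n / x < t\<^sub>0" using n' x1 by (auto simp: field_simps)
      ultimately show ?thesis using \<delta>(1) by auto
    qed
    have "\<eta>\<^sup>2 * (\<delta> / 2) * x \<le> \<eta>\<^sup>2 * real k"
      using k x1 \<eta> by (simp add: mult.assoc)
    also have "\<dots> = (\<Sum>n\<in>{m..<m + k}. \<eta>\<^sup>2)" by simp
    also have "\<dots> \<le> (\<Sum>n\<in>{m..<m + k}. (w (real n / x))\<^sup>2)"
    proof (rule sum_mono)
      fix n assume "n \<in> {m..<m + k}"
      then have "\<eta> \<le> \<bar>w (real n / x)\<bar>" using mem large by blast
      then have "\<eta>\<^sup>2 \<le> \<bar>w (real n / x)\<bar>\<^sup>2" using \<eta> by (intro power_mono) auto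
      then show "\<eta>\<^sup>2 \<le> (w (real n / x))\<^sup>2" by simp
    qed
    also have "\<dots> \<le> weight_energy x r"
      unfolding weight_energy_def using mem by (intro sum_mono2) auto
    finally show ?thesis .
  qed
  then show ?thesis using that[of "\<eta>\<^sup>2 * (\<delta> / 2)" "max 1 (2 / \<delta>)"] \<eta> \<delta>(1) by auto
qed

theorem mixed_sum_first_moment:
  assumes \<theta>: "\<theta> \<notin> \<rat>" and B: "bounded_pair_sums \<theta> B"
    and c: "0 < c" "1 \<le> X" "\<And>x r. X \<le> x \<Longrightarrow> x \<le> real r \<Longrightarrow> c * x \<le> weight_energy x r"
  obtains c\<^sub>1 where "c\<^sub>1 > 0" "\<And>r x. prime r \<Longrightarrow> X \<le> x \<Longrightarrow> x \<le> real r \<Longrightarrow>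
    (real r - 1) * (c\<^sub>1 * sqrt x) \<le> (\<Sum>chi\<in>dirichlet_characters r. cmod (mixed_sum \<theta> x chi))"
proof -
  have \<theta>Z: "\<theta> \<notin> \<int>" using \<theta> Ints_subset_Rats by auto
  \<comment> \<open>Large enough that the tail carries at most a quarter of the mass of the transform.\<close>
  define L where "L = max 1 (K / sqrt c)"
  have L: "1 \<le> L" "3 * K\<^sup>2 / (16 * L\<^sup>2) \<le> c / 4"
  proof -
    show L1: "1 \<le> L" by (simp add: L_def)
    have "K / sqrt c \<le> L" by (simp add: L_def)
    then have "(K / sqrt c)\<^sup>2 \<le> L\<^sup>2" using K_pos c(1) by (intro power_mono) auto
    then have "K\<^sup>2 \<le> c * L\<^sup>2" using c(1) by (simp add: power_divide pos_divide_le_eq mult.commute)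
    moreover have "0 < L\<^sup>2" using L1 by simp
    moreover from this have "0 \<le> c * L\<^sup>2" using c(1) by simp
    ultimately have "3 * K\<^sup>2 \<le> c / 4 * (16 * L\<^sup>2)" by simp
    then show "3 * K\<^sup>2 / (16 * L\<^sup>2) \<le> c / 4" using \<open>0 < L\<^sup>2\<close> by (simp add: pos_divide_le_eq)
  qed
  define f where "f = K / nint_dist \<theta>"
  have f: "0 \<le> f" using K_pos by (simp add: f_def)
  \<comment> \<open>From here on x is large enough for the dual argument; smaller x are treated trivially.\<close>
  define Z where "Z = max (max X (2 * L + 1)) (max (4 * f\<^sup>2 / c) (1 + 4 * f * A / c))"
  have Z: "X \<le> Z" "2 * L + 1 \<le> Z" "4 * f\<^sup>2 / c \<le> Z" "1 + 4 * f * A / c \<le> Z" by (auto simp: Z_def)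
  have Z1: "1 \<le> Z" using Z(1) c(2) by simp
  define k1 where "k1 = c ^ 3 / (A ^ 4 + (A\<^sup>2 + 2 * A * K)\<^sup>2 * B)"
  define k2 where "k2 = c ^ 4 / (256 * (A ^ 6 * L\<^sup>2 * (9 + 8 * (1 + 8 * L\<^sup>2) * (2 + 16 * L ^ 4 * B))))"
  have B0: "0 < B" using B by (simp add: bounded_pair_sums_def)
  have k1: "0 < k1" unfolding k1_def using c(1) A_pos K_pos B0 by (intro divide_pos_pos add_pos_nonneg) auto
  have k2: "0 < k2"
    unfolding k2_def using c(1) A_pos L(1) B0 by (intro divide_pos_pos mult_pos_pos add_pos_nonneg) auto
  define c\<^sub>1 where "c\<^sub>1 = min (c / A / sqrt Z) (min (sqrt k1) (sqrt k2))"
  have c1: "0 < c\<^sub>1" using k1 k2 c(1) A_pos Z1 by (simp add: c\<^sub>1_def)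
  have "(real r - 1) * (c\<^sub>1 * sqrt x) \<le> (\<Sum>chi\<in>dirichlet_characters r. cmod (mixed_sum \<theta> x chi))"
    if r: "prime r" and x: "X \<le> x" "x \<le> real r" for r x
  proof -
    define s where "s = (\<Sum>chi\<in>dirichlet_characters r. cmod (mixed_sum \<theta> x chi))"
    have s0: "0 \<le> s" unfolding s_def by (intro sum_nonneg) auto
    have r1: "0 < real r - 1" using prime_gt_1_nat[OF r] by simp
    have x1: "1 \<le> x" using x(1) c(2) by simp
    have energy: "c * x \<le> weight_energy x r" by (rule c(3)[OF x])
    have from_square: "(real r - 1) * (c\<^sub>1 * sqrt x) \<le> s" if k: "k \<in> {k1, k2}" "k * ((real r - 1)\<^sup>2 * x) \<le> s\<^sup>2" for k
    proof (rule power2_le_imp_le[OF _ s0])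
      have "c\<^sub>1 \<le> sqrt k" using k(1) by (auto simp: c\<^sub>1_def)
      then have "c\<^sub>1\<^sup>2 \<le> (sqrt k)\<^sup>2" using c1 by (intro power_mono) auto
      then have "c\<^sub>1\<^sup>2 \<le> k" using k(1) k1 k2 by auto
      then have "c\<^sub>1\<^sup>2 * ((real r - 1)\<^sup>2 * x) \<le> k * ((real r - 1)\<^sup>2 * x)" using x1 by (intro mult_right_mono) auto
      then show "((real r - 1) * (c\<^sub>1 * sqrt x))\<^sup>2 \<le> s\<^sup>2"
      proof -
        have "((real r - 1) * (c\<^sub>1 * sqrt x))\<^sup>2 = c\<^sub>1\<^sup>2 * ((real r - 1)\<^sup>2 * x)"
          using x1 by (simp add: power_mult_distrib)
        then show ?thesis using k(2) \<open>c\<^sub>1\<^sup>2 * ((real r - 1)\<^sup>2 * x) \<le> k * ((real r - 1)\<^sup>2 * x)\<close> by linarith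
      qed
    qed
    have "(real r - 1) * (c\<^sub>1 * sqrt x) \<le> s"
    proof (cases "x \<le> Z")
      case True
      have "c\<^sub>1 * sqrt x \<le> (c / A / sqrt Z) * sqrt Z"
        using True x1 c(1) A_pos c1 by (intro mult_mono) (auto simp: c\<^sub>1_def)
      then have "c\<^sub>1 * sqrt x \<le> c / A" using Z1 by simp
      then have "(real r - 1) * (c\<^sub>1 * sqrt x) \<le> (real r - 1) * (c / A)" using r1 by (intro mult_left_mono) auto
      also have "\<dots> \<le> s" unfolding s_def using x1 by (intro mixed_sum_first_moment_trivial r x energy) auto
      finally show ?thesis .
    next
      case False
      then have xZ: "Z \<le> x" by simp
      show ?thesis
      proof (cases "x\<^sup>2 \<le> real r")
        case True
        have "k1 * ((real r - 1)\<^sup>2 * x) \<le> s\<^sup>2"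
          unfolding k1_def s_def by (rule mixed_sum_first_moment_small[OF r x1 True x(2) \<theta> B c(1) energy])
        then show ?thesis by (intro from_square) auto
      next
        case False
        have "k2 * ((real r - 1)\<^sup>2 * x) \<le> s\<^sup>2"
          unfolding k2_def s_def
        proof (rule mixed_sum_first_moment_large[OF r \<theta> B L _ x(2) _ c(1) energy])
          show "2 * L < x" using Z(2) xZ by simp
          show "real r \<le> x\<^sup>2" using False by simp
          have "4 * f\<^sup>2 / c \<le> x" "4 * f * A / c \<le> x - 1" using Z(3,4) xZ by auto
          then show "(K / nint_dist \<theta>)\<^sup>2 \<le> c / 4 * x" "K / nint_dist \<theta> * A \<le> c / 4 * (x - 1)"
            using c(1) unfolding f_def[symmetric] by (simp_all add: pos_divide_le_eq) (simp_all add: algebra_simps)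
        qed
        then show ?thesis by (intro from_square) auto
      qed
    qed
    then show ?thesis by (simp add: s_def)
  qed
  then show ?thesis using that c1 by blast
qed

end

text \<open>
  The derivative is bounded on \<open>[0, 1]\<close>; since \<open>w\<close> vanishes elsewhere, moving an argument to the nearest
  point of \<open>[0, 1]\<close> does not change the value of \<open>w\<close> and does not increase distances.
\<close>

lemma smooth_compact_support_lipschitz:
  assumes "smooth w" and supp: "closure {t. w t \<noteq> 0} \<subseteq> {0..1}"
  obtains A K where "lipschitz_weight w A K"
proof -
  have d0: "w field_differentiable at t" for t
    using assms(1) unfolding smooth_def by (metis funpow_0)
  have d1: "deriv w field_differentiable at t" for t
    using assms(1) unfolding smooth_def by (metis funpow_0 funpow_simps_right(2) o_def One_nat_def)
  have w_cont: "continuous_on UNIV w"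
    using field_differentiable_imp_continuous_at[OF d0] by (simp add: continuous_on_eq_continuous_at)
  have w'_cont: "continuous_on UNIV (deriv w)"
    using field_differentiable_imp_continuous_at[OF d1] by (simp add: continuous_on_eq_continuous_at)
  have zero: "w t = 0" if "t \<notin> {0..1}" for t
    using that supp closure_subset[of "{t. w t \<noteq> 0}"] by auto
  have w0: "w t = 0" if "t \<le> 0" for t
  proof (cases "t = 0")
    case True
    have "(w \<longlongrightarrow> w 0) (at_left 0)"
      using w_cont by (simp add: continuous_on_eq_continuous_at continuous_within_subset isCont_def filterlim_at_split)
    moreover have "(w \<longlongrightarrow> 0) (at_left 0)"
      by (rule tendsto_eventually) (auto simp: eventually_at_filter zero)
    ultimately show ?thesis using True tendsto_unique[of "at_left (0::real)"] by auto
  qed (use that zero in auto)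
  have w1: "w t = 0" if "1 \<le> t" for t
  proof (cases "t = 1")
    case True
    have "(w \<longlongrightarrow> w 1) (at_right 1)"
      using w_cont by (simp add: continuous_on_eq_continuous_at isCont_def filterlim_at_split)
    moreover have "(w \<longlongrightarrow> 0) (at_right 1)"
      by (rule tendsto_eventually) (auto simp: eventually_at_filter zero)
    ultimately show ?thesis using True tendsto_unique[of "at_right (1::real)"] by auto
  qed (use that zero in auto)
  have "bounded (w ` {0..1})" "bounded (deriv w ` {0..1})"
    using w_cont w'_cont by (auto intro!: compact_imp_bounded compact_continuous_image intro: continuous_on_subset)
  then obtain A K where "A > 0" "\<forall>y\<in>w ` {0..1}. norm y \<le> A" "K > 0" "\<forall>y\<in>deriv w ` {0..1}. norm y \<le> K"
    unfolding bounded_pos by blast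
  then have A: "\<And>t. t \<in> {0..1} \<Longrightarrow> \<bar>w t\<bar> \<le> A" "A > 0"
      and K: "\<And>t. t \<in> {0..1} \<Longrightarrow> \<bar>deriv w t\<bar> \<le> K" "K > 0"
    by auto
  have lip01: "\<bar>w s - w t\<bar> \<le> K * \<bar>s - t\<bar>" if "s \<in> {0..1}" "t \<in> {0..1}" for s t
  proof -
    have "norm (w s - w t) \<le> K * norm (s - t)"
    proof (rule field_differentiable_bound[of "{0..1}" w "deriv w"])
      fix z :: real
      show "(w has_field_derivative deriv w z) (at z within {0..1})"
        using d0[of z] by (simp add: DERIV_deriv_iff_field_differentiable has_field_derivative_at_within)
    qed (use that K in auto)
    then show ?thesis by simp
  qed
  have clamp: "w t = w (max 0 (min 1 t))" for t using w0 w1 by (simp add: max_def min_def)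
  have "lipschitz_weight w A K"
  proof
    show "\<bar>w t\<bar> \<le> A" for t by (subst clamp) (rule A(1), auto)
    show "\<bar>w s - w t\<bar> \<le> K * \<bar>s - t\<bar>" for s t
    proof -
      have "\<bar>w s - w t\<bar> \<le> K * \<bar>max 0 (min 1 s) - max 0 (min 1 t)\<bar>"
        unfolding clamp[of s] clamp[of t] by (rule lip01) auto
      also have "\<dots> \<le> K * \<bar>s - t\<bar>" using K(2) by (intro mult_left_mono) auto
      finally show ?thesis .
    qed
    show "w t = 0" if "t \<le> 0 \<or> 1 \<le> t" for t using that w0 w1 by blast
  qed (use A K in auto)
  then show ?thesis using that by blast
qed

theorem theorem1p1:
  fixes w :: "real \<Rightarrow> real"
  assumes "smooth w"
    and "closure {t. w t \<noteq> 0} \<subseteq> {0..1}"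
    and "integral {0..1} (\<lambda>t. (w t)\<^sup>2) > 0"
  shows "\<exists>x\<^sub>0::real. x\<^sub>0 > 0 \<and>
    (\<forall>\<theta>::real. \<theta> \<notin> \<rat> \<longrightarrow>
      (\<exists>C::real. C > 0 \<and>
        (\<forall>q::nat. q > 0 \<longrightarrow> nint_dist (real q * \<theta>) \<ge> C * exp (- (real q powr (1/4))))) \<longrightarrow>
      (\<exists>c\<^sub>1 c\<^sub>2 :: real. c\<^sub>1 > 0 \<and> c\<^sub>2 > 0 \<and>
        (\<forall>(r::nat) (x::real). prime r \<longrightarrow> x\<^sub>0 \<le> x \<longrightarrow> x \<le> real r \<longrightarrow>
          c\<^sub>1 * sqrt x \<le>
            1 / (real r - 1) * (\<Sum>chi \<in> dirichlet_characters r.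
              cmod (\<Sum>n | 1 \<le> n \<and> real n \<le> x.
                chi n * e (real n * \<theta>) * complex_of_real (w (real n / x)))) \<and>
          1 / (real r - 1) * (\<Sum>chi \<in> dirichlet_characters r.
              cmod (\<Sum>n | 1 \<le> n \<and> real n \<le> x.
                chi n * e (real n * \<theta>) * complex_of_real (w (real n / x))))
            \<le> c\<^sub>2 * sqrt x)))"
proof -
  obtain A K where "lipschitz_weight w A K"
    using smooth_compact_support_lipschitz[OF assms(1,2)] by blast
  then interpret lipschitz_weight w A K .
  obtain t\<^sub>0 where t0: "t\<^sub>0 \<in> {0..1}" "w t\<^sub>0 \<noteq> 0"
  proof -
    have "\<exists>t\<in>{0..1}. w t \<noteq> 0"
    proof (rule ccontr)
      assume *: "\<not> (\<exists>t\<in>{0..1}. w t \<noteq> 0)"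
      have "((\<lambda>t. (w t)\<^sup>2) has_integral 0) {0..1}"
        by (rule has_integral_is_0) (use * in auto)
      then show False using assms(3) by (simp add: integral_unique)
    qed
    then show ?thesis using that by blast
  qed
  obtain c X where cX: "0 < c" "1 \<le> X" "\<And>x r. X \<le> x \<Longrightarrow> x \<le> real r \<Longrightarrow> c * x \<le> weight_energy x r"
    using weight_energy_lower[OF t0] by blast
  show ?thesis
  proof (rule exI[of _ X], intro conjI allI impI)
    show "0 < X" using cX(2) by simp
    fix \<theta> :: real
    assume \<theta>: "\<theta> \<notin> \<rat>"
      and "\<exists>C>0. \<forall>q::nat. 0 < q \<longrightarrow> C * exp (- (real q powr (1/4))) \<le> nint_dist (real q * \<theta>)"
    then obtain C where C: "C > 0" "\<And>q::nat. 0 < q \<Longrightarrow> C * exp (- (real q powr (1/4))) \<le> nint_dist (real q * \<theta>)"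
      by blast
    obtain B where "bounded_pair_sums \<theta> B"
      using diophantine_pair_sum_bounded[OF C] by blast
    from mixed_sum_first_moment[OF \<theta> this cX]
    obtain c\<^sub>1 where c1: "c\<^sub>1 > 0" "\<And>r x. prime r \<Longrightarrow> X \<le> x \<Longrightarrow> x \<le> real r \<Longrightarrow>
        (real r - 1) * (c\<^sub>1 * sqrt x) \<le> (\<Sum>chi\<in>dirichlet_characters r. cmod (mixed_sum \<theta> x chi))"
      by blast
    show "\<exists>c\<^sub>1 c\<^sub>2 :: real. c\<^sub>1 > 0 \<and> c\<^sub>2 > 0 \<and>
        (\<forall>(r::nat) (x::real). prime r \<longrightarrow> X \<le> x \<longrightarrow> x \<le> real r \<longrightarrow>
          c\<^sub>1 * sqrt x \<le>
            1 / (real r - 1) * (\<Sum>chi \<in> dirichlet_characters r.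
              cmod (\<Sum>n | 1 \<le> n \<and> real n \<le> x.
                chi n * e (real n * \<theta>) * complex_of_real (w (real n / x)))) \<and>
          1 / (real r - 1) * (\<Sum>chi \<in> dirichlet_characters r.
              cmod (\<Sum>n | 1 \<le> n \<and> real n \<le> x.
                chi n * e (real n * \<theta>) * complex_of_real (w (real n / x))))
            \<le> c\<^sub>2 * sqrt x)"
      unfolding mixed_sum_def[symmetric]
    proof (rule exI[of _ c\<^sub>1], rule exI[of _ A], intro conjI allI impI c1(1) A_pos)
      fix r :: nat and x :: real
      assume r: "prime r" and x: "X \<le> x" "x \<le> real r"
      have r1: "0 < real r - 1" using prime_gt_1_nat[OF r] by simp
      show "c\<^sub>1 * sqrt x \<le> 1 / (real r - 1) * (\<Sum>chi \<in> dirichlet_characters r. cmod (mixed_sum \<theta> x chi))"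
        using c1(2)[OF r x] r1 by (simp add: pos_le_divide_eq mult.commute)
      show "1 / (real r - 1) * (\<Sum>chi \<in> dirichlet_characters r. cmod (mixed_sum \<theta> x chi)) \<le> A * sqrt x"
        using mixed_sum_first_moment_upper[OF r _ x(2), of \<theta>] x(1) cX(2) r1
        by (simp add: pos_divide_le_eq mult.commute)
    qed
  qed
qed

end
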